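(* Let $\Gamma$ be a rank $2$ lattice with a skew-symmetric form $\langle\cdot,\cdot\rangle:\Gamma\times\Gamma\to\mathbb Z$ and a basis $(e_1,e_2)$ with $\langle e_1,e_2\rangle>0$. Let $\Gamma_+=\mathbb N e_1+\mathbb N e_2$ and $\Gamma_+^*=\Gamma_+\setminus\{0\}$. Let $(\bar\Omega^+_\gamma)_{\gamma\in\Gamma_+^*}$ and $(\bar\Omega^-_\gamma)_{\gamma\in\Gamma_+^*}$ be two families of elements of $\mathcal V$, and for finitely supported nonzero $m:\Gamma_+^*\to\mathbb N$ let $g(m)$ be the abelian quiver invariants defined in the context. Then the following are equivalent. (KS) In the quantum torus of $(\Gamma,\langle\cdot,\cdot\rangle)$, $$\prod^{\curvearrowright}_l\exp\left(\frac{\sum_{\gamma\in l\cap\Gamma}\bar\Omega^+_\gamma x^\gamma}{q^{1/2}-q^{-1/2}}\right)=\prod^{\curvearrowleft}_l\exp\left(\frac{\sum_{\gamma\in l\cap\Gamma}\bar\Omega^-_\gamma x^\gamma}{q^{1/2}-q^{-1/2}}\right),$$ where both products run over the rays $l=\mathbb R_{>0}\gamma$, $\gamma\in\Gamma_+^*$, the left one being taken in clockwise order and the right one in anticlockwise order. (MPS) For every $\gamma\in\Gamma_+^*$, $$\bar\Omega^+_\gamma=\sum_{m:\Gamma_+^*\to\mathbb N,\ \|m\|=\gamma}\frac{g(m)}{m!}\prod_{\alpha\in\Gamma_+^*}(\bar\Omega^-_\alpha)^{m(\alpha)}.$$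
   Context: $\mathbb N=\{0,1,2,\dots\}$. $K_0(\mathrm{Var}_{\mathbb C})$ is the Grothendieck ring of complex varieties, $\mathbb L=[\mathbb A^1]$ is also denoted by $q$, and $\mathcal V=K_0(\mathrm{Var}_{\mathbb C})\otimes_{\mathbb Z[\mathbb L]}\mathbb Q(\mathbb L^{1/2})$. Quantum torus of $(\Gamma,\langle\cdot,\cdot\rangle)$: formal series $\sum_{\gamma\in\Gamma_+}c_\gamma x^\gamma$ with $c_\gamma\in\mathcal V$, with multiplication $x^\alpha\circ x^\beta=q^{\frac12\langle\alpha,\beta\rangle}x^{\alpha+\beta}$. Infinite ordered products are taken coefficientwise. Identify $\Gamma\otimes\mathbb R$ with $\mathbb R^2$ via $(e_1,e_2)$, so all rays lie in the closed first quadrant. Clockwise order means that the factors are written from left to right starting at the ray of $e_2$ and ending at the ray of $e_1$; anticlockwise order is the reverse. For finitely supported $m:\Gamma_+^*\to\mathbb N$ put $\|m\|=\sum_\alpha m(\alpha)\alpha\in\Gamma_+$ and $m!=\prod_\alpha m(\alpha)!$; sums over $m$ are over finitely supported $m$. Write $|m|=\sum_\alpha m(\alpha)$. The quiver $Q(m)$: its vertices are $\alpha_k$ with $\alpha\in\Gamma_+^*$, $1\le k\le m(\alpha)$; the number of arrows from $\alpha_k$ to $\beta_{k'}$ is $\langle\beta,\alpha\rangle$ if $\langle\beta,\alpha\rangle>0$ and $0$ otherwise. An abelian representation of $Q(m)$ is a representation over $\mathbb C$ of dimension one at every vertex; these form the affine space $R(Q(m))=\mathbb C^{Q(m)_1}$,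 where $Q(m)_1$ is the set of arrows. For a representation $N$ of $Q(m)$ put $\mathrm{cl}(N)=\sum_{\alpha_k}\dim(N_{\alpha_k})\,\alpha\in\Gamma_+$. Semistability is taken with respect to any stability function $Z:\Gamma\to\mathbb C$, $Z(e_i)=-d_i+\sqrt{-1}\,r_i$ in $\{re^{i\pi\varphi}:r>0,0<\varphi\le1\}$, with slopes $\mu_Z(e_1)<\mu_Z(e_2)$ where $\mu_Z(a_1e_1+a_2e_2)=\frac{d_1a_1+d_2a_2}{r_1a_1+r_2a_2}$ (value $\infty$ if the denominator is $0$); for such $Z$ one has $\mu_Z(\alpha)\le\mu_Z(\beta)$ iff $\langle\alpha,\beta\rangle\ge0$. An abelian representation $M$ is semistable if $\mu_Z(\mathrm{cl}(N))\le\mu_Z(\mathrm{cl}(M))$ (equivalently $\langle \mathrm{cl}(N),\mathrm{cl}(M)\rangle\ge0$) for every nonzero proper subrepresentation $N\subset M$. Let $R_+(Q(m))\subset R(Q(m))$ be the semistable locus and $$f_+(m)=q^{\frac12(|m|-|Q(m)_1|)}\frac{[R_+(Q(m))]}{(q-1)^{|m|}}\in\mathcal V .$$ The invariants $g(m)$ are defined, for each ray $l=\mathbb R_{>0}\gamma$ with $\gamma\in\Gamma_+^*$, by $$1+\sum_{\|m\|\in l}f_+(m)\frac{x^m}{m!}=\exp\Bigg(\frac{\sum_{\|m\|\in l}g(m)\frac{x^m}{m!}}{q^{1/2}-q^{-1/2}}\Bigg)$$ in the commutative power series ring over $\mathcal V$ in variables $x_\alpha$, $\alpha\in\Gamma_+^*$,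 where $x^m=\prod_\alpha x_\alpha^{m(\alpha)}$. *)

theory Defs
  imports "HOL-Analysis.Analysis" "HOL-Library.Poly_Mapping" "HOL-Library.Groups_Big_Fun"
    "HOL-Library.Countable_Set" "HOL-Computational_Algebra.Polynomial_Factorial"
begin

section \<open>Complex varieties\<close>

text \<open>
  Varieties are taken in the sense of Serre's FAC: reduced, separated schemes of finite type over
  the complex numbers, given as spaces with a sheaf of complex valued functions. They need not be
  irreducible. A variety has at most continuum many points, so every variety is isomorphic to
  one whose points lie in the type \<open>nat \<Rightarrow> complex\<close>, and we only use those. The number
  of coordinates in use is finite for affine space, but an abstract variety is any subset of
  the type with any topology and sheaf.
\<close>

type_synonym point = "nat \<Rightarrow> complex"

definition affine_points :: "nat \<Rightarrow> point set" where
  "affine_points n = {x. \<forall>i\<ge>n. x i = 0}"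

inductive poly_fun :: "nat \<Rightarrow> (point \<Rightarrow> complex) \<Rightarrow> bool" for n where
  const: "poly_fun n (\<lambda>x. c)"
| coord: "i < n \<Longrightarrow> poly_fun n (\<lambda>x. x i)"
| add: "poly_fun n p \<Longrightarrow> poly_fun n r \<Longrightarrow> poly_fun n (\<lambda>x. p x + r x)"
| mult: "poly_fun n p \<Longrightarrow> poly_fun n r \<Longrightarrow> poly_fun n (\<lambda>x. p x * r x)"

definition zariski_open :: "nat \<Rightarrow> point set \<Rightarrow> bool" where
  "zariski_open n U \<longleftrightarrow>
    (\<exists>P. (\<forall>p\<in>P. poly_fun n p) \<and> U = affine_points n - {x. \<forall>p\<in>P. p x = 0})"

definition zariski :: "nat \<Rightarrow> point topology" where
  "zariski n = topology (zariski_open n)"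

lemma istopology_zariski_open: "istopology (zariski_open n)"
  unfolding istopology_def
proof (intro conjI allI impI)
  fix S T assume "zariski_open n S" "zariski_open n T"
  then obtain P Q where
    P: "\<And>p. p \<in> P \<Longrightarrow> poly_fun n p" "S = affine_points n - {x. \<forall>p\<in>P. p x = 0}" and
    Q: "\<And>p. p \<in> Q \<Longrightarrow> poly_fun n p" "T = affine_points n - {x. \<forall>p\<in>Q. p x = 0}"
    unfolding zariski_open_def by auto
  define R where "R = (\<lambda>(p, r) x. p x * r x) ` (P \<times> Q)"
  have "S \<inter> T = affine_points n - {x. \<forall>h\<in>R. h x = 0}"
    unfolding P(2) Q(2) R_def by auto
  moreover have "\<forall>h\<in>R. poly_fun n h"
    unfolding R_def by (auto intro: poly_fun.mult P(1) Q(1))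
  ultimately show "zariski_open n (S \<inter> T)"
    unfolding zariski_open_def by (intro exI[of _ R] conjI)
next
  fix K assume K: "\<forall>S\<in>K. zariski_open n S"
  define R where "R = {p. poly_fun n p \<and> (\<forall>x\<in>affine_points n. p x \<noteq> 0 \<longrightarrow> x \<in> \<Union>K)}"
  have "\<Union>K \<subseteq> affine_points n - {x. \<forall>h\<in>R. h x = 0}"
  proof
    fix x assume "x \<in> \<Union>K"
    then obtain S where S: "S \<in> K" "x \<in> S" by (rule UnionE)
    from K S(1) have "zariski_open n S" by (rule bspec)
    then obtain P where P: "\<forall>p\<in>P. poly_fun n p" "S = affine_points n - {x. \<forall>p\<in>P. p x = 0}"
      unfolding zariski_open_def by (elim exE conjE)
    from S(2) obtain p where p: "x \<in> affine_points n" "p \<in> P" "p x \<noteq> 0"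
      unfolding P(2) by auto
    have "p \<in> R"
      unfolding R_def
    proof (intro CollectI conjI ballI impI)
      show "poly_fun n p" using P(1) p(2) by (rule bspec)
      fix y assume "y \<in> affine_points n" "p y \<noteq> 0"
      with p(2) have "y \<in> S" unfolding P(2) by auto
      with S(1) show "y \<in> \<Union>K" by (rule UnionI)
    qed
    with p show "x \<in> affine_points n - {x. \<forall>h\<in>R. h x = 0}" by auto
  qed
  moreover have "affine_points n - {x. \<forall>h\<in>R. h x = 0} \<subseteq> \<Union>K"
    unfolding R_def by auto
  ultimately have "\<Union>K = affine_points n - {x. \<forall>h\<in>R. h x = 0}"
    by (rule equalityI)
  moreover have "\<forall>h\<in>R. poly_fun n h"
    unfolding R_def by simp
  ultimately show "zariski_open n (\<Union>K)"
    unfolding zariski_open_def by (intro exI[of _ R] conjI)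
qed

lemma openin_zariski: "openin (zariski n) = zariski_open n"
  unfolding zariski_def by (rule topology_inverse'[OF istopology_zariski_open])

text \<open>
  In a space with functions, \<open>regular X U f\<close> says that \<open>U\<close> is open and that the restriction of
  \<open>f\<close> to \<open>U\<close> is a section over \<open>U\<close>; the values of \<open>f\<close> outside \<open>U\<close> are irrelevant.
\<close>

record fspace =
  zar :: "point topology"
  regular :: "point set \<Rightarrow> (point \<Rightarrow> complex) \<Rightarrow> bool"

abbreviation points :: "fspace \<Rightarrow> point set" where
  "points X \<equiv> topspace (zar X)"

definition function_sheaf :: "fspace \<Rightarrow> bool" where
  "function_sheaf X \<longleftrightarrow>
    (\<forall>U f. regular X U f \<longrightarrow> openin (zar X) U) \<and>
    (\<forall>U f g. regular X U f \<longrightarrow> (\<forall>x\<in>U. f x = g x) \<longrightarrow> regular X U g) \<and>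
    (\<forall>U W f. regular X U f \<longrightarrow> openin (zar X) W \<longrightarrow> W \<subseteq> U \<longrightarrow> regular X W f) \<and>
    (\<forall>U f. openin (zar X) U \<longrightarrow> (\<forall>x\<in>U. \<exists>W. x \<in> W \<and> W \<subseteq> U \<and> regular X W f) \<longrightarrow> regular X U f)"

definition affine_space :: "nat \<Rightarrow> fspace" where
  "affine_space n = \<lparr>zar = zariski n,
    regular = (\<lambda>U f. openin (zariski n) U \<and>
      (\<forall>x\<in>U. \<exists>W p r. openin (zariski n) W \<and> x \<in> W \<and> W \<subseteq> U \<and> poly_fun n p \<and> poly_fun n r \<and>
        (\<forall>y\<in>W. r y \<noteq> 0 \<and> f y = p y / r y)))\<rparr>"

text \<open>
  The structure induced on a subset: sections are the functions which are locally restrictions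
  of sections of the ambient space. On open subsets this is the restricted sheaf, on closed
  subsets it is the reduced closed subvariety.
\<close>

definition induced :: "fspace \<Rightarrow> point set \<Rightarrow> fspace" where
  "induced X S = \<lparr>zar = subtopology (zar X) S,
    regular = (\<lambda>U f. openin (subtopology (zar X) S) U \<and>
      (\<forall>x\<in>U. \<exists>W g. regular X W g \<and> x \<in> W \<and> W \<inter> S \<subseteq> U \<and> (\<forall>y\<in>W \<inter> S. f y = g y)))\<rparr>"

definition morphism :: "fspace \<Rightarrow> fspace \<Rightarrow> (point \<Rightarrow> point) \<Rightarrow> bool" where
  "morphism X Y \<phi> \<longleftrightarrow> continuous_map (zar X) (zar Y) \<phi> \<and>
    (\<forall>V f. regular Y V f \<longrightarrow> regular X {x \<in> points X. \<phi> x \<in> V} (f \<circ> \<phi>))"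

definition isomorphic :: "fspace \<Rightarrow> fspace \<Rightarrow> bool" where
  "isomorphic X Y \<longleftrightarrow> (\<exists>\<phi> \<psi>. morphism X Y \<phi> \<and> morphism Y X \<psi> \<and>
    (\<forall>x\<in>points X. \<psi> (\<phi> x) = x) \<and> (\<forall>y\<in>points Y. \<phi> (\<psi> y) = y))"

definition affine_variety :: "fspace \<Rightarrow> bool" where
  "affine_variety X \<longleftrightarrow> function_sheaf X \<and>
    (\<exists>n S. closedin (zariski n) S \<and> isomorphic X (induced (affine_space n) S))"

text \<open>
  Separatedness is expressed by equalizers of maps from affine varieties being closed, which
  avoids products; it is equivalent to the diagonal being closed.
\<close>

definition is_variety :: "fspace \<Rightarrow> bool" where
  "is_variety X \<longleftrightarrow> function_sheaf X \<and>
    (\<exists>\<C>. finite \<C> \<and> \<Union>\<C> = points X \<and>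
      (\<forall>U\<in>\<C>. openin (zar X) U \<and> affine_variety (induced X U))) \<and>
    (\<forall>T \<phi> \<psi>. affine_variety T \<longrightarrow> morphism T X \<phi> \<longrightarrow> morphism T X \<psi> \<longrightarrow>
      closedin (zar T) {t \<in> points T. \<phi> t = \<psi> t})"

lemma regular_open: "function_sheaf X \<Longrightarrow> regular X U f \<Longrightarrow> openin (zar X) U"
  unfolding function_sheaf_def by meson

lemma regular_restrict:
  "function_sheaf X \<Longrightarrow> regular X U f \<Longrightarrow> openin (zar X) W \<Longrightarrow> W \<subseteq> U \<Longrightarrow> regular X W f"
  unfolding function_sheaf_def by meson

lemma topspace_zariski: "topspace (zariski n) = affine_points n"
proof -
  have "zariski_open n (affine_points n)"
    unfolding zariski_open_def by (rule exI[of _ "{\<lambda>_. 1}"]) (auto intro: poly_fun.const)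
  moreover have "U \<subseteq> affine_points n" if "zariski_open n U" for U
    using that unfolding zariski_open_def by auto
  ultimately show ?thesis
    unfolding topspace_def openin_zariski by blast
qed

lemma function_sheaf_affine_space: "function_sheaf (affine_space n)"
  unfolding function_sheaf_def
proof (intro conjI allI impI)
  fix U f assume "regular (affine_space n) U f"
  then show "openin (zar (affine_space n)) U" by (simp add: affine_space_def)
next
  fix U f g assume f: "regular (affine_space n) U f" and fg: "\<forall>x\<in>U. f x = g x"
  show "regular (affine_space n) U g"
    unfolding affine_space_def fspace.simps
  proof (intro conjI ballI)
    show "openin (zariski n) U" using f by (simp add: affine_space_def)
    fix x assume "x \<in> U"
    with f obtain W p r where "openin (zariski n) W" "x \<in> W" "W \<subseteq> U" "poly_fun n p" "poly_fun n r"
      "\<forall>y\<in>W. r y \<noteq> 0 \<and> f y = p y / r y"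
      unfolding affine_space_def fspace.simps by meson
    moreover from this fg have "\<forall>y\<in>W. r y \<noteq> 0 \<and> g y = p y / r y" by (metis subsetD)
    ultimately show "\<exists>W p r. openin (zariski n) W \<and> x \<in> W \<and> W \<subseteq> U \<and> poly_fun n p \<and> poly_fun n r \<and>
        (\<forall>y\<in>W. r y \<noteq> 0 \<and> g y = p y / r y)"
      by blast
  qed
next
  fix U V f assume f: "regular (affine_space n) U f" and V: "openin (zar (affine_space n)) V" "V \<subseteq> U"
  show "regular (affine_space n) V f"
    unfolding affine_space_def fspace.simps
  proof (intro conjI ballI)
    show oV: "openin (zariski n) V" using V by (simp add: affine_space_def)
    fix x assume "x \<in> V"
    with V(2) have "x \<in> U" by blast
    with f obtain W p r where "openin (zariski n) W" "x \<in> W" "W \<subseteq> U" "poly_fun n p" "poly_fun n r"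
      "\<forall>y\<in>W. r y \<noteq> 0 \<and> f y = p y / r y"
      unfolding affine_space_def fspace.simps by meson
    moreover from this oV have "openin (zariski n) (W \<inter> V)" by (simp add: openin_Int)
    ultimately show "\<exists>W p r. openin (zariski n) W \<and> x \<in> W \<and> W \<subseteq> V \<and> poly_fun n p \<and> poly_fun n r \<and>
        (\<forall>y\<in>W. r y \<noteq> 0 \<and> f y = p y / r y)"
      using \<open>x \<in> V\<close> by (meson IntD1 IntI inf_le2)
  qed
next
  fix U f assume U: "openin (zar (affine_space n)) U"
    and loc: "\<forall>x\<in>U. \<exists>W. x \<in> W \<and> W \<subseteq> U \<and> regular (affine_space n) W f"
  show "regular (affine_space n) U f"
    unfolding affine_space_def fspace.simps
  proof (intro conjI ballI)
    show "openin (zariski n) U" using U by (simp add: affine_space_def)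
    fix x assume "x \<in> U"
    with loc obtain V where V: "x \<in> V" "V \<subseteq> U" "regular (affine_space n) V f" by blast
    then obtain W p r where "openin (zariski n) W" "x \<in> W" "W \<subseteq> V" "poly_fun n p" "poly_fun n r"
      "\<forall>y\<in>W. r y \<noteq> 0 \<and> f y = p y / r y"
      unfolding affine_space_def fspace.simps by meson
    with V(2) show "\<exists>W p r. openin (zariski n) W \<and> x \<in> W \<and> W \<subseteq> U \<and> poly_fun n p \<and> poly_fun n r \<and>
        (\<forall>y\<in>W. r y \<noteq> 0 \<and> f y = p y / r y)"
      by (meson subset_trans)
  qed
qed

lemma function_sheaf_induced:
  assumes "function_sheaf X" shows "function_sheaf (induced X S)"
  unfolding function_sheaf_def
proof (intro conjI allI impI)
  fix U f assume "regular (induced X S) U f"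
  then show "openin (zar (induced X S)) U" by (simp add: induced_def)
next
  fix U f g assume f: "regular (induced X S) U f" and fg: "\<forall>x\<in>U. f x = g x"
  show "regular (induced X S) U g"
    unfolding induced_def fspace.simps
  proof (intro conjI ballI)
    show "openin (subtopology (zar X) S) U" using f by (simp add: induced_def)
    fix x assume "x \<in> U"
    with f obtain W h where "regular X W h" "x \<in> W" "W \<inter> S \<subseteq> U" "\<forall>y\<in>W \<inter> S. f y = h y"
      unfolding induced_def fspace.simps by meson
    moreover from this fg have "\<forall>y\<in>W \<inter> S. g y = h y" by (metis subsetD)
    ultimately show "\<exists>W h. regular X W h \<and> x \<in> W \<and> W \<inter> S \<subseteq> U \<and> (\<forall>y\<in>W \<inter> S. g y = h y)"
      by blast
  qed
next
  fix U V f assume f: "regular (induced X S) U f"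
    and V: "openin (zar (induced X S)) V" "V \<subseteq> U"
  show "regular (induced X S) V f"
    unfolding induced_def fspace.simps
  proof (intro conjI ballI)
    show oV: "openin (subtopology (zar X) S) V" using V by (simp add: induced_def)
    then obtain V' where V': "openin (zar X) V'" "V = V' \<inter> S"
      by (auto simp: openin_subtopology)
    fix x assume x: "x \<in> V"
    with V(2) have "x \<in> U" by blast
    with f obtain W h where W: "regular X W h" "x \<in> W" "W \<inter> S \<subseteq> U" "\<forall>y\<in>W \<inter> S. f y = h y"
      unfolding induced_def fspace.simps by meson
    have "openin (zar X) (W \<inter> V')"
      using regular_open[OF assms W(1)] V'(1) by (rule openin_Int)
    then have "regular X (W \<inter> V') h"
      by (rule regular_restrict[OF assms W(1)]) simp
    moreover have "x \<in> W \<inter> V'" "(W \<inter> V') \<inter> S \<subseteq> V" "\<forall>y\<in>(W \<inter> V') \<inter> S. f y = h y"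
      using W x V'(2) by blast+
    ultimately show "\<exists>W h. regular X W h \<and> x \<in> W \<and> W \<inter> S \<subseteq> V \<and> (\<forall>y\<in>W \<inter> S. f y = h y)"
      by blast
  qed
next
  fix U f assume U: "openin (zar (induced X S)) U"
    and loc: "\<forall>x\<in>U. \<exists>W. x \<in> W \<and> W \<subseteq> U \<and> regular (induced X S) W f"
  show "regular (induced X S) U f"
    unfolding induced_def fspace.simps
  proof (intro conjI ballI)
    show "openin (subtopology (zar X) S) U" using U by (simp add: induced_def)
    fix x assume "x \<in> U"
    with loc obtain V where V: "x \<in> V" "V \<subseteq> U" "regular (induced X S) V f" by blast
    then obtain W h where "regular X W h" "x \<in> W" "W \<inter> S \<subseteq> V" "\<forall>y\<in>W \<inter> S. f y = h y"
      unfolding induced_def fspace.simps by meson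
    with V(2) show "\<exists>W h. regular X W h \<and> x \<in> W \<and> W \<inter> S \<subseteq> U \<and> (\<forall>y\<in>W \<inter> S. f y = h y)"
      by (meson subset_trans)
  qed
qed

lemma isomorphic_refl:
  assumes "function_sheaf X" shows "isomorphic X X"
proof -
  have "{x \<in> points X. x \<in> V} = V" if "regular X V f" for V f
    using openin_subset[OF regular_open[OF assms that]] by blast
  then have "morphism X X (\<lambda>x. x)"
    unfolding morphism_def by (auto simp: o_def)
  then show ?thesis
    unfolding isomorphic_def by (intro exI[of _ "\<lambda>x. x"]) simp
qed

lemma morphism_points: "morphism X Y \<phi> \<Longrightarrow> x \<in> points X \<Longrightarrow> \<phi> x \<in> points Y"
  unfolding morphism_def continuous_map_def by blast

lemma regular_pullback:
  assumes "morphism X Y \<phi>" "regular Y (points Y) f"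
  shows "regular X (points X) (\<lambda>x. f (\<phi> x))"
proof -
  have "regular X {x \<in> points X. \<phi> x \<in> points Y} (f \<circ> \<phi>)"
    using assms unfolding morphism_def by blast
  moreover have "{x \<in> points X. \<phi> x \<in> points Y} = points X"
    using morphism_points[OF assms(1)] by blast
  ultimately show ?thesis by (simp only: o_def)
qed

lemma affine_neq_open:
  assumes T: "affine_variety T" and f: "regular T (points T) f" and g: "regular T (points T) g"
  shows "openin (zar T) {t \<in> points T. f t \<noteq> g t}"
proof -
  from T obtain n S \<alpha> \<beta> where
    \<alpha>: "morphism T (induced (affine_space n) S) \<alpha>" and
    \<beta>: "morphism (induced (affine_space n) S) T \<beta>" and
    inv: "\<forall>x\<in>points T. \<beta> (\<alpha> x) = x"
    unfolding affine_variety_def isomorphic_def by blast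
  let ?I = "induced (affine_space n) S"
  let ?D = "{y \<in> points ?I. f (\<beta> y) \<noteq> g (\<beta> y)}"
  note fr = regular_pullback[OF \<beta> f] and gr = regular_pullback[OF \<beta> g]
  have "openin (zar ?I) ?D"
  proof (subst openin_subopen, intro ballI)
    fix y assume y: "y \<in> ?D"
    obtain W h where W: "regular (affine_space n) W h" "y \<in> W" "\<forall>z\<in>W \<inter> S. f (\<beta> z) = h z"
      using fr y unfolding induced_def fspace.simps mem_Collect_eq by meson
    obtain V k where V: "regular (affine_space n) V k" "y \<in> V" "\<forall>z\<in>V \<inter> S. g (\<beta> z) = k z"
      using gr y unfolding induced_def fspace.simps mem_Collect_eq by meson
    obtain W' p r where W': "openin (zariski n) W'" "y \<in> W'" "W' \<subseteq> W" "poly_fun n p" "poly_fun n r"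
      "\<forall>z\<in>W'. r z \<noteq> 0 \<and> h z = p z / r z"
      using W(1,2) unfolding affine_space_def fspace.simps by meson
    obtain V' p' r' where V': "openin (zariski n) V'" "y \<in> V'" "V' \<subseteq> V" "poly_fun n p'" "poly_fun n r'"
      "\<forall>z\<in>V'. r' z \<noteq> 0 \<and> k z = p' z / r' z"
      using V(1,2) unfolding affine_space_def fspace.simps by meson
    define d where "d = (\<lambda>x. p x * r' x + (- 1) * (p' x * r x))"
    have "poly_fun n d"
      unfolding d_def using W' V' by (intro poly_fun.intros)
    define O' where "O' = affine_points n - {x. d x = 0}"
    have "openin (zariski n) O'"
      unfolding openin_zariski zariski_open_def O'_def
      using \<open>poly_fun n d\<close> by (intro exI[of _ "{d}"]) auto
    define N where "N = W' \<inter> V' \<inter> O' \<inter> S"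
    have ptI: "points ?I = affine_points n \<inter> S"
      by (simp add: induced_def affine_space_def topspace_zariski)
    have eq: "f (\<beta> z) \<noteq> g (\<beta> z) \<longleftrightarrow> d z \<noteq> 0" if "z \<in> W' \<inter> V' \<inter> S" for z
    proof -
      have "f (\<beta> z) = p z / r z" "g (\<beta> z) = p' z / r' z" "r z \<noteq> 0" "r' z \<noteq> 0"
        using that W(3) V(3) W'(3,6) V'(3,6) by auto
      then show ?thesis
        unfolding d_def by (simp add: frac_eq_eq)
    qed
    have "openin (zar ?I) N"
      unfolding N_def induced_def affine_space_def fspace.simps
      using W'(1) V'(1) \<open>openin (zariski n) O'\<close>
      by (intro openin_subtopology_Int openin_Int)
    moreover have "y \<in> N" "N \<subseteq> ?D"
      using y W'(2) V'(2) eq ptI unfolding N_def O'_def by auto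
    ultimately show "\<exists>N. openin (zar ?I) N \<and> y \<in> N \<and> N \<subseteq> ?D" by blast
  qed
  then have "openin (zar T) {t \<in> points T. \<alpha> t \<in> ?D}"
    using \<alpha> unfolding morphism_def continuous_map_def by blast
  moreover have "{t \<in> points T. \<alpha> t \<in> ?D} = {t \<in> points T. f t \<noteq> g t}"
    using morphism_points[OF \<alpha>] inv by auto
  ultimately show ?thesis by simp
qed

lemma regular_coord:
  assumes "i < n" shows "regular (affine_space n) (affine_points n) (\<lambda>x. x i)"
  unfolding affine_space_def fspace.simps
proof (intro conjI ballI)
  show o: "openin (zariski n) (affine_points n)"
    using openin_topspace[of "zariski n"] by (simp add: topspace_zariski)
  fix x assume "x \<in> affine_points n"
  with o assms show "\<exists>W p r. openin (zariski n) W \<and> x \<in> W \<and> W \<subseteq> affine_points n \<and> poly_fun n p \<and>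
      poly_fun n r \<and> (\<forall>y\<in>W. r y \<noteq> 0 \<and> y i = p y / r y)"
    by (intro exI[of _ "affine_points n"] exI[of _ "\<lambda>x. x i"] exI[of _ "\<lambda>_. 1"])
      (auto intro: poly_fun.intros)
qed

lemma is_variety_affine_space: "is_variety (affine_space n)"
  unfolding is_variety_def
proof (intro conjI allI impI)
  let ?A = "affine_space n"
  show "function_sheaf ?A" by (rule function_sheaf_affine_space)
  have pts: "points ?A = affine_points n"
    by (simp add: affine_space_def topspace_zariski)
  have "affine_variety (induced ?A (points ?A))"
    unfolding affine_variety_def
    by (intro conjI exI[of _ n] exI[of _ "points ?A"] isomorphic_refl function_sheaf_induced
        function_sheaf_affine_space) (metis closedin_topspace pts topspace_zariski)
  then show "\<exists>\<C>. finite \<C> \<and> \<Union>\<C> = points ?A \<and>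
      (\<forall>U\<in>\<C>. openin (zar ?A) U \<and> affine_variety (induced ?A U))"
    by (intro exI[of _ "{points ?A}"]) (simp del: topspace_discrete_topology)
  fix T \<phi> \<psi>
  assume T: "affine_variety T" and \<phi>: "morphism T ?A \<phi>" and \<psi>: "morphism T ?A \<psi>"
  have coord: "regular T (points T) (\<lambda>t. \<theta> t i)" if "morphism T ?A \<theta>" "i < n" for \<theta> i
    using regular_pullback[OF that(1)] regular_coord[OF that(2)] unfolding pts .
  have in_pts: "\<theta> t \<in> affine_points n" if "morphism T ?A \<theta>" "t \<in> points T" for \<theta> t
    using morphism_points[OF that] unfolding pts .
  have "\<phi> t = \<psi> t \<longleftrightarrow> (\<forall>i<n. \<phi> t i = \<psi> t i)" if "t \<in> points T" for t
    using in_pts[OF \<phi> that] in_pts[OF \<psi> that] unfolding affine_points_def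
    by (auto simp: fun_eq_iff) (metis not_le)
  then have "points T - {t \<in> points T. \<phi> t = \<psi> t} = (\<Union>i\<in>{..<n}. {t \<in> points T. \<phi> t i \<noteq> \<psi> t i})"
    by auto
  moreover have "openin (zar T) (\<Union>i\<in>{..<n}. {t \<in> points T. \<phi> t i \<noteq> \<psi> t i})"
  proof (rule openin_Union, elim imageE)
    fix K i assume "K = {t \<in> points T. \<phi> t i \<noteq> \<psi> t i}" "i \<in> {..<n}"
    then show "openin (zar T) K"
      using affine_neq_open[OF T coord[OF \<phi>, of i] coord[OF \<psi>, of i]] by simp
  qed
  ultimately show "closedin (zar T) {t \<in> points T. \<phi> t = \<psi> t}"
    by (simp only: closedin_def Collect_restrict simp_thms)
qed

typedef variety = "{X. is_variety X}"
  morphisms space_of variety_of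
  using is_variety_affine_space by blast

definition is_product :: "variety \<Rightarrow> variety \<Rightarrow> variety \<Rightarrow> bool" where
  "is_product P X Y \<longleftrightarrow> (\<exists>\<pi> \<rho>.
    morphism (space_of P) (space_of X) \<pi> \<and> morphism (space_of P) (space_of Y) \<rho> \<and>
    (\<forall>T \<phi> \<psi>. morphism (space_of T) (space_of X) \<phi> \<longrightarrow> morphism (space_of T) (space_of Y) \<psi> \<longrightarrow>
      (\<exists>h. morphism (space_of T) (space_of P) h \<and>
        (\<forall>t\<in>points (space_of T). \<pi> (h t) = \<phi> t \<and> \<rho> (h t) = \<psi> t) \<and>
        (\<forall>h'. morphism (space_of T) (space_of P) h' \<longrightarrow>
          (\<forall>t\<in>points (space_of T). \<pi> (h' t) = \<phi> t \<and> \<rho> (h' t) = \<psi> t) \<longrightarrow>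
          (\<forall>t\<in>points (space_of T). h' t = h t)))))"

section \<open>The Grothendieck ring of varieties\<close>

definition ideal_gen :: "'a::comm_ring_1 set \<Rightarrow> 'a set" where
  "ideal_gen S = module.span (*) S"

lemma ideal_gen_0: "0 \<in> ideal_gen S"
  and ideal_gen_add: "a \<in> ideal_gen S \<Longrightarrow> b \<in> ideal_gen S \<Longrightarrow> a + b \<in> ideal_gen S"
  and ideal_gen_mult: "b \<in> ideal_gen S \<Longrightarrow> c * b \<in> ideal_gen S"
  and ideal_gen_base: "s \<in> S \<Longrightarrow> s \<in> ideal_gen S"
proof -
  interpret module "(*) :: 'a \<Rightarrow> 'a \<Rightarrow> 'a"
    by unfold_locales (simp_all add: algebra_simps)
  show "0 \<in> ideal_gen S"
    unfolding ideal_gen_def by (rule span_zero)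
  show "a \<in> ideal_gen S \<Longrightarrow> b \<in> ideal_gen S \<Longrightarrow> a + b \<in> ideal_gen S"
    unfolding ideal_gen_def by (rule span_add)
  show "b \<in> ideal_gen S \<Longrightarrow> c * b \<in> ideal_gen S"
    unfolding ideal_gen_def by (rule span_scale)
  show "s \<in> S \<Longrightarrow> s \<in> ideal_gen S"
    unfolding ideal_gen_def by (rule span_base)
qed

definition cong_mod :: "'a::comm_ring_1 set \<Rightarrow> 'a \<Rightarrow> 'a \<Rightarrow> bool" where
  "cong_mod S a b \<longleftrightarrow> a - b \<in> ideal_gen S"

lemma cong_mod_refl: "cong_mod S a a"
  by (simp add: cong_mod_def ideal_gen_0)

lemma cong_mod_uminus:
  assumes "cong_mod S a b" shows "cong_mod S (- a) (- b)"
  using ideal_gen_mult[of "a - b" S "- 1"] assms by (simp add: cong_mod_def)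

lemma equivp_cong_mod: "equivp (cong_mod S)"
proof (rule equivpI)
  show "reflp (cong_mod S)"
    by (simp add: reflp_def cong_mod_refl)
  show "symp (cong_mod S)"
  proof (rule sympI)
    fix a b assume "cong_mod S a b"
    then have "(- 1) * (a - b) \<in> ideal_gen S"
      unfolding cong_mod_def by (rule ideal_gen_mult)
    then show "cong_mod S b a" by (simp add: cong_mod_def)
  qed
  show "transp (cong_mod S)"
  proof (rule transpI)
    fix a b c assume "cong_mod S a b" "cong_mod S b c"
    then have "(a - b) + (b - c) \<in> ideal_gen S"
      unfolding cong_mod_def by (rule ideal_gen_add)
    then show "cong_mod S a c" by (simp add: cong_mod_def)
  qed
qed

lemma cong_mod_add:
  assumes "cong_mod S a b" "cong_mod S c d" shows "cong_mod S (a + c) (b + d)"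
proof -
  have "(a - b) + (c - d) \<in> ideal_gen S"
    using assms unfolding cong_mod_def by (rule ideal_gen_add)
  then show ?thesis by (simp add: cong_mod_def algebra_simps)
qed

lemma cong_mod_diff:
  assumes "cong_mod S a b" "cong_mod S c d" shows "cong_mod S (a - c) (b - d)"
  using cong_mod_add[OF assms(1) cong_mod_uminus[OF assms(2)]] by simp

lemma cong_mod_mult:
  assumes "cong_mod S a b" "cong_mod S c d" shows "cong_mod S (a * c) (b * d)"
proof -
  have "c * (a - b) + b * (c - d) \<in> ideal_gen S"
    using assms unfolding cong_mod_def by (intro ideal_gen_add ideal_gen_mult)
  then show ?thesis by (simp add: cong_mod_def algebra_simps)
qed

text \<open>
  \<open>(variety \<Rightarrow>\<^sub>0 nat) \<Rightarrow>\<^sub>0 int\<close> is the free commutative ring on the set of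
  varieties. The relations for products and for the point identify its quotient with the free
  abelian group on isomorphism classes modulo the cut-and-paste relations, with the product
  given by \<open>[X][Y] = [X \<times> Y]\<close>.
\<close>

type_synonym free_ring = "(variety \<Rightarrow>\<^sub>0 nat) \<Rightarrow>\<^sub>0 int"

definition gen :: "variety \<Rightarrow> free_ring" where
  "gen X = Poly_Mapping.single (Poly_Mapping.single X 1) 1"

definition K0_rels :: "free_ring set" where
  "K0_rels =
    {gen X - gen Y | X Y. isomorphic (space_of X) (space_of Y)} \<union>
    {gen X - (gen Y + gen U) | X Y U. \<exists>S. closedin (zar (space_of X)) S \<and>
       space_of Y = induced (space_of X) S \<and>
       space_of U = induced (space_of X) (points (space_of X) - S)} \<union>
    {gen P - gen X * gen Y | P X Y. is_product P X Y} \<union>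
    {gen X - 1 | X. space_of X = affine_space 0}"

quotient_type K0 = free_ring / "cong_mod K0_rels"
  by (rule equivp_cong_mod)

text \<open>
  The class of unital commutative rings demands \<open>0 \<noteq> 1\<close>, which for this quotient is
  a theorem about motivic measures; hence the weaker sort.
\<close>

instantiation K0 :: "{comm_ring, comm_monoid_mult}"
begin
lift_definition zero_K0 :: K0 is 0 .
lift_definition one_K0 :: K0 is 1 .
lift_definition plus_K0 :: "K0 \<Rightarrow> K0 \<Rightarrow> K0" is "(+)" by (rule cong_mod_add)
lift_definition minus_K0 :: "K0 \<Rightarrow> K0 \<Rightarrow> K0" is "(-)" by (rule cong_mod_diff)
lift_definition uminus_K0 :: "K0 \<Rightarrow> K0" is uminus by (rule cong_mod_uminus)
lift_definition times_K0 :: "K0 \<Rightarrow> K0 \<Rightarrow> K0" is "(*)" by (rule cong_mod_mult)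
instance
  by standard (transfer; simp add: algebra_simps cong_mod_refl)+
end

lift_definition class_of :: "variety \<Rightarrow> K0" is gen .

definition Lef :: K0 where  \<comment> \<open>the class of the affine line\<close>
  "Lef = class_of (variety_of (affine_space 1))"

section \<open>Extension of scalars\<close>

text \<open>
  The field of rational functions in \<open>L\<^sup>1\<^sup>/\<^sup>2\<close>, a variable over the rationals.
\<close>

type_synonym ratfun = "rat poly fract"

definition qhalf :: ratfun where
  "qhalf = to_fract [:0, 1:]"

text \<open>
  The multiplicative monoid of pairs, written additively so that \<open>pure \<Rightarrow>\<^sub>0 int\<close> is its
  monoid ring: the free abelian group on pure tensors, with \<open>(a \<otimes> r)(b \<otimes> s) = ab \<otimes> rs\<close>.
\<close>

datatype pure = Pure K0 ratfun

instantiation pure :: comm_monoid_add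
begin
definition zero_pure :: pure where "zero_pure = Pure 1 1"
fun plus_pure :: "pure \<Rightarrow> pure \<Rightarrow> pure" where
  "Pure a r + Pure b s = Pure (a * b) (r * s)"
instance
proof
  fix x y z :: pure
  show "x + y + z = x + (y + z)" by (cases x; cases y; cases z) (simp add: mult.assoc)
  show "x + y = y + x" by (cases x; cases y) (simp add: mult.commute)
  show "0 + x = x" by (cases x) (simp add: zero_pure_def)
qed
end

abbreviation pure_tensor :: "K0 \<Rightarrow> ratfun \<Rightarrow> pure \<Rightarrow>\<^sub>0 int" where
  "pure_tensor a r \<equiv> Poly_Mapping.single (Pure a r) 1"

text \<open>
  Biadditivity, and balancedness over \<open>\<int>[L]\<close>; given biadditivity, the latter only needs to be
  imposed for the generator \<open>L\<close>, which acts on \<open>\<rat>(L\<^sup>1\<^sup>/\<^sup>2)\<close> as the square of the variable.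
\<close>

definition tensor_rels :: "(pure \<Rightarrow>\<^sub>0 int) set" where
  "tensor_rels =
    {pure_tensor (a + b) r - (pure_tensor a r + pure_tensor b r) | a b r. True} \<union>
    {pure_tensor a (r + s) - (pure_tensor a r + pure_tensor a s) | a r s. True} \<union>
    {pure_tensor (Lef * a) r - pure_tensor a (qhalf ^ 2 * r) | a r. True}"

quotient_type motive = "pure \<Rightarrow>\<^sub>0 int" / "cong_mod tensor_rels"
  by (rule equivp_cong_mod)

instantiation motive :: "{comm_ring, comm_monoid_mult}"
begin
lift_definition zero_motive :: motive is 0 .
lift_definition one_motive :: motive is 1 .
lift_definition plus_motive :: "motive \<Rightarrow> motive \<Rightarrow> motive" is "(+)" by (rule cong_mod_add)
lift_definition minus_motive :: "motive \<Rightarrow> motive \<Rightarrow> motive" is "(-)" by (rule cong_mod_diff)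
lift_definition uminus_motive :: "motive \<Rightarrow> motive" is uminus by (rule cong_mod_uminus)
lift_definition times_motive :: "motive \<Rightarrow> motive \<Rightarrow> motive" is "(*)" by (rule cong_mod_mult)
instance
  by standard (transfer; simp add: algebra_simps cong_mod_refl)+
end

lift_definition tensor :: "K0 \<Rightarrow> ratfun \<Rightarrow> motive" is pure_tensor .

abbreviation scalar :: "ratfun \<Rightarrow> motive" where
  "scalar r \<equiv> tensor 1 r"

text \<open>Meaningful only if \<open>X\<close> satisfies \<open>is_variety\<close>.\<close>

definition motive_of :: "fspace \<Rightarrow> motive" where
  "motive_of X = tensor (class_of (variety_of X)) 1"

section \<open>Formal series\<close>

text \<open>
  Series with exponents in \<open>S\<close>, multiplied by \<open>x\<^sup>\<alpha> x\<^sup>\<beta> = \<sigma> \<alpha> \<beta> x\<^sup>\<alpha>\<^sup>+\<^sup>\<beta>\<close>. Below, all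
  elements of \<open>S\<close> have only finitely many decompositions in \<open>S\<close>, and series which are
  exponentiated have no constant term, so that the sum over \<open>n\<close> is coefficientwise finite.
\<close>

definition ser_mult :: "'i::comm_monoid_add set \<Rightarrow> ('i \<Rightarrow> 'i \<Rightarrow> motive) \<Rightarrow>
    ('i \<Rightarrow> motive) \<Rightarrow> ('i \<Rightarrow> motive) \<Rightarrow> 'i \<Rightarrow> motive" where
  "ser_mult S \<sigma> F G = (\<lambda>\<gamma>. \<Sum>(\<alpha>, \<beta>) \<in> {(\<alpha>, \<beta>). \<alpha> \<in> S \<and> \<beta> \<in> S \<and> \<alpha> + \<beta> = \<gamma>}. \<sigma> \<alpha> \<beta> * F \<alpha> * G \<beta>)"

definition ser_one :: "'i::comm_monoid_add \<Rightarrow> motive" where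
  "ser_one = (\<lambda>\<gamma>. if \<gamma> = 0 then 1 else 0)"

definition ser_exp :: "(('i \<Rightarrow> motive) \<Rightarrow> ('i \<Rightarrow> motive) \<Rightarrow> 'i \<Rightarrow> motive) \<Rightarrow>
    ('i::comm_monoid_add \<Rightarrow> motive) \<Rightarrow> 'i \<Rightarrow> motive" where
  "ser_exp mul F = (\<lambda>\<gamma>. Sum_any (\<lambda>n. scalar (1 / of_nat (fact n)) * (mul F ^^ n) ser_one \<gamma>))"

section \<open>The lattice, its rays and the quantum torus\<close>

definition zmult :: "int \<Rightarrow> 'g::ab_group_add \<Rightarrow> 'g" where
  "zmult k x = (if k \<ge> 0 then (\<Sum>_\<in>{..<nat k}. x) else - (\<Sum>_\<in>{..<nat (- k)}. x))"

record 'g skew_lattice =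
  e1 :: 'g
  e2 :: 'g
  form :: "'g \<Rightarrow> 'g \<Rightarrow> int"

definition rank2_skew_lattice :: "'g::ab_group_add skew_lattice \<Rightarrow> bool" where
  "rank2_skew_lattice \<Gamma> \<longleftrightarrow>
    (\<forall>\<gamma>. \<exists>!(a, b). \<gamma> = zmult a (e1 \<Gamma>) + zmult b (e2 \<Gamma>)) \<and>
    (\<forall>x y z. form \<Gamma> (x + y) z = form \<Gamma> x z + form \<Gamma> y z) \<and>
    (\<forall>x y z. form \<Gamma> x (y + z) = form \<Gamma> x y + form \<Gamma> x z) \<and>
    (\<forall>x y. form \<Gamma> x y = - form \<Gamma> y x)"

definition Gplus :: "'g::ab_group_add skew_lattice \<Rightarrow> 'g set" where
  "Gplus \<Gamma> = {zmult (int a) (e1 \<Gamma>) + zmult (int b) (e2 \<Gamma>) | a b. True}"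

abbreviation Gplus_nz :: "'g::ab_group_add skew_lattice \<Rightarrow> 'g set" where
  "Gplus_nz \<Gamma> \<equiv> Gplus \<Gamma> - {0}"

definition plane :: "'g::ab_group_add skew_lattice \<Rightarrow> 'g \<Rightarrow> real \<times> real" where
  "plane \<Gamma> \<gamma> = (THE (u, v). \<exists>a b. \<gamma> = zmult a (e1 \<Gamma>) + zmult b (e2 \<Gamma>) \<and>
     u = real_of_int a \<and> v = real_of_int b)"

definition rays :: "'g::ab_group_add skew_lattice \<Rightarrow> (real \<times> real) set set" where
  "rays \<Gamma> = {{t *\<^sub>R plane \<Gamma> \<gamma> | t. t > 0} | \<gamma>. \<gamma> \<in> Gplus_nz \<Gamma>}"

text \<open>
  \<open>clockwise l l'\<close>: the ray \<open>l\<close> comes strictly before \<open>l'\<close> on the way from \<open>e\<^sub>2 = (0,1)\<close> to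
  \<open>e\<^sub>1 = (1,0)\<close> through the first quadrant.
\<close>

definition clockwise :: "(real \<times> real) set \<Rightarrow> (real \<times> real) set \<Rightarrow> bool" where
  "clockwise l l' \<longleftrightarrow> (\<exists>u\<in>l. \<exists>v\<in>l'. fst u * snd v < snd u * fst v)"

abbreviation anticlockwise :: "(real \<times> real) set \<Rightarrow> (real \<times> real) set \<Rightarrow> bool" where
  "anticlockwise l l' \<equiv> clockwise l' l"

definition torus_mult :: "'g::ab_group_add skew_lattice \<Rightarrow>
    ('g \<Rightarrow> motive) \<Rightarrow> ('g \<Rightarrow> motive) \<Rightarrow> 'g \<Rightarrow> motive" where
  "torus_mult \<Gamma> = ser_mult (Gplus \<Gamma>) (\<lambda>\<alpha> \<beta>. scalar (qhalf powi form \<Gamma> \<alpha> \<beta>))"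

definition ray_factor :: "'g::ab_group_add skew_lattice \<Rightarrow> ('g \<Rightarrow> motive) \<Rightarrow>
    (real \<times> real) set \<Rightarrow> 'g \<Rightarrow> motive" where
  "ray_factor \<Gamma> \<Omega> l = ser_exp (torus_mult \<Gamma>)
    (\<lambda>\<gamma>. if plane \<Gamma> \<gamma> \<in> l then scalar (1 / (qhalf - 1 / qhalf)) * \<Omega> \<gamma> else 0)"

definition finite_ordered_prod :: "'g::ab_group_add skew_lattice \<Rightarrow> ('l \<Rightarrow> 'l \<Rightarrow> bool) \<Rightarrow>
    'l set \<Rightarrow> ('l \<Rightarrow> 'g \<Rightarrow> motive) \<Rightarrow> 'g \<Rightarrow> motive" where
  "finite_ordered_prod \<Gamma> before A E =
    foldr (torus_mult \<Gamma>) (map E (THE ls. sorted_wrt before ls \<and> set ls = A)) ser_one"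

text \<open>
  The coefficient of an infinite ordered product is the eventual value of the coefficients of
  the finite ordered partial products.
\<close>

definition ordered_prod :: "'g::ab_group_add skew_lattice \<Rightarrow> ('l \<Rightarrow> 'l \<Rightarrow> bool) \<Rightarrow>
    'l set \<Rightarrow> ('l \<Rightarrow> 'g \<Rightarrow> motive) \<Rightarrow> 'g \<Rightarrow> motive" where
  "ordered_prod \<Gamma> before I E = (\<lambda>\<gamma>. THE c.
    \<forall>\<^sub>F A in finite_subsets_at_top I. finite_ordered_prod \<Gamma> before A E \<gamma> = c)"

section \<open>Multiplicities\<close>

text \<open>Finitely supported \<open>m\<close> on the nonzero elements of \<open>Gplus \<Gamma>\<close>.\<close>

definition mults :: "'g::ab_group_add skew_lattice \<Rightarrow> ('g \<Rightarrow>\<^sub>0 nat) set" where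
  "mults \<Gamma> = {m. Poly_Mapping.keys m \<subseteq> Gplus_nz \<Gamma>}"

definition mnorm :: "('g::ab_group_add \<Rightarrow>\<^sub>0 nat) \<Rightarrow> 'g" where
  "mnorm m = (\<Sum>\<alpha>\<in>Poly_Mapping.keys m. zmult (int (Poly_Mapping.lookup m \<alpha>)) \<alpha>)"

definition mcard :: "('g \<Rightarrow>\<^sub>0 nat) \<Rightarrow> nat" where
  "mcard m = (\<Sum>\<alpha>\<in>Poly_Mapping.keys m. Poly_Mapping.lookup m \<alpha>)"

definition mfact :: "('g \<Rightarrow>\<^sub>0 nat) \<Rightarrow> nat" where
  "mfact m = (\<Prod>\<alpha>\<in>Poly_Mapping.keys m. fact (Poly_Mapping.lookup m \<alpha>))"

section \<open>Abelian representations of the quiver of a multiplicity\<close>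

type_synonym 'g vertex = "'g \<times> nat"

definition vertices :: "('g \<Rightarrow>\<^sub>0 nat) \<Rightarrow> 'g vertex set" where
  "vertices m = {(\<alpha>, k). \<alpha> \<in> Poly_Mapping.keys m \<and> 1 \<le> k \<and> k \<le> Poly_Mapping.lookup m \<alpha>}"

text \<open>An arrow is a triple of source, target and index.\<close>

type_synonym 'g arrow = "'g vertex \<times> 'g vertex \<times> nat"

definition arrows :: "'g skew_lattice \<Rightarrow> ('g \<Rightarrow>\<^sub>0 nat) \<Rightarrow> 'g arrow set" where
  "arrows \<Gamma> m = {(v, w, j). v \<in> vertices m \<and> w \<in> vertices m \<and> j < nat (form \<Gamma> (fst w) (fst v))}"

text \<open>
  A point \<open>x\<close> of affine space of dimension \<open>card (arrows \<Gamma> m)\<close> is the representation in which the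
  arrow \<open>a\<close> acts as multiplication by the following coordinate of \<open>x\<close>. (\<open>to_nat_on A\<close>
  enumerates a finite set \<open>A\<close> by the numbers below its cardinality.)
\<close>

definition arrow_map :: "'g skew_lattice \<Rightarrow> ('g \<Rightarrow>\<^sub>0 nat) \<Rightarrow> point \<Rightarrow> 'g arrow \<Rightarrow> complex" where
  "arrow_map \<Gamma> m x a = x (to_nat_on (arrows \<Gamma> m) a)"

definition subrep :: "'g skew_lattice \<Rightarrow> ('g \<Rightarrow>\<^sub>0 nat) \<Rightarrow> point \<Rightarrow>
    ('g vertex \<Rightarrow> complex set) \<Rightarrow> bool" where
  "subrep \<Gamma> m x N \<longleftrightarrow> (\<forall>v\<in>vertices m. vector_space_over_itself.subspace (N v)) \<and>
    (\<forall>(v, w, j)\<in>arrows \<Gamma> m. \<forall>z\<in>N v. arrow_map \<Gamma> m x (v, w, j) * z \<in> N w)"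

definition cl :: "('g::ab_group_add \<Rightarrow>\<^sub>0 nat) \<Rightarrow> ('g vertex \<Rightarrow> complex set) \<Rightarrow> 'g" where
  "cl m N = (\<Sum>v\<in>vertices m. zmult (int (vector_space_over_itself.dim (N v))) (fst v))"

definition slope :: "('g \<Rightarrow> complex) \<Rightarrow> 'g \<Rightarrow> ereal" where
  "slope Z \<gamma> = (if Im (Z \<gamma>) = 0 then \<infinity> else ereal (- Re (Z \<gamma>) / Im (Z \<gamma>)))"

definition stability_function :: "'g::ab_group_add skew_lattice \<Rightarrow> ('g \<Rightarrow> complex) \<Rightarrow> bool" where
  "stability_function \<Gamma> Z \<longleftrightarrow> (\<forall>x y. Z (x + y) = Z x + Z y) \<and>
    (\<forall>e\<in>{e1 \<Gamma>, e2 \<Gamma>}. \<exists>r \<phi>. r > 0 \<and> 0 < \<phi> \<and> \<phi> \<le> 1 \<and> Z e = rcis r (pi * \<phi>)) \<and>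
    slope Z (e1 \<Gamma>) < slope Z (e2 \<Gamma>)"

definition semistable :: "'g::ab_group_add skew_lattice \<Rightarrow> ('g \<Rightarrow> complex) \<Rightarrow>
    ('g \<Rightarrow>\<^sub>0 nat) \<Rightarrow> point \<Rightarrow> bool" where
  "semistable \<Gamma> Z m x \<longleftrightarrow> (\<forall>N. subrep \<Gamma> m x N \<longrightarrow>
    (\<exists>v\<in>vertices m. N v \<noteq> {0}) \<longrightarrow> (\<exists>v\<in>vertices m. N v \<noteq> UNIV) \<longrightarrow>
    slope Z (cl m N) \<le> slope Z (cl m (\<lambda>_. UNIV)))"

definition semistable_locus :: "'g::ab_group_add skew_lattice \<Rightarrow> ('g \<Rightarrow> complex) \<Rightarrow>
    ('g \<Rightarrow>\<^sub>0 nat) \<Rightarrow> fspace" where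
  "semistable_locus \<Gamma> Z m = (let A = affine_space (card (arrows \<Gamma> m)) in
    induced A {x \<in> points A. semistable \<Gamma> Z m x})"

definition f_plus :: "'g::ab_group_add skew_lattice \<Rightarrow> ('g \<Rightarrow> complex) \<Rightarrow>
    ('g \<Rightarrow>\<^sub>0 nat) \<Rightarrow> motive" where
  "f_plus \<Gamma> Z m =
    scalar (qhalf powi (int (mcard m) - int (card (arrows \<Gamma> m))) / (qhalf ^ 2 - 1) ^ mcard m) *
    motive_of (semistable_locus \<Gamma> Z m)"

text \<open>
  The defining equations of the invariants, one for each ray, in the commutative power series
  ring in variables indexed by the nonzero elements of \<open>Gplus \<Gamma>\<close>.
\<close>

definition abelian_invariants :: "'g::ab_group_add skew_lattice \<Rightarrow> ('g \<Rightarrow> complex) \<Rightarrow>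
    (('g \<Rightarrow>\<^sub>0 nat) \<Rightarrow> motive) \<Rightarrow> bool" where
  "abelian_invariants \<Gamma> Z g \<longleftrightarrow> (\<forall>l\<in>rays \<Gamma>.
    (\<lambda>m. ser_one m +
      (if m \<in> mults \<Gamma> \<and> plane \<Gamma> (mnorm m) \<in> l
       then scalar (1 / of_nat (mfact m)) * f_plus \<Gamma> Z m else 0)) =
    ser_exp (ser_mult (mults \<Gamma>) (\<lambda>_ _. 1))
      (\<lambda>m. if m \<in> mults \<Gamma> \<and> plane \<Gamma> (mnorm m) \<in> l
       then scalar (1 / (qhalf - 1 / qhalf)) * (scalar (1 / of_nat (mfact m)) * g m) else 0))"

end

theory Submission
  imports Defs
begin

text \<open>
  Write \<open>v = q\<^sup>1\<^sup>/\<^sup>2\<close>. The theorem follows from one identity in the quantum torus: for every family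
  \<open>\<Omega>\<close>, the anticlockwise product with exponents \<open>\<Omega>\<close> equals the clockwise product whose exponents
  are the sums \<open>\<Sum> g(m) \<Omega>\<^sup>m / m!\<close> over \<open>\<parallel>m\<parallel> = \<gamma>\<close> (lemma \<open>anticlockwise_eq_clockwise_mps_sum\<close>). Since a
  series has at most one clockwise factorization (lemma \<open>factorization_unique\<close>), (KS) then says
  that \<open>\<Omega>\<^sup>+\<close> is this family of sums for \<open>\<Omega> = \<Omega>\<^sup>-\<close>, which is (MPS).

  For the identity, expand the anticlockwise product. Monomials on one ray commute, and every pair
  of factors from different rays contributes a power of \<open>v\<close> whose exponent is a number of arrows of
  \<open>Q(m)\<close>. The result is a sum over multiplicities \<open>m\<close> of \<open>\<Omega>\<^sup>m x\<^sup>\<parallel>\<^sup>m\<^sup>\<parallel> / m!\<close> with coefficient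
  \<open>v\<close> to the power \<open>|m| + |Q(m)\<^sub>1|\<close> divided by \<open>(q - 1)\<^sup>|\<^sup>m\<^sup>|\<close>. This is the coefficient \<open>f\<^sub>+(m)\<close> with
  the semistable locus replaced by the space \<open>R(Q(m))\<close> of all abelian representations. Now
  stratify \<open>R(Q(m))\<close> by Harder-Narasimhan type. A stratum is the product of the semistable loci of
  the subquotients and of an affine space, with one coordinate for each arrow from a later to an
  earlier subquotient. The difference between the numbers of arrows in the two directions is a
  value of the form, so that the stratification becomes a product of series in the quantum torus,
  one factor for each ray, ordered by decreasing slope, that is, clockwise. By the definition of
  \<open>g\<close> its factors are the exponentials of the sums above.

  Two remarks make this elementary. Whether an abelian representation is semistable depends only on
  the set of arrows which act by nonzero numbers. Hence the semistable locus is a union of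
  coordinate strata \<open>\<complex>\<^sup>*\<^sup>\<times>\<^sup>k\<close>, each of class \<open>(\<bbbL> - 1)\<^sup>k\<close> (lemma \<open>motive_of_strata\<close>), and all classes are
  sums of powers of \<open>q - 1\<close> over sets of arrows. The Harder-Narasimhan stratification is then a
  statement about finite directed graphs: lemmas \<open>hn_first_subset\<close> and \<open>hn_exists\<close> give uniqueness and
  existence, and \<open>hn_sum_Cons\<close> the recursion which splits off the first subquotient. Moreover the
  expansion of the anticlockwise product is the same statement for the opposite order of slopes: there,
  the vertices of smallest slope always form a subrepresentation, and only multiplicities supported
  on a single ray have semistable representations (lemma \<open>f_coeff_plus\<close>). So one recursion, with a sign \<open>s\<close>
  which is \<open>-1\<close> for the clockwise and \<open>1\<close> for the anticlockwise order, evaluates both products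
  (lemma \<open>hn_coeff_complete\<close>), and the result does not depend on \<open>s\<close>.

  Exponentials are handled through their logarithmic derivative: with respect to the degree
  derivation \<open>D\<close>, the series \<open>E = exp F\<close> is the solution of \<open>D E = (D F) E\<close> with constant term
  one. This determines \<open>E\<close> degree by degree, and \<open>F\<close> from \<open>E\<close>.
\<close>

section \<open>Regular functions on varieties\<close>

lemma regular_cong:
  "function_sheaf X \<Longrightarrow> regular X U f \<Longrightarrow> (\<And>x. x \<in> U \<Longrightarrow> f x = g x) \<Longrightarrow> regular X U g"
  unfolding function_sheaf_def by meson

lemma regular_glue:
  assumes "function_sheaf X" "openin (zar X) U"
    and "\<And>x. x \<in> U \<Longrightarrow> \<exists>W. x \<in> W \<and> W \<subseteq> U \<and> regular X W f"
  shows "regular X U f"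
  using assms unfolding function_sheaf_def by meson

text \<open>
  A variety is only given with a sheaf of functions. That its sections form rings, and that a section
  is invertible away from its zeros, comes from affine space through charts. Both are needed to check that
  a map with regular coordinates is a morphism.
\<close>

definition ring_sheaf :: "fspace \<Rightarrow> bool" where
  "ring_sheaf X \<longleftrightarrow> function_sheaf X \<and>
    (\<forall>U c. openin (zar X) U \<longrightarrow> regular X U (\<lambda>_. c)) \<and>
    (\<forall>U f g. regular X U f \<longrightarrow> regular X U g \<longrightarrow> regular X U (\<lambda>x. f x + g x)) \<and>
    (\<forall>U f g. regular X U f \<longrightarrow> regular X U g \<longrightarrow> regular X U (\<lambda>x. f x * g x)) \<and>
    (\<forall>U f. regular X U f \<longrightarrow> regular X {x \<in> U. f x \<noteq> 0} (\<lambda>x. 1 / f x))"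

lemma
  assumes "ring_sheaf X"
  shows ring_sheaf_function_sheaf: "function_sheaf X"
    and regular_const: "openin (zar X) U \<Longrightarrow> regular X U (\<lambda>_. c)"
    and regular_add: "regular X U f \<Longrightarrow> regular X U g \<Longrightarrow> regular X U (\<lambda>x. f x + g x)"
    and regular_mult: "regular X U f \<Longrightarrow> regular X U g \<Longrightarrow> regular X U (\<lambda>x. f x * g x)"
    and regular_inverse: "regular X U f \<Longrightarrow> regular X {x \<in> U. f x \<noteq> 0} (\<lambda>x. 1 / f x)"
  using assms unfolding ring_sheaf_def by metis+

lemma affine_space_simps [simp]:
  "zar (affine_space n) = zariski n" "points (affine_space n) = affine_points n"
  by (simp_all add: affine_space_def topspace_zariski)

lemma induced_simps [simp]:
  "zar (induced X S) = subtopology (zar X) S" 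
  by (simp_all add: induced_def)

lemma regular_affine_space:
  "regular (affine_space n) U f \<longleftrightarrow> openin (zariski n) U \<and>
    (\<forall>x\<in>U. \<exists>W p r. openin (zariski n) W \<and> x \<in> W \<and> W \<subseteq> U \<and> poly_fun n p \<and> poly_fun n r \<and>
        (\<forall>y\<in>W. r y \<noteq> 0 \<and> f y = p y / r y))"
  by (simp add: affine_space_def)

lemma regular_induced:
  "regular (induced X S) U f \<longleftrightarrow> openin (subtopology (zar X) S) U \<and>
    (\<forall>x\<in>U. \<exists>W g. regular X W g \<and> x \<in> W \<and> W \<inter> S \<subseteq> U \<and> (\<forall>y\<in>W \<inter> S. f y = g y))"
  by (simp add: induced_def)

lemma openin_zariski_nonzero:
  assumes "poly_fun n p" shows "openin (zariski n) {x \<in> affine_points n. p x \<noteq> 0}"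
  unfolding openin_zariski zariski_open_def
  using assms by (intro exI[of _ "{p}"]) auto

lemma ring_sheaf_affine_space: "ring_sheaf (affine_space n)"
  unfolding ring_sheaf_def
proof (intro conjI allI impI)
  show "function_sheaf (affine_space n)" by (rule function_sheaf_affine_space)
  fix U and c :: complex
  assume "openin (zar (affine_space n)) U"
  then show "regular (affine_space n) U (\<lambda>_. c)"
    unfolding regular_affine_space
    by (intro conjI ballI exI[of _ U] exI[of _ "\<lambda>_. c"] exI[of _ "\<lambda>_. 1"])
      (auto intro: poly_fun.const)
next
  fix U f g
  assume f: "regular (affine_space n) U f" and g: "regular (affine_space n) U g"
  have loc: "\<exists>W p r p' r'. openin (zariski n) W \<and> x \<in> W \<and> W \<subseteq> U \<and> poly_fun n p \<and> poly_fun n r \<and>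
        poly_fun n p' \<and> poly_fun n r' \<and>
        (\<forall>y\<in>W. r y \<noteq> 0 \<and> f y = p y / r y \<and> r' y \<noteq> 0 \<and> g y = p' y / r' y)" if x: "x \<in> U" for x
  proof -
    obtain W p r where "openin (zariski n) W" "x \<in> W" "W \<subseteq> U" "poly_fun n p" "poly_fun n r"
        "\<forall>y\<in>W. r y \<noteq> 0 \<and> f y = p y / r y"
      using f x unfolding regular_affine_space by meson
    moreover obtain W' p' r' where "openin (zariski n) W'" "x \<in> W'" "W' \<subseteq> U" "poly_fun n p'" "poly_fun n r'"
        "\<forall>y\<in>W'. r' y \<noteq> 0 \<and> g y = p' y / r' y"
      using g x unfolding regular_affine_space by meson
    ultimately show ?thesis
      by (intro exI[of _ "W \<inter> W'"] exI[of _ p] exI[of _ r] exI[of _ p'] exI[of _ r'])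
        (auto intro: openin_Int)
  qed
  have o: "openin (zariski n) U" using f by (simp add: regular_affine_space)
  show "regular (affine_space n) U (\<lambda>x. f x + g x)"
    unfolding regular_affine_space
  proof (intro conjI ballI o)
    fix x assume "x \<in> U"
    then obtain W p r p' r' where "openin (zariski n) W" "x \<in> W" "W \<subseteq> U" "poly_fun n p" "poly_fun n r"
        "poly_fun n p'" "poly_fun n r'"
        "\<forall>y\<in>W. r y \<noteq> 0 \<and> f y = p y / r y \<and> r' y \<noteq> 0 \<and> g y = p' y / r' y"
      using loc by metis
    then show "\<exists>W p r. openin (zariski n) W \<and> x \<in> W \<and> W \<subseteq> U \<and> poly_fun n p \<and> poly_fun n r \<and>
        (\<forall>y\<in>W. r y \<noteq> 0 \<and> f y + g y = p y / r y)"
      by (intro exI[of _ W] exI[of _ "\<lambda>y. p y * r' y + p' y * r y"] exI[of _ "\<lambda>y. r y * r' y"])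
        (auto intro!: poly_fun.add poly_fun.mult simp: field_simps)
  qed
  show "regular (affine_space n) U (\<lambda>x. f x * g x)"
    unfolding regular_affine_space
  proof (intro conjI ballI o)
    fix x assume "x \<in> U"
    then obtain W p r p' r' where "openin (zariski n) W" "x \<in> W" "W \<subseteq> U" "poly_fun n p" "poly_fun n r"
        "poly_fun n p'" "poly_fun n r'"
        "\<forall>y\<in>W. r y \<noteq> 0 \<and> f y = p y / r y \<and> r' y \<noteq> 0 \<and> g y = p' y / r' y"
      using loc by metis
    then show "\<exists>W p r. openin (zariski n) W \<and> x \<in> W \<and> W \<subseteq> U \<and> poly_fun n p \<and> poly_fun n r \<and>
        (\<forall>y\<in>W. r y \<noteq> 0 \<and> f y * g y = p y / r y)"
      by (intro exI[of _ W] exI[of _ "\<lambda>y. p y * p' y"] exI[of _ "\<lambda>y. r y * r' y"])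
        (auto intro!: poly_fun.add poly_fun.mult simp: field_simps)
  qed
next
  fix U f
  assume f: "regular (affine_space n) U f"
  let ?D = "{x \<in> U. f x \<noteq> 0}"
  have loc: "\<exists>W p r. openin (zariski n) W \<and> x \<in> W \<and> W \<subseteq> ?D \<and> poly_fun n p \<and> poly_fun n r \<and>
        (\<forall>y\<in>W. r y \<noteq> 0 \<and> 1 / f y = p y / r y)" if "x \<in> ?D" for x
  proof -
    obtain W p r where W: "openin (zariski n) W" "x \<in> W" "W \<subseteq> U" "poly_fun n p" "poly_fun n r"
        "\<forall>y\<in>W. r y \<noteq> 0 \<and> f y = p y / r y"
      using f \<open>x \<in> ?D\<close> unfolding regular_affine_space by force
    have "W \<subseteq> affine_points n" using openin_subset[OF W(1)] by (simp add: topspace_zariski)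
    with W that show ?thesis
      by (intro exI[of _ "W \<inter> {x \<in> affine_points n. p x \<noteq> 0}"] exI[of _ r] exI[of _ p])
        (auto intro!: openin_Int openin_zariski_nonzero)
  qed
  have "openin (zariski n) ?D"
    using loc by (subst openin_subopen) blast
  with loc show "regular (affine_space n) ?D (\<lambda>x. 1 / f x)"
    unfolding regular_affine_space by blast
qed

lemma ring_sheaf_induced:
  assumes X: "ring_sheaf X" shows "ring_sheaf (induced X S)"
  unfolding ring_sheaf_def
proof (intro conjI allI impI)
  note fX = ring_sheaf_function_sheaf[OF X]
  show "function_sheaf (induced X S)" by (rule function_sheaf_induced[OF fX])
  fix U and c :: complex
  assume U: "openin (zar (induced X S)) U"
  then obtain V where "openin (zar X) V" "U = V \<inter> S" by (auto simp: openin_subtopology)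
  then have "regular X V (\<lambda>_. c)" "U = V \<inter> S" using regular_const[OF X] by auto
  with U show "regular (induced X S) U (\<lambda>_. c)"
    unfolding regular_induced by auto
next
  note fX = ring_sheaf_function_sheaf[OF X]
  fix U f g
  assume f: "regular (induced X S) U f" and g: "regular (induced X S) U g"
  have o: "openin (subtopology (zar X) S) U" using f by (simp add: regular_induced)
  have loc: "\<exists>W f' g'. regular X W f' \<and> regular X W g' \<and> x \<in> W \<and> W \<inter> S \<subseteq> U \<and>
     (\<forall>y\<in>W \<inter> S. f y = f' y \<and> g y = g' y)" if "x \<in> U" for x
  proof -
    obtain W f' where W: "regular X W f'" "x \<in> W" "W \<inter> S \<subseteq> U" "\<forall>y\<in>W \<inter> S. f y = f' y"
      using f \<open>x \<in> U\<close> unfolding regular_induced by blast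
    obtain W' g' where W': "regular X W' g'" "x \<in> W'" "W' \<inter> S \<subseteq> U" "\<forall>y\<in>W' \<inter> S. g y = g' y"
      using g \<open>x \<in> U\<close> unfolding regular_induced by blast
    have o: "openin (zar X) (W \<inter> W')"
      using regular_open[OF fX W(1)] regular_open[OF fX W'(1)] by (rule openin_Int)
    show ?thesis
      using W W' regular_restrict[OF fX W(1) o] regular_restrict[OF fX W'(1) o]
      by (intro exI[of _ "W \<inter> W'"] exI[of _ f'] exI[of _ g']) auto
  qed
  show "regular (induced X S) U (\<lambda>x. f x + g x)"
    unfolding regular_induced
  proof (intro conjI o ballI)
    fix x assume "x \<in> U"
    from loc[OF this] regular_add[OF X]
    show "\<exists>W h. regular X W h \<and> x \<in> W \<and> W \<inter> S \<subseteq> U \<and> (\<forall>y\<in>W \<inter> S. f y + g y = h y)"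
      by (metis (no_types, lifting))
  qed
  show "regular (induced X S) U (\<lambda>x. f x * g x)"
    unfolding regular_induced
  proof (intro conjI o ballI)
    fix x assume "x \<in> U"
    from loc[OF this] regular_mult[OF X]
    show "\<exists>W h. regular X W h \<and> x \<in> W \<and> W \<inter> S \<subseteq> U \<and> (\<forall>y\<in>W \<inter> S. f y * g y = h y)"
      by (metis (no_types, lifting))
  qed
next
  note fX = ring_sheaf_function_sheaf[OF X]
  fix U f
  assume f: "regular (induced X S) U f"
  let ?D = "{x \<in> U. f x \<noteq> 0}"
  have US: "U \<subseteq> S" using f unfolding regular_induced by (metis openin_imp_subset)
  have loc: "\<exists>W g. regular X W g \<and> x \<in> W \<and> W \<inter> S \<subseteq> ?D \<and> (\<forall>y\<in>W \<inter> S. 1 / f y = g y)"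
    if x: "x \<in> ?D" for x
  proof -
    obtain W f' where W: "regular X W f'" "x \<in> W" "W \<inter> S \<subseteq> U" "\<forall>y\<in>W \<inter> S. f y = f' y"
      using f x unfolding regular_induced by force
    show ?thesis
      using W x regular_inverse[OF X W(1)] US
      by (intro exI[of _ "{y \<in> W. f' y \<noteq> 0}"] exI[of _ "\<lambda>y. 1 / f' y"]) auto
  qed
  have "openin (subtopology (zar X) S) ?D"
  proof (subst openin_subopen, intro ballI)
    fix x assume x: "x \<in> ?D"
    with loc obtain W g where W: "regular X W g" "x \<in> W" "W \<inter> S \<subseteq> ?D" by meson
    then show "\<exists>T. openin (subtopology (zar X) S) T \<and> x \<in> T \<and> T \<subseteq> ?D"
      using regular_open[OF fX W(1)] US x by (intro exI[of _ "W \<inter> S"]) (auto intro: openin_subtopology_Int)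
  qed
  with loc show "regular (induced X S) ?D (\<lambda>x. 1 / f x)"
    unfolding regular_induced by blast
qed

text \<open>
  On an open subset the induced structure is the restriction of the sheaf, since sections which are
  locally restrictions glue.
\<close>

lemma regular_induced_open:
  assumes "function_sheaf X" "openin (zar X) U"
  shows "regular (induced X U) W f \<longleftrightarrow> W \<subseteq> U \<and> regular X W f"
proof
  assume L: "regular (induced X U) W f"
  then have W: "openin (zar X) W" "W \<subseteq> U"
    using assms(2) unfolding regular_induced by (auto simp: openin_open_subtopology)
  have "regular X W f"
  proof (rule regular_glue[OF assms(1) W(1)])
    fix x assume x: "x \<in> W"
    then obtain V g where V: "regular X V g" "x \<in> V" "V \<inter> U \<subseteq> W" "\<forall>y\<in>V \<inter> U. f y = g y"
      using L unfolding regular_induced by meson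
    have "regular X (V \<inter> U) g"
      using regular_restrict[OF assms(1) V(1)] regular_open[OF assms(1) V(1)] assms(2) by blast
    then have "regular X (V \<inter> U) f"
      by (rule regular_cong[OF assms(1)]) (use V in auto)
    with V x W show "\<exists>V. x \<in> V \<and> V \<subseteq> W \<and> regular X V f" by (intro exI[of _ "V \<inter> U"]) auto
  qed
  with W show "W \<subseteq> U \<and> regular X W f" by simp
next
  assume "W \<subseteq> U \<and> regular X W f"
  then show "regular (induced X U) W f"
    using assms regular_open[OF assms(1)] unfolding regular_induced
    by (auto simp: openin_open_subtopology)
qed

text \<open>
  A section is transported to \<open>Y\<close> along one of the two inverse morphisms; the operation is done
  there, and the result is pulled back along the other.
\<close>

lemma ring_sheaf_isomorphic:
  assumes "isomorphic X Y" and X: "function_sheaf X" and Y: "ring_sheaf Y"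
  shows "ring_sheaf X"
proof -
  obtain \<phi> \<psi> where \<phi>: "morphism X Y \<phi>" and \<psi>: "morphism Y X \<psi>" and
    inv: "\<forall>x\<in>points X. \<psi> (\<phi> x) = x"
    using assms(1) unfolding isomorphic_def by blast
  have sub: "U \<subseteq> points X" if "regular X U f" for U f
    using regular_open[OF X that] by (rule openin_subset)
  have push: "regular Y {y \<in> points Y. \<psi> y \<in> U} (\<lambda>y. f (\<psi> y))" if "regular X U f" for U f
    using \<psi> that unfolding morphism_def by (auto simp: o_def)
  have pull: "regular X {x \<in> points X. \<phi> x \<in> V} (\<lambda>x. h (\<phi> x))" if "regular Y V h" for V h
    using \<phi> that unfolding morphism_def by (auto simp: o_def)
  have transfer: "regular X U f"
    if "regular Y {y \<in> points Y. \<psi> y \<in> U} (\<lambda>y. f (\<psi> y))" "U \<subseteq> points X" for U f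
  proof -
    have "{x \<in> points X. \<phi> x \<in> {y \<in> points Y. \<psi> y \<in> U}} = U"
      using that(2) inv morphism_points[OF \<phi>] by auto
    with pull[OF that(1)] have "regular X U (\<lambda>x. f (\<psi> (\<phi> x)))" by simp
    then show ?thesis by (rule regular_cong[OF X]) (use that(2) inv in auto)
  qed
  show ?thesis
    unfolding ring_sheaf_def
  proof (intro conjI allI impI X)
    fix U and c :: complex assume U: "openin (zar X) U"
    then have "openin (zar Y) {y \<in> points Y. \<psi> y \<in> U}"
      using \<psi> unfolding morphism_def continuous_map_def by blast
    from regular_const[OF Y this] openin_subset[OF U]
    show "regular X U (\<lambda>_. c)" by (intro transfer) auto
  next
    fix U f g assume fg: "regular X U f" "regular X U g"
    show "regular X U (\<lambda>x. f x + g x)"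
      using transfer[of U "\<lambda>x. f x + g x"] regular_add[OF Y push[OF fg(1)] push[OF fg(2)]] sub[OF fg(1)]
      by blast
    show "regular X U (\<lambda>x. f x * g x)"
      using transfer[of U "\<lambda>x. f x * g x"] regular_mult[OF Y push[OF fg(1)] push[OF fg(2)]] sub[OF fg(1)]
      by blast
  next
    fix U f assume f: "regular X U f"
    have "{y \<in> {y \<in> points Y. \<psi> y \<in> U}. f (\<psi> y) \<noteq> 0} = {y \<in> points Y. \<psi> y \<in> {x \<in> U. f x \<noteq> 0}}"
      by auto
    then show "regular X {x \<in> U. f x \<noteq> 0} (\<lambda>x. 1 / f x)"
      using regular_inverse[OF Y push[OF f]] sub[OF f] by (intro transfer) auto
  qed
qed

text \<open>
  The properties are local, and on a chart they are inherited from affine space.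
\<close>

lemma ring_sheaf_variety:
  assumes "is_variety X" shows "ring_sheaf X"
proof -
  have X: "function_sheaf X" using assms by (simp add: is_variety_def)
  obtain \<C> where \<C>: "\<Union>\<C> = points X"
    "\<And>U. U \<in> \<C> \<Longrightarrow> openin (zar X) U \<and> affine_variety (induced X U)"
    using assms unfolding is_variety_def by blast
  have ring: "ring_sheaf (induced X U)" if U: "U \<in> \<C>" for U
  proof -
    obtain n S where "isomorphic (induced X U) (induced (affine_space n) S)"
      using \<C>(2)[OF U] unfolding affine_variety_def by blast
    then show ?thesis
      by (rule ring_sheaf_isomorphic)
        (auto intro: X function_sheaf_induced ring_sheaf_induced ring_sheaf_affine_space)
  qed
  have cover: "\<exists>U\<in>\<C>. x \<in> U" if "openin (zar X) W" "x \<in> W" for x W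
    using that \<C>(1) openin_subset by blast
  have loc: "regular X W h"
    if W: "openin (zar X) W" and "\<And>U. U \<in> \<C> \<Longrightarrow> regular X (W \<inter> U) h" for W h
  proof (rule regular_glue[OF X W])
    fix x assume "x \<in> W"
    with cover[OF W] obtain U where "U \<in> \<C>" "x \<in> U" by blast
    with that \<open>x \<in> W\<close> show "\<exists>V. x \<in> V \<and> V \<subseteq> W \<and> regular X V h" by blast
  qed
  have restr: "regular (induced X U) (W \<inter> U) f" if "regular X W f" "U \<in> \<C>" for W U f
    using that \<C>(2)[OF that(2)] regular_open[OF X that(1)]
    by (auto simp: regular_induced_open[OF X] intro!: regular_restrict[OF X that(1)] openin_Int)
  have out: "regular X W f" if "regular (induced X U) W f" "U \<in> \<C>" for W U f
    using that \<C>(2)[OF that(2)] by (auto simp: regular_induced_open[OF X])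
  show ?thesis
    unfolding ring_sheaf_def
  proof (intro conjI allI impI X)
    fix U and c :: complex assume U: "openin (zar X) U"
    show "regular X U (\<lambda>_. c)"
    proof (rule loc[OF U])
      fix V assume V: "V \<in> \<C>"
      then have "openin (zar (induced X V)) (U \<inter> V)"
        using U by (auto intro: openin_subtopology_Int)
      from regular_const[OF ring[OF V] this] show "regular X (U \<inter> V) (\<lambda>_. c)"
        using V by (rule out)
    qed
  next
    fix U f g assume fg: "regular X U f" "regular X U g"
    note U = regular_open[OF X fg(1)]
    show "regular X U (\<lambda>x. f x + g x)"
      by (rule loc[OF U], rule out) (auto intro: regular_add[OF ring] restr fg)
    show "regular X U (\<lambda>x. f x * g x)"
      by (rule loc[OF U], rule out) (auto intro: regular_mult[OF ring] restr fg)
  next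
    fix U f assume f: "regular X U f"
    let ?D = "{x \<in> U. f x \<noteq> 0}"
    have D: "regular X (?D \<inter> V) (\<lambda>x. 1 / f x)" if V: "V \<in> \<C>" for V
    proof -
      have "{x \<in> U \<inter> V. f x \<noteq> 0} = ?D \<inter> V" by auto
      then show ?thesis
        using out[OF regular_inverse[OF ring[OF V] restr[OF f V]] V] by simp
    qed
    have "openin (zar X) ?D"
    proof (subst openin_subopen, intro ballI)
      fix x assume "x \<in> ?D"
      with cover[OF regular_open[OF X f]] obtain V where "V \<in> \<C>" "x \<in> V" by blast
      with regular_open[OF X D[OF this(1)]] \<open>x \<in> ?D\<close>
      show "\<exists>T. openin (zar X) T \<and> x \<in> T \<and> T \<subseteq> ?D" by blast
    qed
    then show "regular X ?D (\<lambda>x. 1 / f x)" using D by (rule loc)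
  qed
qed


declare topspace_zariski [simp]

lemma points_induced_affine [simp]:
  "points (induced (affine_space n) S) = affine_points n \<inter> S"
  by (simp add: topspace_zariski)

lemma poly_fun_cong:
  "poly_fun n p \<Longrightarrow> (\<And>i. i < n \<Longrightarrow> x i = y i) \<Longrightarrow> p x = p y"
  by (induction rule: poly_fun.induct) auto

lemma poly_fun_mono: "poly_fun n p \<Longrightarrow> n \<le> k \<Longrightarrow> poly_fun k p"
  by (induction rule: poly_fun.induct) (auto intro: poly_fun.intros)

lemma poly_fun_minus:
  assumes "poly_fun n p" "poly_fun n r" shows "poly_fun n (\<lambda>x. p x - r x)"
  using poly_fun.add[OF assms(1) poly_fun.mult[OF poly_fun.const[of n "-1"] assms(2)]] by simp

lemma poly_fun_prod:
  assumes "B \<subseteq> {..<n}" shows "poly_fun n (\<lambda>x. \<Prod>i\<in>B. x i)"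
proof -
  have "finite B" using assms finite_subset by blast
  then show ?thesis using assms
    by (induction B rule: finite_induct) (auto intro: poly_fun.intros)
qed

lemma closedin_zariski_zeros:
  assumes "\<forall>p\<in>P. poly_fun n p"
  shows "closedin (zariski n) {x \<in> affine_points n. \<forall>p\<in>P. p x = 0}"
proof -
  have "affine_points n - {x \<in> affine_points n. \<forall>p\<in>P. p x = 0} = affine_points n - {x. \<forall>p\<in>P. p x = 0}"
    by auto
  then show ?thesis
    using assms unfolding closedin_def openin_zariski zariski_open_def topspace_zariski by auto
qed

lemma closedin_zariski_obtain:
  assumes "closedin (zariski n) S"
  obtains P where "\<forall>p\<in>P. poly_fun n p" "S = {x \<in> affine_points n. \<forall>p\<in>P. p x = 0}"
proof -
  have S: "S \<subseteq> affine_points n" and "zariski_open n (affine_points n - S)"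
    using assms by (auto simp: closedin_def topspace_zariski openin_zariski)
  then obtain P where "\<forall>p\<in>P. poly_fun n p" "affine_points n - S = affine_points n - {x. \<forall>p\<in>P. p x = 0}"
    unfolding zariski_open_def by auto
  with S that show ?thesis by blast
qed

lemma regular_poly:
  assumes T: "ring_sheaf T" and U: "openin (zar T) U"
    and coords: "\<And>i. i < n \<Longrightarrow> regular T U (\<lambda>t. \<theta> t i)" and p: "poly_fun n p"
  shows "regular T U (\<lambda>t. p (\<theta> t))"
  using p by induction (auto intro: regular_const[OF T U] coords regular_add[OF T] regular_mult[OF T])

text \<open>
  Pullbacks of polynomials are regular because regular functions form rings; preimages of Zariski open
  sets are then unions of nonvanishing loci, and local quotients pull back to local quotients.
\<close>

lemma morphism_into_affine:
  assumes T: "ring_sheaf T"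
    and pts: "\<And>t. t \<in> points T \<Longrightarrow> \<theta> t \<in> affine_points n \<inter> S"
    and coords: "\<And>i. i < n \<Longrightarrow> regular T (points T) (\<lambda>t. \<theta> t i)"
  shows "morphism T (induced (affine_space n) S) \<theta>"
proof -
  note fT = ring_sheaf_function_sheaf[OF T]
  have poly: "regular T (points T) (\<lambda>t. p (\<theta> t))" if "poly_fun n p" for p
    using regular_poly[OF T _ coords that] by simp
  have inv: "regular T {t \<in> points T. p (\<theta> t) \<noteq> 0} (\<lambda>t. 1 / p (\<theta> t))" if "poly_fun n p" for p
    using regular_inverse[OF T poly[OF that]] .
  have open_pre: "openin (zar T) {t \<in> points T. \<theta> t \<in> W}" if W: "openin (zariski n) W" for W
  proof -
    obtain P where P: "\<forall>p\<in>P. poly_fun n p" "W = affine_points n - {x. \<forall>p\<in>P. p x = 0}"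
      using W unfolding openin_zariski zariski_open_def by auto
    have "{t \<in> points T. \<theta> t \<in> W} = (\<Union>p\<in>P. {t \<in> points T. p (\<theta> t) \<noteq> 0})"
      unfolding P(2) using pts by auto
    also have "openin (zar T) \<dots>"
      using P(1) regular_open[OF fT inv] by (intro openin_Union) auto
    finally show ?thesis .
  qed
  have "continuous_map (zar T) (zariski n) \<theta>"
    unfolding continuous_map_def topspace_zariski using open_pre pts by auto
  then have cont: "continuous_map (zar T) (zar (induced (affine_space n) S)) \<theta>"
    using pts by (auto simp: continuous_map_in_subtopology)
  have "regular T {t \<in> points T. \<theta> t \<in> V} (f \<circ> \<theta>)" if f: "regular (induced (affine_space n) S) V f" for V f
  proof (rule regular_glue[OF fT])
    have "openin (zar (induced (affine_space n) S)) V"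
      using f by (simp add: regular_induced)
    then show "openin (zar T) {t \<in> points T. \<theta> t \<in> V}"
      using cont unfolding continuous_map_def by blast
    fix t assume "t \<in> {t \<in> points T. \<theta> t \<in> V}"
    then have t: "t \<in> points T" "\<theta> t \<in> V" by auto
    then obtain W g where W: "regular (affine_space n) W g" "\<theta> t \<in> W" "W \<inter> S \<subseteq> V" "\<forall>y\<in>W \<inter> S. f y = g y"
      using f unfolding regular_induced by meson
    then obtain W' p r where W': "openin (zariski n) W'" "\<theta> t \<in> W'" "W' \<subseteq> W" "poly_fun n p" "poly_fun n r"
      "\<forall>y\<in>W'. r y \<noteq> 0 \<and> g y = p y / r y"
      unfolding regular_affine_space by meson
    let ?N = "{t \<in> points T. \<theta> t \<in> W'}"
    have N: "openin (zar T) ?N" by (rule open_pre[OF W'(1)])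
    have "regular T ?N (\<lambda>t. p (\<theta> t))"
      by (rule regular_restrict[OF fT poly[OF W'(4)] N]) auto
    moreover have "regular T ?N (\<lambda>t. 1 / r (\<theta> t))"
      by (rule regular_restrict[OF fT inv[OF W'(5)] N]) (use W'(6) in auto)
    ultimately have "regular T ?N (\<lambda>t. p (\<theta> t) * (1 / r (\<theta> t)))"
      by (rule regular_mult[OF T])
    then have "regular T ?N (f \<circ> \<theta>)"
    proof (rule regular_cong[OF fT])
      fix s assume "s \<in> ?N"
      then have "\<theta> s \<in> W'" "\<theta> s \<in> S" using pts by auto
      then show "p (\<theta> s) * (1 / r (\<theta> s)) = (f \<circ> \<theta>) s"
        using W W' by (auto simp: subset_eq)
    qed
    moreover have "?N \<subseteq> {t \<in> points T. \<theta> t \<in> V}" "t \<in> ?N"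
      using W W' pts t by auto
    ultimately show "\<exists>N. t \<in> N \<and> N \<subseteq> {t \<in> points T. \<theta> t \<in> V} \<and> regular T N (f \<circ> \<theta>)"
      by (intro exI[of _ ?N] conjI)
  qed
  with cont show ?thesis unfolding morphism_def by (intro conjI allI impI)
qed

lemma regular_coord_induced:
  assumes "i < n"
  shows "regular (induced (affine_space n) S) (affine_points n \<inter> S) (\<lambda>x. x i)"
proof -
  have "openin (subtopology (zariski n) S) (affine_points n \<inter> S)"
    using openin_topspace[of "subtopology (zariski n) S"] by (simp add: topspace_zariski)
  then show ?thesis
    unfolding regular_induced using regular_coord[OF assms] by auto
qed

lemma morphism_coord:
  assumes "morphism T (induced (affine_space n) S) \<theta>" "i < n"
  shows "regular T (points T) (\<lambda>t. \<theta> t i)"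
  using regular_pullback[OF assms(1), of "\<lambda>x. x i"] regular_coord_induced[OF assms(2), of S] by simp

lemma ring_sheaf_induced_affine: "ring_sheaf (induced (affine_space n) S)"
  by (intro ring_sheaf_induced ring_sheaf_affine_space)

lemma induced_induced:
  assumes X: "function_sheaf X" and "T \<subseteq> S"
  shows "induced (induced X S) T = induced X T"
proof -
  have top: "subtopology (subtopology (zar X) S) T = subtopology (zar X) T"
    using assms(2) by (simp add: subtopology_subtopology Int_absorb1)
  have "(\<exists>W g. regular (induced X S) W g \<and> x \<in> W \<and> W \<inter> T \<subseteq> U \<and> (\<forall>y\<in>W \<inter> T. f y = g y)) \<longleftrightarrow>
     (\<exists>W g. regular X W g \<and> x \<in> W \<and> W \<inter> T \<subseteq> U \<and> (\<forall>y\<in>W \<inter> T. f y = g y))"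
    (is "?L \<longleftrightarrow> ?R") if x: "x \<in> T" for x U f
  proof
    assume ?L
    then obtain W g where W: "regular (induced X S) W g" "x \<in> W" "W \<inter> T \<subseteq> U" "\<forall>y\<in>W \<inter> T. f y = g y"
      by meson
    then obtain V h where V: "regular X V h" "x \<in> V" "V \<inter> S \<subseteq> W" "\<forall>y\<in>V \<inter> S. g y = h y"
      unfolding regular_induced by meson
    have "f y = h y" if "y \<in> V \<inter> T" for y
      using that V W assms(2) by (metis IntD1 IntD2 IntI subsetD)
    moreover have "V \<inter> T \<subseteq> U" using V W assms(2) by blast
    ultimately show ?R using V by blast
  next
    assume ?R
    then obtain W g where W: "regular X W g" "x \<in> W" "W \<inter> T \<subseteq> U" "\<forall>y\<in>W \<inter> T. f y = g y"
      by meson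
    then have "regular (induced X S) (W \<inter> S) g"
      unfolding regular_induced using regular_open[OF X W(1)] by (auto intro: openin_subtopology_Int)
    then show ?L using W assms(2) x by (intro exI[of _ "W \<inter> S"] exI[of _ g]) auto
  qed
  then have eq: "(openin (subtopology (zar X) T) U \<and>
      (\<forall>x\<in>U. \<exists>W g. regular (induced X S) W g \<and> x \<in> W \<and> W \<inter> T \<subseteq> U \<and> (\<forall>y\<in>W \<inter> T. f y = g y))) \<longleftrightarrow>
     (openin (subtopology (zar X) T) U \<and>
      (\<forall>x\<in>U. \<exists>W g. regular X W g \<and> x \<in> W \<and> W \<inter> T \<subseteq> U \<and> (\<forall>y\<in>W \<inter> T. f y = g y)))" for U f
    using openin_imp_subset by blast
  show ?thesis
    unfolding induced_def[of "induced X S" T] induced_def[of X T] induced_simps top eq ..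
qed

text \<open>
  Separatedness is automatic in affine space: two morphisms agree exactly where all coordinates
  agree, and regular functions agree on a closed set.
\<close>

lemma is_variety_induced_affine:
  assumes "finite \<C>" "\<Union>\<C> = affine_points n \<inter> S"
    and "\<And>U. U \<in> \<C> \<Longrightarrow> openin (subtopology (zariski n) S) U"
    and "\<And>U. U \<in> \<C> \<Longrightarrow> affine_variety (induced (affine_space n) U)"
  shows "is_variety (induced (affine_space n) S)"
  unfolding is_variety_def
proof (intro conjI allI impI)
  let ?X = "induced (affine_space n) S"
  show "function_sheaf ?X"
    by (intro function_sheaf_induced function_sheaf_affine_space)
  have "induced ?X U = induced (affine_space n) U" if "U \<in> \<C>" for U
    using assms(2) that by (intro induced_induced function_sheaf_affine_space) auto
  with assms show "\<exists>\<C>. finite \<C> \<and> \<Union>\<C> = points ?X \<and>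
      (\<forall>U\<in>\<C>. openin (zar ?X) U \<and> affine_variety (induced ?X U))"
    by (intro exI[of _ \<C>] conjI ballI) simp_all
  fix T \<phi> \<psi>
  assume T: "affine_variety T" and \<phi>: "morphism T ?X \<phi>" and \<psi>: "morphism T ?X \<psi>"
  have in_pts: "\<theta> t \<in> affine_points n" if "morphism T ?X \<theta>" "t \<in> points T" for \<theta> t
    using morphism_points[OF that] by simp
  have "\<phi> t = \<psi> t \<longleftrightarrow> (\<forall>i<n. \<phi> t i = \<psi> t i)" if "t \<in> points T" for t
    using in_pts[OF \<phi> that] in_pts[OF \<psi> that] unfolding affine_points_def
    by (auto simp: fun_eq_iff) (metis not_le)
  then have "points T - {t \<in> points T. \<phi> t = \<psi> t} = (\<Union>i\<in>{..<n}. {t \<in> points T. \<phi> t i \<noteq> \<psi> t i})"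
    by auto
  moreover have "openin (zar T) (\<Union>i\<in>{..<n}. {t \<in> points T. \<phi> t i \<noteq> \<psi> t i})"
  proof (rule openin_Union, elim imageE)
    fix K i assume "K = {t \<in> points T. \<phi> t i \<noteq> \<psi> t i}" "i \<in> {..<n}"
    then show "openin (zar T) K"
      using affine_neq_open[OF T morphism_coord[OF \<phi>] morphism_coord[OF \<psi>]] by simp
  qed
  ultimately show "closedin (zar T) {t \<in> points T. \<phi> t = \<psi> t}"
    by (simp only: closedin_def Collect_restrict simp_thms)
qed

text \<open>
  The trick of Rabinowitsch: the points where \<open>h\<close> does not vanish are identified with the closed
  set \<open>y\<^sub>n h = 1\<close> in one more variable.
\<close>

lemma affine_variety_principal:
  assumes S: "closedin (zariski n) S" and h: "poly_fun n h"
  shows "affine_variety (induced (affine_space n) {x \<in> S. h x \<noteq> 0})"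
proof -
  let ?U = "{x \<in> S. h x \<noteq> 0}"
  obtain P where P: "\<forall>p\<in>P. poly_fun n p" "S = {x \<in> affine_points n. \<forall>p\<in>P. p x = 0}"
    using S by (rule closedin_zariski_obtain)
  define r where "r = (\<lambda>y. y n * h y - 1)"
  define C where "C = {y \<in> affine_points (Suc n). \<forall>p\<in>insert r P. p y = 0}"
  have r: "poly_fun (Suc n) r"
    unfolding r_def using poly_fun_mono[OF h]
    by (intro poly_fun_minus poly_fun.intros) auto
  have C: "closedin (zariski (Suc n)) C"
    unfolding C_def using P(1) r by (intro closedin_zariski_zeros) (auto intro: poly_fun_mono)
  define \<phi> where "\<phi> = (\<lambda>x::point. x(n := 1 / h x))"
  define \<psi> where "\<psi> = (\<lambda>y::point. y(n := 0))"
  let ?A = "induced (affine_space n) ?U" and ?C = "induced (affine_space (Suc n)) C"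
  have upd: "p (x(n := c)) = p x" if "poly_fun n p" for p x c
    by (rule poly_fun_cong[OF that]) auto
  have updP: "p (x(n := c)) = p x" if "p \<in> P" for p x c
    using upd P(1) that by blast
  have "morphism ?A ?C \<phi>"
  proof (rule morphism_into_affine[OF ring_sheaf_induced_affine])
    fix x assume x: "x \<in> points ?A"
    then have "x \<in> affine_points n" "h x \<noteq> 0" "\<forall>p\<in>P. p x = 0" using P(2) by auto
    then show "\<phi> x \<in> affine_points (Suc n) \<inter> C"
      using upd[OF h] unfolding C_def \<phi>_def r_def by (auto simp: affine_points_def updP)
  next
    fix i assume i: "i < Suc n"
    have coord: "regular ?A (points ?A) (\<lambda>x. x j)" if "j < n" for j
      using regular_coord_induced[OF that, of ?U] by simp
    show "regular ?A (points ?A) (\<lambda>x. \<phi> x i)"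
    proof (cases "i = n")
      case False
      then show ?thesis using coord[of i] i by (simp add: \<phi>_def)
    next
      case True
      have "regular ?A (points ?A) h"
        using regular_poly[where \<theta> = "\<lambda>x. x", OF ring_sheaf_induced_affine openin_topspace coord h] by simp
      from regular_inverse[OF ring_sheaf_induced_affine this]
      have "regular ?A {x \<in> points ?A. h x \<noteq> 0} (\<lambda>x. 1 / h x)" .
      moreover have "{x \<in> points ?A. h x \<noteq> 0} = points ?A" by auto
      ultimately show ?thesis using True by (simp add: \<phi>_def)
    qed
  qed
  moreover have "morphism ?C ?A \<psi>"
  proof (rule morphism_into_affine[OF ring_sheaf_induced_affine])
    fix y assume y: "y \<in> points ?C"
    then have y: "y \<in> affine_points (Suc n)" "y n * h y = 1" "\<forall>p\<in>P. p y = 0"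
      by (auto simp: C_def r_def)
    then show "\<psi> y \<in> affine_points n \<inter> ?U"
      using upd[OF h] unfolding \<psi>_def P(2) by (auto simp: affine_points_def le_less_Suc_eq updP)
  next
    fix i assume i: "i < n"
    then show "regular ?C (points ?C) (\<lambda>y. \<psi> y i)"
      using regular_coord_induced[of i "Suc n" C] by (simp add: \<psi>_def)
  qed
  moreover have "\<psi> (\<phi> x) = x" if "x \<in> points ?A" for x
    using that unfolding \<phi>_def \<psi>_def by (auto simp: affine_points_def)
  moreover have "\<phi> (\<psi> y) = y" if "y \<in> points ?C" for y
  proof -
    have "y n * h y = 1" using that by (auto simp: C_def r_def)
    then have "1 / h y = y n" by (metis mult_zero_right nonzero_eq_divide_eq zero_neq_one)
    then show ?thesis using upd[OF h] unfolding \<phi>_def \<psi>_def by auto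
  qed
  ultimately have "isomorphic ?A ?C" unfolding isomorphic_def by blast
  with C show ?thesis
    unfolding affine_variety_def using ring_sheaf_function_sheaf[OF ring_sheaf_induced_affine]
    by (intro conjI exI[of _ "Suc n"] exI[of _ C])
qed


section \<open>Classes of unions of coordinate strata\<close>

lemma induced_points:
  assumes "function_sheaf X" shows "induced X (points X) = X"
proof -
  have "regular (induced X (points X)) W f \<longleftrightarrow> regular X W f" for W f
    using regular_induced_open[OF assms openin_topspace] regular_open[OF assms] openin_subset
    by blast
  then have "regular (induced X (points X)) = regular X" by (intro ext) simp
  then show ?thesis
    using fspace.equality[of "induced X (points X)" X] by simp
qed

lemma affine_space_induced: "induced (affine_space n) (affine_points n) = affine_space n"
  using induced_points[OF function_sheaf_affine_space[of n]] by simp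

lemma space_of_variety_of: "is_variety X \<Longrightarrow> space_of (variety_of X) = X"
  by (simp add: variety_of_inverse)

lemma cong_mod_relation: "a - b \<in> R \<Longrightarrow> cong_mod R a b"
  unfolding cong_mod_def by (rule ideal_gen_base)

lemma class_of_isomorphic:
  assumes "is_variety X" "is_variety Y" "isomorphic X Y"
  shows "class_of (variety_of X) = class_of (variety_of Y)"
proof -
  have "isomorphic (space_of (variety_of X)) (space_of (variety_of Y))"
    using assms by (simp add: space_of_variety_of)
  then have "cong_mod K0_rels (gen (variety_of X)) (gen (variety_of Y))"
    by (intro cong_mod_relation) (auto simp: K0_rels_def)
  then show ?thesis by (simp add: class_of.abs_eq K0.abs_eq_iff)
qed

lemma class_of_cut:
  assumes "is_variety X" "closedin (zar X) S"
    and "is_variety (induced X S)" "is_variety (induced X (points X - S))"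
  shows "class_of (variety_of X) =
    class_of (variety_of (induced X S)) + class_of (variety_of (induced X (points X - S)))"
proof -
  let ?X = "variety_of X" and ?Y = "variety_of (induced X S)"
  let ?U = "variety_of (induced X (points X - S))"
  have "\<exists>S. closedin (zar (space_of ?X)) S \<and> space_of ?Y = induced (space_of ?X) S \<and>
       space_of ?U = induced (space_of ?X) (points (space_of ?X) - S)"
    using assms by (intro exI[of _ S]) (simp add: space_of_variety_of)
  then have "gen ?X - (gen ?Y + gen ?U) \<in> K0_rels"
    unfolding K0_rels_def by blast
  then have "cong_mod K0_rels (gen ?X) (gen ?Y + gen ?U)"
    by (rule cong_mod_relation)
  then show ?thesis by (simp add: class_of.abs_eq plus_K0.abs_eq K0.abs_eq_iff)
qed

lemma class_of_product:
  assumes "is_product P X Y" shows "class_of P = class_of X * class_of Y"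
proof -
  have "gen P - gen X * gen Y \<in> K0_rels"
    using assms unfolding K0_rels_def by blast
  then have "cong_mod K0_rels (gen P) (gen X * gen Y)"
    by (rule cong_mod_relation)
  then show ?thesis by (simp add: class_of.abs_eq times_K0.abs_eq K0.abs_eq_iff)
qed

lemma class_of_point: "class_of (variety_of (affine_space 0)) = 1"
proof -
  have "space_of (variety_of (affine_space 0)) = affine_space 0"
    by (intro space_of_variety_of is_variety_affine_space)
  then have "gen (variety_of (affine_space 0)) - 1 \<in> K0_rels"
    unfolding K0_rels_def by blast
  then have "cong_mod K0_rels (gen (variety_of (affine_space 0))) 1"
    by (rule cong_mod_relation)
  then show ?thesis by (simp add: class_of.abs_eq one_K0.abs_eq K0.abs_eq_iff)
qed

text \<open>
  The points whose set of nonzero coordinates is a member of \<open>\<S>\<close>. The locus of semistable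
  representations has this form.
\<close>

definition strata :: "nat \<Rightarrow> nat set set \<Rightarrow> point set" where
  "strata n \<S> = {x \<in> affine_points n. {i. x i \<noteq> 0} \<in> \<S>}"

lemma strata_subset [simp]: "affine_points n \<inter> strata n \<S> = strata n \<S>"
  "strata n \<S> \<subseteq> affine_points n"
  by (auto simp: strata_def)

lemma support_subset: "x \<in> affine_points n \<Longrightarrow> {i. x i \<noteq> 0} \<subseteq> {..<n}"
  unfolding affine_points_def by (auto simp: not_less[symmetric])

lemma coordinates_zero_iff:
  assumes "x \<in> affine_points n"
  shows "(\<forall>p\<in>(\<lambda>i x. x i) ` ({..<n} - B). p x = 0) \<longleftrightarrow> {i. x i \<noteq> 0} \<subseteq> B"
  using support_subset[OF assms] by auto

text \<open>
  The set is cut out by the vanishing of the coordinates outside \<open>D\<close> and the invertibility of the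
  product of the coordinates in \<open>B\<close>.
\<close>

lemma affine_variety_strata_interval:
  assumes "B \<subseteq> D" "D \<subseteq> {..<n}"
  shows "affine_variety (induced (affine_space n) (strata n {C. B \<subseteq> C \<and> C \<subseteq> D}))"
proof -
  let ?S = "{x \<in> affine_points n. \<forall>p\<in>(\<lambda>i x. x i) ` ({..<n} - D). p x = 0}"
  have fin: "finite B" using assms finite_subset[of B "{..<n}"] by auto
  have "(\<Prod>i\<in>B. x i) \<noteq> 0 \<longleftrightarrow> B \<subseteq> {i. x i \<noteq> 0}" for x :: point
    using fin by auto
  then have "x \<in> strata n {C. B \<subseteq> C \<and> C \<subseteq> D} \<longleftrightarrow> x \<in> {x \<in> ?S. (\<Prod>i\<in>B. x i) \<noteq> 0}" for x
    unfolding strata_def mem_Collect_eq using coordinates_zero_iff[of x n D] by metis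
  then have "strata n {C. B \<subseteq> C \<and> C \<subseteq> D} = {x \<in> ?S. (\<Prod>i\<in>B. x i) \<noteq> 0}"
    by (rule set_eqI)
  moreover have "affine_variety (induced (affine_space n) {x \<in> ?S. (\<Prod>i\<in>B. x i) \<noteq> 0})"
  proof (rule affine_variety_principal)
    show "closedin (zariski n) ?S"
      by (rule closedin_zariski_zeros) (auto intro: poly_fun.coord)
    show "poly_fun n (\<lambda>x. \<Prod>i\<in>B. x i)"
      using assms by (intro poly_fun_prod) blast
  qed
  ultimately show ?thesis by simp
qed

lemma is_variety_strata_interval:
  assumes "B \<subseteq> D" "D \<subseteq> {..<n}"
  shows "is_variety (induced (affine_space n) (strata n {C. B \<subseteq> C \<and> C \<subseteq> D}))"
proof (rule is_variety_induced_affine)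
  let ?S = "strata n {C. B \<subseteq> C \<and> C \<subseteq> D}"
  show "finite {?S}" "\<Union>{?S} = affine_points n \<inter> ?S" by simp_all
  fix U assume U: "U \<in> {?S}"
  then show "affine_variety (induced (affine_space n) U)"
    using affine_variety_strata_interval[OF assms] by simp
  show "openin (subtopology (zariski n) ?S) U"
    using openin_topspace[of "subtopology (zariski n) ?S"] U by simp
qed

definition up_closed :: "nat \<Rightarrow> nat set set \<Rightarrow> bool" where
  "up_closed n \<S> \<longleftrightarrow> \<S> \<subseteq> Pow {..<n} \<and> (\<forall>A\<in>\<S>. \<forall>B. A \<subseteq> B \<longrightarrow> B \<subseteq> {..<n} \<longrightarrow> B \<in> \<S>)"

lemma up_closed_finite: "up_closed n \<S> \<Longrightarrow> finite \<S>"
  unfolding up_closed_def by (meson finite_Pow_iff finite_lessThan finite_subset)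

text \<open>
  The set is open in affine space and is covered by the principal open sets given by its members.
\<close>

lemma is_variety_strata_up_closed:
  assumes "up_closed n \<S>"
  shows "is_variety (induced (affine_space n) (strata n \<S>))"
proof (rule is_variety_induced_affine)
  let ?U = "\<lambda>B. strata n {C. B \<subseteq> C \<and> C \<subseteq> {..<n}}"
  have supp: "{i. x i \<noteq> 0} \<subseteq> {..<n}" if "x \<in> affine_points n" for x
    using that by (rule support_subset)
  show "finite (?U ` \<S>)" using up_closed_finite[OF assms] by simp
  have U: "?U B \<subseteq> strata n \<S>" if "B \<in> \<S>" for B
    using that assms unfolding up_closed_def strata_def by auto
  moreover have "strata n \<S> \<subseteq> \<Union>(?U ` \<S>)"
    using supp unfolding strata_def by auto
  ultimately have "\<Union>(?U ` \<S>) = strata n \<S>" by blast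
  then show "\<Union>(?U ` \<S>) = affine_points n \<inter> strata n \<S>" by simp
  fix V assume "V \<in> ?U ` \<S>"
  then obtain B where B: "B \<in> \<S>" "V = ?U B" by blast
  then have sub: "B \<subseteq> {..<n}" using assms by (auto simp: up_closed_def)
  then show "affine_variety (induced (affine_space n) V)"
    unfolding B(2) by (intro affine_variety_strata_interval) auto
  have "finite B" using sub finite_subset by blast
  then have "V = {x \<in> affine_points n. (\<Prod>i\<in>B. x i) \<noteq> 0}"
    unfolding B(2) strata_def using supp by auto
  moreover have "openin (zariski n) {x \<in> affine_points n. (\<Prod>i\<in>B. x i) \<noteq> 0}"
    by (intro openin_zariski_nonzero poly_fun_prod sub)
  ultimately have "openin (zariski n) V" by simp
  then have "openin (subtopology (zariski n) (strata n \<S>)) (V \<inter> strata n \<S>)"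
    by (rule openin_subtopology_Int)
  moreover have "V \<inter> strata n \<S> = V" using U B by blast
  ultimately show "openin (subtopology (zariski n) (strata n \<S>)) V" by simp
qed

abbreviation strata_class :: "nat \<Rightarrow> nat set set \<Rightarrow> K0" where
  "strata_class n \<S> \<equiv> class_of (variety_of (induced (affine_space n) (strata n \<S>)))"

text \<open>
  Minimality of \<open>B\<close> makes the stratum of \<open>B\<close> closed: it is cut out by the coordinates outside \<open>B\<close>.
\<close>

lemma strata_class_cut:
  assumes "is_variety (induced (affine_space n) (strata n \<S>))"
    and "is_variety (induced (affine_space n) (strata n {B}))"
    and "is_variety (induced (affine_space n) (strata n (\<S> - {B})))"
    and B: "B \<in> \<S>" "\<And>C. C \<in> \<S> \<Longrightarrow> C \<subseteq> B \<Longrightarrow> C = B" and sub: "B \<subseteq> {..<n}"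
  shows "strata_class n \<S> = strata_class n {B} + strata_class n (\<S> - {B})"
proof -
  let ?X = "induced (affine_space n) (strata n \<S>)"
  let ?Z = "{x \<in> affine_points n. \<forall>p\<in>(\<lambda>i x. x i) ` ({..<n} - B). p x = 0}"
  have "closedin (zariski n) ?Z"
    by (rule closedin_zariski_zeros) (auto intro: poly_fun.coord)
  then have "closedin (zar ?X) (?Z \<inter> strata n \<S>)"
    by (auto simp: closedin_subtopology)
  moreover have "?Z \<inter> strata n \<S> = strata n {B}"
  proof (rule set_eqI)
    fix x
    have min: "S \<subseteq> B \<and> S \<in> \<S> \<longleftrightarrow> S = B" for S using B by auto
    show "x \<in> ?Z \<inter> strata n \<S> \<longleftrightarrow> x \<in> strata n {B}"
    proof (cases "x \<in> affine_points n")
      case True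
      show ?thesis
        unfolding strata_def Int_iff mem_Collect_eq singleton_iff coordinates_zero_iff[OF True]
        using min[of "{i. x i \<noteq> 0}"] by (simp only: True simp_thms)
    qed (simp add: strata_def)
  qed
  ultimately have cl: "closedin (zar ?X) (strata n {B})" by simp
  have ind: "induced ?X (strata n \<T>) = induced (affine_space n) (strata n \<T>)" if "\<T> \<subseteq> \<S>" for \<T>
    using that by (intro induced_induced function_sheaf_affine_space) (auto simp: strata_def)
  have diff: "points ?X - strata n {B} = strata n (\<S> - {B})"
    by (auto simp: strata_def)
  have 1: "induced ?X (strata n {B}) = induced (affine_space n) (strata n {B})"
    "induced ?X (points ?X - strata n {B}) = induced (affine_space n) (strata n (\<S> - {B}))"
    unfolding diff using B(1) by (intro ind; blast)+
  show ?thesis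
    using class_of_cut[OF assms(1) cl] assms(2,3) unfolding 1 by blast
qed

text \<open>
  Letting the coordinate \<open>i\<close> vary freely over the stratum of \<open>B\<close> gives the product with the line; a
  map into it is a map into the stratum together with the value of that coordinate.
\<close>

lemma product_line:
  assumes i: "i < n" "i \<notin> B" and B: "B \<subseteq> {..<n}"
  shows "is_product (variety_of (induced (affine_space n) (strata n {B, insert i B})))
    (variety_of (induced (affine_space n) (strata n {B}))) (variety_of (affine_space 1))"
proof -
  let ?P = "induced (affine_space n) (strata n {B, insert i B})"
  let ?X = "induced (affine_space n) (strata n {B})"
  have "{C. B \<subseteq> C \<and> C \<subseteq> insert i B} = {B, insert i B}" "{C. B \<subseteq> C \<and> C \<subseteq> B} = {B}"
    using i by auto
  then have var: "is_variety ?P" "is_variety ?X"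
    using is_variety_strata_interval[of B "insert i B" n] is_variety_strata_interval[of B B n] i B by auto
  have sp: "space_of (variety_of ?P) = ?P" "space_of (variety_of ?X) = ?X"
    "space_of (variety_of (affine_space 1)) = induced (affine_space 1) (affine_points 1)"
    using var is_variety_affine_space by (simp_all add: space_of_variety_of affine_space_induced)
  define \<pi> where "\<pi> = (\<lambda>x::point. x(i := 0))"
  define \<rho> where "\<rho> = (\<lambda>(x::point) k. if k = (0::nat) then x i else 0)"
  have coordP: "regular ?P (points ?P) (\<lambda>x. x j)" if "j < n" for j
    using regular_coord_induced[OF that, of "strata n {B, insert i B}"] by simp
  have supp0: "{k. (x(i := 0)) k \<noteq> 0} = {k. x k \<noteq> 0} - {i}" for x :: point
    by auto
  have supp1: "{k. (x(i := c)) k \<noteq> 0} = insert i {k. x k \<noteq> 0}" if "c \<noteq> 0" for x :: point and c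
    using that by auto
  have const: "regular ?P (points ?P) (\<lambda>_. 0)"
    by (intro regular_const[OF ring_sheaf_induced_affine] openin_topspace)
  have \<pi>: "morphism ?P ?X \<pi>"
  proof (rule morphism_into_affine[OF ring_sheaf_induced_affine])
    fix x assume "x \<in> points ?P"
    then have "x \<in> affine_points n" "{k. x k \<noteq> 0} \<in> {B, insert i B}" by (auto simp: strata_def)
    then show "\<pi> x \<in> affine_points n \<inter> strata n {B}"
      using i unfolding strata_def \<pi>_def mem_Collect_eq supp0 by (auto simp: affine_points_def)
  next
    fix j assume "j < n"
    then show "regular ?P (points ?P) (\<lambda>x. \<pi> x j)"
      using coordP const by (cases "j = i") (simp_all add: \<pi>_def)
  qed
  have \<rho>: "morphism ?P (induced (affine_space 1) (affine_points 1)) \<rho>"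
  proof (rule morphism_into_affine[OF ring_sheaf_induced_affine])
    fix j :: nat assume "j < 1"
    then show "regular ?P (points ?P) (\<lambda>x. \<rho> x j)"
      using coordP[OF i(1)] by (simp add: \<rho>_def)
  qed (auto simp: \<rho>_def affine_points_def)
  show ?thesis
    unfolding is_product_def sp
  proof (rule exI[of _ \<pi>], rule exI[of _ \<rho>], intro conjI allI impI \<pi> \<rho>)
    fix T \<phi> \<psi>
    assume \<phi>: "morphism (space_of T) ?X \<phi>"
      and \<psi>: "morphism (space_of T) (induced (affine_space 1) (affine_points 1)) \<psi>"
    have T: "ring_sheaf (space_of T)" using space_of[of T] by (simp add: ring_sheaf_variety)
    have \<phi>p: "\<phi> t \<in> affine_points n" "{k. \<phi> t k \<noteq> 0} = B" if "t \<in> points (space_of T)" for t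
      using morphism_points[OF \<phi> that] by (auto simp: strata_def)
    have \<psi>p: "\<psi> t \<in> affine_points 1" if "t \<in> points (space_of T)" for t
      using morphism_points[OF \<psi> that] by auto
    define h where "h = (\<lambda>t. (\<phi> t)(i := \<psi> t 0))"
    have "morphism (space_of T) ?P h"
    proof (rule morphism_into_affine[OF T])
      fix t assume t: "t \<in> points (space_of T)"
      have "{k. h t k \<noteq> 0} \<in> {B, insert i B}"
        using \<phi>p(2)[OF t] i supp0 supp1 unfolding h_def by (cases "\<psi> t 0 = 0") auto
      then show "h t \<in> affine_points n \<inter> strata n {B, insert i B}"
        using \<phi>p(1)[OF t] i(1) by (auto simp: strata_def h_def affine_points_def)
    next
      fix j assume "j < n"
      then show "regular (space_of T) (points (space_of T)) (\<lambda>t. h t j)"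
        using morphism_coord[OF \<phi>] morphism_coord[OF \<psi>, of 0] by (cases "j = i") (simp_all add: h_def)
    qed
    moreover have "\<pi> (h t) = \<phi> t \<and> \<rho> (h t) = \<psi> t" if t: "t \<in> points (space_of T)" for t
    proof
      have "\<phi> t i = 0" using \<phi>p(2)[OF t] i(2) by auto
      then show "\<pi> (h t) = \<phi> t" by (auto simp: \<pi>_def h_def)
      show "\<rho> (h t) = \<psi> t" using \<psi>p[OF t] by (auto simp: \<rho>_def h_def affine_points_def)
    qed
    moreover have "h' t = h t" if "\<pi> (h' t) = \<phi> t" "\<rho> (h' t) = \<psi> t" for h' t
    proof
      fix k
      show "h' t k = h t k"
        using fun_cong[OF that(1), of k] fun_cong[OF that(2), of 0]
        by (cases "k = i") (simp_all add: \<pi>_def \<rho>_def h_def)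
    qed
    ultimately show "\<exists>h. morphism (space_of T) ?P h \<and>
        (\<forall>t\<in>points (space_of T). \<pi> (h t) = \<phi> t \<and> \<rho> (h t) = \<psi> t) \<and>
        (\<forall>h'. morphism (space_of T) ?P h' \<longrightarrow>
          (\<forall>t\<in>points (space_of T). \<pi> (h' t) = \<phi> t \<and> \<rho> (h' t) = \<psi> t) \<longrightarrow>
          (\<forall>t\<in>points (space_of T). h' t = h t))"
      by (metis (no_types))
  qed
qed

text \<open>
  Induction on \<open>B\<close>. The product of the stratum with a line has class \<open>(\<bbbL> - 1)\<^sup>k \<bbbL>\<close>, and removing the
  zero section leaves \<open>(\<bbbL> - 1)\<^sup>k \<bbbL> - (\<bbbL> - 1)\<^sup>k\<close>.
\<close>

lemma strata_class_torus:
  assumes "B \<subseteq> {..<n}"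
  shows "strata_class n {B} = (Lef - 1) ^ card B"
proof -
  have var: "is_variety (induced (affine_space n) (strata n {B}))" if "B \<subseteq> {..<n}" for B
  proof -
    have "{C. B \<subseteq> C \<and> C \<subseteq> B} = {B}" by auto
    then show ?thesis using is_variety_strata_interval[OF subset_refl that] by simp
  qed
  have "finite B" using assms finite_subset by blast
  then show ?thesis using assms
  proof (induction B rule: finite_induct)
    case empty
    let ?X = "induced (affine_space n) (strata n {{}})" and ?A = "induced (affine_space 0) (affine_points 0)"
    have pt: "strata n {{}} = {\<lambda>_. 0}" "affine_points 0 = {\<lambda>_. 0}"
      by (auto simp: strata_def affine_points_def)
    have "morphism ?X ?A (\<lambda>x. x)" "morphism ?A ?X (\<lambda>x. x)"
    proof -
      show "morphism ?X ?A (\<lambda>x. x)"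
        by (rule morphism_into_affine[OF ring_sheaf_induced_affine]) (auto simp: pt)
      show "morphism ?A ?X (\<lambda>x. x)"
      proof (rule morphism_into_affine[OF ring_sheaf_induced_affine])
        fix j
        have "regular ?A (points ?A) (\<lambda>_. 0)"
          by (intro regular_const[OF ring_sheaf_induced_affine] openin_topspace)
        then show "regular ?A (points ?A) (\<lambda>x. x j)"
          by (rule regular_cong[OF ring_sheaf_function_sheaf[OF ring_sheaf_induced_affine]])
            (auto simp: pt)
      qed (auto simp: pt affine_points_def)
    qed
    then have "isomorphic ?X ?A" unfolding isomorphic_def by blast
    then have "isomorphic ?X (affine_space 0)" by (simp add: affine_space_induced)
    from class_of_isomorphic[OF var is_variety_affine_space this] class_of_point
    show ?case by simp
  next
    case (insert i B)
    let ?S = "{B, insert i B}"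
    have "{C. B \<subseteq> C \<and> C \<subseteq> insert i B} = ?S"
      using insert by auto
    then have v: "is_variety (induced (affine_space n) (strata n ?S))"
      using is_variety_strata_interval[of B "insert i B" n] insert by auto
    have d: "?S - {B} = {insert i B}" using insert by auto
    have "strata_class n ?S = strata_class n {B} + strata_class n (?S - {B})"
      by (rule strata_class_cut[OF v]) (use var insert d in auto)
    moreover have "strata_class n ?S = strata_class n {B} * Lef"
      using class_of_product[OF product_line[of i n B]] insert unfolding Lef_def by auto
    moreover have "strata_class n {B} = (Lef - 1) ^ card B"
      using insert by auto
    ultimately have "strata_class n {insert i B} = (Lef - 1) ^ card B * (Lef - 1)"
      unfolding d by (simp add: right_diff_distrib eq_diff_eq add.commute)
    then show ?case using insert by (simp add: mult.commute)
  qed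
qed

text \<open>
  Strata are removed one by one, a minimal one first, so that the remaining family stays closed
  under enlarging.
\<close>

lemma strata_class_up_closed:
  assumes "up_closed n \<S>"
  shows "strata_class n \<S> = (\<Sum>B\<in>\<S>. (Lef - 1) ^ card B)"
  using assms
proof (induction "card \<S>" arbitrary: \<S>)
  case 0
  then have S: "\<S> = {}" using up_closed_finite by auto
  have v: "is_variety (induced (affine_space n) (strata n {}))"
    by (rule is_variety_strata_up_closed) (simp add: up_closed_def)
  let ?X = "induced (affine_space n) (strata n {})"
  have e: "strata n {} = {}" by (simp add: strata_def)
  have i: "induced ?X {} = ?X" "points ?X = {}"
    unfolding e using induced_induced[OF function_sheaf_affine_space, of "{}" "{}"] by simp_all
  have "strata_class n {} = strata_class n {} + strata_class n {}"
    using class_of_cut[of ?X "{}"] v i by simp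
  then show ?case unfolding S by simp
next
  case (Suc k)
  have fin: "finite \<S>" and ne: "\<S> \<noteq> {}" using up_closed_finite Suc by auto
  obtain B where B: "B \<in> \<S>" "\<And>C. C \<in> \<S> \<Longrightarrow> C \<subseteq> B \<Longrightarrow> C = B"
    using finite_has_minimal[OF fin ne] by metis
  have sub: "B \<subseteq> {..<n}" using B(1) Suc.prems by (auto simp: up_closed_def)
  have up: "up_closed n (\<S> - {B})"
    using Suc.prems B unfolding up_closed_def by blast
  have "{C. B \<subseteq> C \<and> C \<subseteq> B} = {B}" by auto
  then have v: "is_variety (induced (affine_space n) (strata n {B}))"
    using is_variety_strata_interval[OF subset_refl sub] by simp
  have "strata_class n \<S> = strata_class n {B} + strata_class n (\<S> - {B})"
    by (rule strata_class_cut[OF is_variety_strata_up_closed[OF Suc.prems] v is_variety_strata_up_closed[OF up] B sub])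
  also have "strata_class n (\<S> - {B}) = (\<Sum>B\<in>\<S> - {B}. (Lef - 1) ^ card B)"
    using Suc.hyps fin B(1) up by simp
  also have "strata_class n {B} = (Lef - 1) ^ card B" by (rule strata_class_torus[OF sub])
  finally show ?case using sum.remove[OF fin B(1), of "\<lambda>B. (Lef - 1) ^ card B"] by simp
qed

lemma tensor_add_left: "tensor (a + b) r = tensor a r + tensor b r"
proof -
  have "cong_mod tensor_rels (pure_tensor (a + b) r) (pure_tensor a r + pure_tensor b r)"
    unfolding tensor_rels_def by (rule cong_mod_relation) blast
  then show ?thesis by (simp add: tensor.abs_eq plus_motive.abs_eq motive.abs_eq_iff)
qed

lemma tensor_add_right: "tensor a (r + s) = tensor a r + tensor a s"
proof -
  have "cong_mod tensor_rels (pure_tensor a (r + s)) (pure_tensor a r + pure_tensor a s)"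
    unfolding tensor_rels_def by (rule cong_mod_relation) blast
  then show ?thesis by (simp add: tensor.abs_eq plus_motive.abs_eq motive.abs_eq_iff)
qed

lemma tensor_Lef: "tensor (Lef * a) r = tensor a (qhalf ^ 2 * r)"
proof -
  have "cong_mod tensor_rels (pure_tensor (Lef * a) r) (pure_tensor a (qhalf ^ 2 * r))"
    unfolding tensor_rels_def by (rule cong_mod_relation) blast
  then show ?thesis by (simp add: tensor.abs_eq motive.abs_eq_iff)
qed

lemma tensor_mult: "tensor a r * tensor b s = tensor (a * b) (r * s)"
  by (simp add: tensor.abs_eq times_motive.abs_eq mult_single)

lemma tensor_one: "tensor 1 1 = 1"
  by (simp add: tensor.abs_eq one_motive.abs_eq flip: zero_pure_def)

lemma scalar_add: "scalar (r + s) = scalar r + scalar s"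
  and scalar_mult: "scalar (r * s) = scalar r * scalar s"
  and scalar_1 [simp]: "scalar 1 = 1"
  by (simp_all add: tensor_add_right tensor_mult tensor_one)

lemma scalar_0 [simp]: "scalar 0 = 0"
  using scalar_add[of 0 0] by simp

lemma scalar_diff: "scalar (r - s) = scalar r - scalar s"
  using scalar_add[of "r - s" s] by (simp add: eq_diff_eq)

lemma scalar_sum: "scalar (sum f A) = (\<Sum>a\<in>A. scalar (f a))"
  by (induction A rule: infinite_finite_induct) (simp_all add: scalar_add)

lemma motive_of_strata:
  assumes "up_closed n \<S>"
  shows "motive_of (induced (affine_space n) (strata n \<S>)) = scalar (\<Sum>B\<in>\<S>. (qhalf ^ 2 - 1) ^ card B)"
proof -
  have zero: "tensor 0 1 = 0" using tensor_add_left[of 0 0 1] by simp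
  have sum: "tensor (\<Sum>a\<in>A. f a) 1 = (\<Sum>a\<in>A. tensor (f a) 1)" for f and A :: "nat set set"
    by (induction A rule: infinite_finite_induct) (simp_all add: zero tensor_add_left)
  have "tensor (Lef - 1) 1 + tensor 1 1 = tensor Lef 1"
    using tensor_add_left[of "Lef - 1" 1 1] by simp
  then have "tensor (Lef - 1) 1 = scalar (qhalf ^ 2 - 1)"
    using tensor_Lef[of 1 1] by (simp add: scalar_diff eq_diff_eq tensor_one)
  then have pow: "tensor ((Lef - 1) ^ k) 1 = scalar ((qhalf ^ 2 - 1) ^ k)" for k
  proof (induction k)
    case (Suc k)
    have "tensor ((Lef - 1) ^ Suc k) 1 = tensor (Lef - 1) 1 * tensor ((Lef - 1) ^ k) 1"
      by (simp add: tensor_mult)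
    also have "\<dots> = scalar ((qhalf ^ 2 - 1) ^ Suc k)"
      unfolding Suc.IH[OF Suc.prems] Suc.prems by (simp add: tensor_mult)
    finally show ?case .
  qed simp
  show ?thesis
    unfolding motive_of_def strata_class_up_closed[OF assms] sum scalar_sum pow ..
qed


section \<open>Slopes in the positive cone\<close>

lemma zmult_0 [simp]: "zmult 0 x = 0"
  by (simp add: zmult_def)

lemma zmult_of_nat: "zmult (int n) x = (\<Sum>_\<in>{..<n}. x)"
  by (simp add: zmult_def)

lemma zmult_1 [simp]: "zmult 1 x = x"
  using zmult_of_nat[of 1 x] by simp

lemma zmult_minus: "zmult (- k) x = - zmult k x"
  by (cases "k = 0") (auto simp: zmult_def)

lemma zmult_Suc: "zmult (int (Suc n)) x = zmult (int n) x + x"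
  unfolding zmult_of_nat by simp

lemma zmult_plus_1: "zmult (k + 1) x = zmult k x + x"
proof (cases "k \<ge> 0")
  case True
  then show ?thesis using zmult_Suc[of "nat k" x] by (simp add: add.commute)
next
  case False
  then have "zmult (- k) x = zmult (- k - 1) x + x"
    using zmult_Suc[of "nat (- k - 1)" x] by simp
  moreover have "zmult (k + 1) x = - zmult (- k - 1) x"
    using zmult_minus[of "- k - 1" x] by (simp add: add.commute)
  moreover from calculation have "zmult k x = - (zmult (- k - 1) x + x)"
    unfolding zmult_minus by (metis minus_minus)
  ultimately show ?thesis by simp
qed

lemma zmult_add: "zmult (a + b) x = zmult a x + zmult b x"
proof (induction b rule: int_induct[of _ 0])
  case base
  then show ?case by simp
next
  case (step1 i)
  then show ?case using zmult_plus_1[of "a + i" x] zmult_plus_1[of i x] by (simp add: add.assoc)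
next
  case (step2 i)
  have "zmult (a + i) x = zmult (a + (i - 1)) x + x" "zmult i x = zmult (i - 1) x + x"
    using zmult_plus_1[of "a + i - 1" x] zmult_plus_1[of "i - 1" x] by (simp_all add: algebra_simps)
  with step2 show ?case by (simp add: algebra_simps)
qed

lemma additive_zmult:
  assumes "\<And>x y. f (x + y) = f x + f y" shows "f (zmult k x) = zmult k (f x)"
proof -
  have f0: "f 0 = 0" using assms[of 0 0] by simp
  have fn: "f (zmult (int n) x) = zmult (int n) (f x)" for n
    by (induction n) (simp_all add: f0 assms zmult_Suc del: of_nat_Suc)
  have fm: "f (- y) = - f y" for y using assms[of y "- y"] f0 by (simp add: eq_neg_iff_add_eq_0 add.commute)
  show ?thesis
  proof (cases "k \<ge> 0")
    case True
    then show ?thesis using fn[of "nat k"] by simp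
  next
    case False
    then show ?thesis using fn[of "nat (- k)"] by (simp add: zmult_minus fm)
  qed
qed

lemma zmult_int: "zmult k (x :: int) = k * x"
proof -
  have n: "zmult (int n) x = int n * x" for n by (simp add: zmult_of_nat)
  show ?thesis
    using n[of "nat k"] n[of "nat (- k)"] zmult_minus[of "- k" x] by (cases "k \<ge> 0") auto
qed

locale positive_lattice =
  fixes \<Gamma> :: "'g::ab_group_add skew_lattice"
  assumes lattice: "rank2_skew_lattice \<Gamma>" and form_pos: "form \<Gamma> (e1 \<Gamma>) (e2 \<Gamma>) > 0"
begin

definition coords :: "'g \<Rightarrow> int \<times> int" where
  "coords \<gamma> = (THE (a, b). \<gamma> = zmult a (e1 \<Gamma>) + zmult b (e2 \<Gamma>))"

abbreviation cx :: "'g \<Rightarrow> int" where "cx \<gamma> \<equiv> fst (coords \<gamma>)"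
abbreviation cy :: "'g \<Rightarrow> int" where "cy \<gamma> \<equiv> snd (coords \<gamma>)"
definition deg :: "'g \<Rightarrow> int" where "deg \<gamma> = cx \<gamma> + cy \<gamma>"

lemma coords: "\<gamma> = zmult (cx \<gamma>) (e1 \<Gamma>) + zmult (cy \<gamma>) (e2 \<Gamma>)"
proof -
  have "\<exists>!(a, b). \<gamma> = zmult a (e1 \<Gamma>) + zmult b (e2 \<Gamma>)"
    using lattice unfolding rank2_skew_lattice_def by blast
  from theI'[OF this] show ?thesis unfolding coords_def by (simp add: case_prod_unfold)
qed

lemma coords_unique: "\<gamma> = zmult a (e1 \<Gamma>) + zmult b (e2 \<Gamma>) \<Longrightarrow> coords \<gamma> = (a, b)"
proof -
  assume a: "\<gamma> = zmult a (e1 \<Gamma>) + zmult b (e2 \<Gamma>)"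
  have "\<exists>!p. case p of (a, b) \<Rightarrow> \<gamma> = zmult a (e1 \<Gamma>) + zmult b (e2 \<Gamma>)"
    using lattice unfolding rank2_skew_lattice_def by blast
  moreover have "case coords \<gamma> of (a, b) \<Rightarrow> \<gamma> = zmult a (e1 \<Gamma>) + zmult b (e2 \<Gamma>)"
    using coords[of \<gamma>] by (simp add: case_prod_unfold)
  moreover have "case (a, b) of (a, b) \<Rightarrow> \<gamma> = zmult a (e1 \<Gamma>) + zmult b (e2 \<Gamma>)"
    using a by simp
  ultimately show ?thesis by blast
qed

lemma coords_add: "cx (\<alpha> + \<beta>) = cx \<alpha> + cx \<beta>" "cy (\<alpha> + \<beta>) = cy \<alpha> + cy \<beta>"
proof -
  have "\<alpha> + \<beta> = (zmult (cx \<alpha>) (e1 \<Gamma>) + zmult (cy \<alpha>) (e2 \<Gamma>)) + (zmult (cx \<beta>) (e1 \<Gamma>) + zmult (cy \<beta>) (e2 \<Gamma>))"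
    using coords[of \<alpha>] coords[of \<beta>] by metis
  also have "\<dots> = zmult (cx \<alpha> + cx \<beta>) (e1 \<Gamma>) + zmult (cy \<alpha> + cy \<beta>) (e2 \<Gamma>)"
    by (simp add: zmult_add)
  finally show "cx (\<alpha> + \<beta>) = cx \<alpha> + cx \<beta>" "cy (\<alpha> + \<beta>) = cy \<alpha> + cy \<beta>"
    using coords_unique by auto
qed

lemma coords_0 [simp]: "cx 0 = 0" "cy 0 = 0"
  using coords_add[of 0 0] by simp_all

lemma coords_eqI: "cx \<alpha> = cx \<beta> \<Longrightarrow> cy \<alpha> = cy \<beta> \<Longrightarrow> \<alpha> = \<beta>"
  using coords by metis

lemma form_add_left: "form \<Gamma> (x + y) z = form \<Gamma> x z + form \<Gamma> y z"
  and form_add_right: "form \<Gamma> x (y + z) = form \<Gamma> x y + form \<Gamma> x z"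
  and form_skew: "form \<Gamma> x y = - form \<Gamma> y x"
  using lattice unfolding rank2_skew_lattice_def by blast+

lemma form_0 [simp]: "form \<Gamma> 0 x = 0" "form \<Gamma> x 0 = 0" and form_self [simp]: "form \<Gamma> x x = 0"
  using form_add_left[of 0 0 x] form_add_right[of x 0 0] form_skew[of x x] by simp_all

lemma form_sum_left: "form \<Gamma> (sum f A) z = (\<Sum>a\<in>A. form \<Gamma> (f a) z)"
  and form_sum_right: "form \<Gamma> z (sum f A) = (\<Sum>a\<in>A. form \<Gamma> z (f a))"
  by (induction A rule: infinite_finite_induct) (simp_all add: form_add_left form_add_right)

lemma form_coords: "form \<Gamma> \<alpha> \<beta> = form \<Gamma> (e1 \<Gamma>) (e2 \<Gamma>) * (cx \<alpha> * cy \<beta> - cy \<alpha> * cx \<beta>)"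
proof -
  have l: "form \<Gamma> (zmult k x) z = k * form \<Gamma> x z" for k x z
    using additive_zmult[of "\<lambda>x. form \<Gamma> x z" k x] by (simp add: form_add_left zmult_int)
  have r: "form \<Gamma> z (zmult k x) = k * form \<Gamma> z x" for k x z
    using additive_zmult[of "\<lambda>x. form \<Gamma> z x" k x] by (simp add: form_add_right zmult_int)
  have "form \<Gamma> \<alpha> \<beta> = form \<Gamma> (zmult (cx \<alpha>) (e1 \<Gamma>) + zmult (cy \<alpha>) (e2 \<Gamma>)) (zmult (cx \<beta>) (e1 \<Gamma>) + zmult (cy \<beta>) (e2 \<Gamma>))"
    using coords[of \<alpha>] coords[of \<beta>] by metis
  also have "\<dots> = form \<Gamma> (e1 \<Gamma>) (e2 \<Gamma>) * (cx \<alpha> * cy \<beta> - cy \<alpha> * cx \<beta>)"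
    using form_skew[of "e2 \<Gamma>" "e1 \<Gamma>"]
    by (simp add: form_add_left form_add_right l r algebra_simps)
  finally show ?thesis .
qed

lemma deg_add: "deg (\<alpha> + \<beta>) = deg \<alpha> + deg \<beta>" and deg_0 [simp]: "deg 0 = 0"
  by (simp_all add: deg_def coords_add)

lemma Gplus_iff: "\<gamma> \<in> Gplus \<Gamma> \<longleftrightarrow> 0 \<le> cx \<gamma> \<and> 0 \<le> cy \<gamma>"
proof
  assume "\<gamma> \<in> Gplus \<Gamma>"
  then obtain a b where "\<gamma> = zmult (int a) (e1 \<Gamma>) + zmult (int b) (e2 \<Gamma>)" unfolding Gplus_def by blast
  from coords_unique[OF this] show "0 \<le> cx \<gamma> \<and> 0 \<le> cy \<gamma>" by simp
next
  assume a: "0 \<le> cx \<gamma> \<and> 0 \<le> cy \<gamma>"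
  then show "\<gamma> \<in> Gplus \<Gamma>"
    unfolding Gplus_def using coords[of \<gamma>] by (intro CollectI exI[of _ "nat (cx \<gamma>)"] exI[of _ "nat (cy \<gamma>)"]) simp
qed

lemma Gplus_0 [simp]: "0 \<in> Gplus \<Gamma>"
  and Gplus_add: "\<alpha> \<in> Gplus \<Gamma> \<Longrightarrow> \<beta> \<in> Gplus \<Gamma> \<Longrightarrow> \<alpha> + \<beta> \<in> Gplus \<Gamma>"
  by (simp_all add: Gplus_iff coords_add)

lemma deg_nonneg: "\<gamma> \<in> Gplus \<Gamma> \<Longrightarrow> 0 \<le> deg \<gamma>"
  by (simp add: Gplus_iff deg_def)

lemma deg_pos: "\<gamma> \<in> Gplus_nz \<Gamma> \<Longrightarrow> 0 < deg \<gamma>"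
  using coords_eqI[of \<gamma> 0] by (fastforce simp: Gplus_iff deg_def)

lemma deg_eq_0: "\<gamma> \<in> Gplus \<Gamma> \<Longrightarrow> deg \<gamma> = 0 \<longleftrightarrow> \<gamma> = 0"
  using deg_pos[of \<gamma>] by (cases "\<gamma> = 0") auto

lemma Gplus_nz_add: "\<alpha> \<in> Gplus_nz \<Gamma> \<Longrightarrow> \<beta> \<in> Gplus \<Gamma> \<Longrightarrow> \<alpha> + \<beta> \<in> Gplus_nz \<Gamma>"
  using deg_pos[of \<alpha>] deg_nonneg[of \<beta>] deg_add[of \<alpha> \<beta>] by (auto simp: Gplus_add)

lemma Gplus_nz_sum:
  assumes "finite V" "V \<noteq> {}" "\<And>v. v \<in> V \<Longrightarrow> f v \<in> Gplus_nz \<Gamma>"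
  shows "sum f V \<in> Gplus_nz \<Gamma>"
  using assms
proof (induction V rule: finite_ne_induct)
  case (insert v V)
  then show ?case using Gplus_nz_add[of "f v" "sum f V"] by auto
qed simp

lemma finite_Gplus_bounded: "finite {\<alpha> \<in> Gplus \<Gamma>. deg \<alpha> \<le> k}"
proof (rule finite_imageD)
  have "coords ` {\<alpha> \<in> Gplus \<Gamma>. deg \<alpha> \<le> k} \<subseteq> {0..k} \<times> {0..k}"
    by (intro image_subsetI) (simp add: mem_Times_iff Gplus_iff deg_def)
  then show "finite (coords ` {\<alpha> \<in> Gplus \<Gamma>. deg \<alpha> \<le> k})"
    by (rule finite_subset) auto
  show "inj_on coords {\<alpha> \<in> Gplus \<Gamma>. deg \<alpha> \<le> k}"
    by (rule inj_onI) (auto intro: coords_eqI)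
qed

lemma finite_decompositions: "finite {(\<alpha>, \<beta>). \<alpha> \<in> Gplus \<Gamma> \<and> \<beta> \<in> Gplus \<Gamma> \<and> \<alpha> + \<beta> = \<gamma>}"
proof (rule finite_subset)
  let ?B = "{\<alpha> \<in> Gplus \<Gamma>. deg \<alpha> \<le> deg \<gamma>}"
  show "{(\<alpha>, \<beta>). \<alpha> \<in> Gplus \<Gamma> \<and> \<beta> \<in> Gplus \<Gamma> \<and> \<alpha> + \<beta> = \<gamma>} \<subseteq> ?B \<times> ?B"
    using deg_nonneg by (auto simp: deg_add)
  show "finite (?B \<times> ?B)" using finite_Gplus_bounded by blast
qed

text \<open>
  Three vectors of a plane satisfy \<open>\<langle>\<alpha>,\<beta>\<rangle>\<gamma> + \<langle>\<beta>,\<gamma>\<rangle>\<alpha> + \<langle>\<gamma>,\<alpha>\<rangle>\<beta> = 0\<close>; this is the degree of that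
  relation. As degrees are positive on the cone, it turns comparison of slopes into a transitive
  relation.
\<close>

lemma form_cocycle: "form \<Gamma> \<alpha> \<beta> * deg \<gamma> + form \<Gamma> \<beta> \<gamma> * deg \<alpha> = form \<Gamma> \<alpha> \<gamma> * deg \<beta>"
  unfolding form_coords[of \<alpha>] form_coords[of \<beta>] deg_def by (simp add: algebra_simps)

lemma form_trans_pos:
  assumes "\<alpha> \<in> Gplus_nz \<Gamma>" "\<beta> \<in> Gplus_nz \<Gamma>" "\<gamma> \<in> Gplus_nz \<Gamma>"
    and "s * form \<Gamma> \<alpha> \<beta> > 0 \<and> s * form \<Gamma> \<beta> \<gamma> \<ge> 0 \<or> s * form \<Gamma> \<alpha> \<beta> \<ge> 0 \<and> s * form \<Gamma> \<beta> \<gamma> > 0"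
  shows "s * form \<Gamma> \<alpha> \<gamma> > 0"
proof -
  have d: "deg \<alpha> > 0" "deg \<beta> > 0" "deg \<gamma> > 0" using assms(1-3) deg_pos by auto
  have "s * form \<Gamma> \<alpha> \<gamma> * deg \<beta> = s * form \<Gamma> \<alpha> \<beta> * deg \<gamma> + s * form \<Gamma> \<beta> \<gamma> * deg \<alpha>"
    using form_cocycle[of \<alpha> \<beta> \<gamma>] by (simp add: algebra_simps flip: distrib_left)
  also have "\<dots> > 0"
    using assms(4) d by (auto intro: add_pos_nonneg add_nonneg_pos)
  finally show ?thesis using d(2) by (simp add: zero_less_mult_iff)
qed

lemma form_trans_nonneg:
  assumes "\<alpha> \<in> Gplus_nz \<Gamma>" "\<beta> \<in> Gplus_nz \<Gamma>" "\<gamma> \<in> Gplus_nz \<Gamma>"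
    and "s * form \<Gamma> \<alpha> \<beta> \<ge> 0" "s * form \<Gamma> \<beta> \<gamma> \<ge> 0"
  shows "s * form \<Gamma> \<alpha> \<gamma> \<ge> 0"
proof -
  have d: "deg \<alpha> > 0" "deg \<beta> > 0" "deg \<gamma> > 0" using assms(1-3) deg_pos by auto
  have "s * form \<Gamma> \<alpha> \<gamma> * deg \<beta> = s * form \<Gamma> \<alpha> \<beta> * deg \<gamma> + s * form \<Gamma> \<beta> \<gamma> * deg \<alpha>"
    using form_cocycle[of \<alpha> \<beta> \<gamma>] by (simp add: algebra_simps flip: distrib_left)
  also have "\<dots> \<ge> 0"
    using assms(4,5) d by auto
  finally show ?thesis using d(2) by (simp add: zero_le_mult_iff)
qed

lemma plane_coords: "plane \<Gamma> \<gamma> = (real_of_int (cx \<gamma>), real_of_int (cy \<gamma>))"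
  unfolding plane_def
proof (rule the_equality)
  show "case (real_of_int (cx \<gamma>), real_of_int (cy \<gamma>)) of (u, v) \<Rightarrow>
    \<exists>a b. \<gamma> = zmult a (e1 \<Gamma>) + zmult b (e2 \<Gamma>) \<and> u = real_of_int a \<and> v = real_of_int b"
    using coords[of \<gamma>] by auto
qed (use coords_unique[of \<gamma>] in auto)

definition ray :: "'g \<Rightarrow> (real \<times> real) set" where
  "ray \<gamma> = {t *\<^sub>R plane \<Gamma> \<gamma> | t. t > 0}"

lemma rays_eq: "rays \<Gamma> = ray ` Gplus_nz \<Gamma>"
  unfolding rays_def ray_def by blast

lemma in_ray_self: "plane \<Gamma> \<gamma> \<in> ray \<gamma>"
  unfolding ray_def by (auto intro!: exI[of _ 1])

lemma in_ray_Gplus_nz: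
  assumes "\<delta> \<in> Gplus_nz \<Gamma>" "plane \<Gamma> \<alpha> \<in> ray \<delta>" shows "\<alpha> \<in> Gplus_nz \<Gamma>"
proof -
  obtain t where t: "t > 0" "real_of_int (cx \<alpha>) = t * real_of_int (cx \<delta>)" "real_of_int (cy \<alpha>) = t * real_of_int (cy \<delta>)"
    using assms(2) by (auto simp: ray_def plane_coords)
  have "cx \<delta> \<ge> 0" "cy \<delta> \<ge> 0" using assms(1) by (auto simp: Gplus_iff)
  with t have "real_of_int (cx \<alpha>) \<ge> 0" "real_of_int (cy \<alpha>) \<ge> 0" by simp_all
  moreover have "real_of_int (deg \<alpha>) > 0"
    using t(1) deg_pos[OF assms(1)] unfolding deg_def of_int_add t(2,3)
    by (simp flip: distrib_left of_int_add)
  ultimately show ?thesis by (auto simp: Gplus_iff)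
qed

lemma in_ray_iff:
  assumes "\<alpha> \<in> Gplus_nz \<Gamma>" "\<delta> \<in> Gplus_nz \<Gamma>"
  shows "plane \<Gamma> \<alpha> \<in> ray \<delta> \<longleftrightarrow> form \<Gamma> \<alpha> \<delta> = 0"
proof
  assume "plane \<Gamma> \<alpha> \<in> ray \<delta>"
  then obtain t where t: "real_of_int (cx \<alpha>) = t * real_of_int (cx \<delta>)" "real_of_int (cy \<alpha>) = t * real_of_int (cy \<delta>)"
    by (auto simp: ray_def plane_coords)
  then have "real_of_int (cx \<alpha> * cy \<delta> - cy \<alpha> * cx \<delta>) = 0" by simp
  then show "form \<Gamma> \<alpha> \<delta> = 0" unfolding form_coords[of \<alpha>] by (metis mult_zero_right of_int_eq_0_iff)
next
  assume "form \<Gamma> \<alpha> \<delta> = 0"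
  then have c: "cx \<alpha> * cy \<delta> = cy \<alpha> * cx \<delta>" using form_pos unfolding form_coords[of \<alpha>] by simp
  have d: "deg \<alpha> > 0" "deg \<delta> > 0" using assms deg_pos by auto
  define t where "t = real_of_int (deg \<alpha>) / real_of_int (deg \<delta>)"
  have "cx \<alpha> * deg \<delta> = deg \<alpha> * cx \<delta>" "cy \<alpha> * deg \<delta> = deg \<alpha> * cy \<delta>"
    using c by (simp_all add: deg_def algebra_simps)
  then have "real_of_int (cx \<alpha>) * real_of_int (deg \<delta>) = real_of_int (deg \<alpha>) * real_of_int (cx \<delta>)"
    "real_of_int (cy \<alpha>) * real_of_int (deg \<delta>) = real_of_int (deg \<alpha>) * real_of_int (cy \<delta>)"
    by (metis of_int_mult)+
  then have "real_of_int (cx \<alpha>) = t * real_of_int (cx \<delta>)" "real_of_int (cy \<alpha>) = t * real_of_int (cy \<delta>)"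
    using d(2) unfolding t_def by (simp_all add: field_simps)
  moreover have "t > 0" using d by (simp add: t_def)
  ultimately show "plane \<Gamma> \<alpha> \<in> ray \<delta>" unfolding ray_def plane_coords by auto
qed

lemma ray_eq_iff:
  assumes "\<alpha> \<in> Gplus_nz \<Gamma>" "\<beta> \<in> Gplus_nz \<Gamma>"
  shows "ray \<alpha> = ray \<beta> \<longleftrightarrow> form \<Gamma> \<alpha> \<beta> = 0"
proof
  assume "ray \<alpha> = ray \<beta>"
  then show "form \<Gamma> \<alpha> \<beta> = 0" using in_ray_self[of \<alpha>] in_ray_iff[OF assms] by simp
next
  have sub: "ray \<alpha> \<subseteq> ray \<beta>" if "form \<Gamma> \<alpha> \<beta> = 0" "\<alpha> \<in> Gplus_nz \<Gamma>" "\<beta> \<in> Gplus_nz \<Gamma>" for \<alpha> \<beta>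
  proof
    fix p assume "p \<in> ray \<alpha>"
    then obtain t where t: "t > 0" "p = t *\<^sub>R plane \<Gamma> \<alpha>" by (auto simp: ray_def)
    have "plane \<Gamma> \<alpha> \<in> ray \<beta>" using in_ray_iff that by blast
    then obtain r where r: "r > 0" "plane \<Gamma> \<alpha> = r *\<^sub>R plane \<Gamma> \<beta>" by (auto simp: ray_def)
    then have "p = (t * r) *\<^sub>R plane \<Gamma> \<beta>" "t * r > 0" using t by simp_all
    then show "p \<in> ray \<beta>" unfolding ray_def by blast
  qed
  assume "form \<Gamma> \<alpha> \<beta> = 0"
  then show "ray \<alpha> = ray \<beta>"
    using sub[of \<alpha> \<beta>] sub[of \<beta> \<alpha>] assms form_skew[of \<alpha> \<beta>] by auto
qed

lemma clockwise_iff: "clockwise (ray \<alpha>) (ray \<beta>) \<longleftrightarrow> form \<Gamma> \<alpha> \<beta> < 0"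
proof -
  have key: "t * a * (r * b) < t * c * (r * d) \<longleftrightarrow> a * b < c * d" if "t > 0" "r > 0" for t r a b c d :: real
  proof -
    have "t * a * (r * b) = (t * r) * (a * b)" "t * c * (r * d) = (t * r) * (c * d)" by simp_all
    then show ?thesis using that by (simp only: mult_less_cancel_left_pos[OF mult_pos_pos])
  qed
  have "clockwise (ray \<alpha>) (ray \<beta>) \<longleftrightarrow>
      (\<exists>t>0. \<exists>r>0. t * real_of_int (cx \<alpha>) * (r * real_of_int (cy \<beta>)) < t * real_of_int (cy \<alpha>) * (r * real_of_int (cx \<beta>)))"
    unfolding clockwise_def ray_def plane_coords by (simp add: Bex_def conj_ac) blast
  also have "\<dots> \<longleftrightarrow> real_of_int (cx \<alpha>) * real_of_int (cy \<beta>) < real_of_int (cy \<alpha>) * real_of_int (cx \<beta>)"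
    using key zero_less_one by (metis (no_types, lifting))
  also have "\<dots> \<longleftrightarrow> cx \<alpha> * cy \<beta> - cy \<alpha> * cx \<beta> < 0"
    by (simp flip: of_int_mult)
  also have "\<dots> \<longleftrightarrow> form \<Gamma> \<alpha> \<beta> < 0"
    unfolding form_coords[of \<alpha>] using form_pos by (simp add: mult_less_0_iff)
  finally show ?thesis .
qed

end

section \<open>Harder-Narasimhan filtrations of sets of arrows\<close>

lemma sum_Pow_Un_disjoint:
  assumes "finite X" "finite Y" "X \<inter> Y = {}"
  shows "(\<Sum>A\<in>Pow (X \<union> Y). F A) = (\<Sum>B\<in>Pow X. \<Sum>C\<in>Pow Y. F (B \<union> C))"
proof -
  have "(\<Sum>B\<in>Pow X. \<Sum>C\<in>Pow Y. F (B \<union> C)) = (\<Sum>(B, C)\<in>Pow X \<times> Pow Y. F (B \<union> C))"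
    by (rule sum.cartesian_product)
  also have "\<dots> = (\<Sum>A\<in>Pow (X \<union> Y). F A)"
    by (rule sum.reindex_bij_witness[of _ "\<lambda>A. (A \<inter> X, A \<inter> Y)" "\<lambda>(B, C). B \<union> C"])
      (use assms in auto)
  finally show ?thesis by simp
qed

lemma sum_Pow_power_card:
  assumes "finite X" shows "(\<Sum>A\<in>Pow X. (y :: 'a::comm_semiring_1) ^ card A) = (1 + y) ^ card X"
  using assms
proof (induction X rule: finite_induct)
  case (insert x X)
  have "(\<Sum>A\<in>Pow (insert x X). y ^ card A) = (\<Sum>A\<in>Pow (X \<union> {x}). y ^ card A)" by simp
  also have "\<dots> = (\<Sum>B\<in>Pow X. \<Sum>C\<in>Pow {x}. y ^ card (B \<union> C))"
    using insert by (intro sum_Pow_Un_disjoint) auto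
  also have "\<dots> = (\<Sum>B\<in>Pow X. y ^ card B * (1 + y))"
  proof (rule sum.cong[OF refl])
    fix B assume "B \<in> Pow X"
    then have "finite B" "x \<notin> B" using insert finite_subset by auto
    then show "(\<Sum>C\<in>Pow {x}. y ^ card (B \<union> C)) = y ^ card B * (1 + y)"
      by (simp add: Pow_insert algebra_simps)
  qed
  also have "\<dots> = (\<Sum>B\<in>Pow X. y ^ card B) * (1 + y)"
    by (rule sum_distrib_right[symmetric])
  finally show ?case using insert by (simp add: mult.commute)
qed simp

context positive_lattice
begin

definition weight :: "'g vertex set \<Rightarrow> 'g" where
  "weight U = (\<Sum>v\<in>U. fst v)"

definition vertex_set :: "'g vertex set \<Rightarrow> bool" where
  "vertex_set V \<longleftrightarrow> finite V \<and> fst ` V \<subseteq> Gplus_nz \<Gamma>"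

text \<open>
  The subrepresentations of an abelian representation are the sets of vertices closed under the
  set \<open>A\<close> of arrows which act by nonzero numbers. Arrows leaving \<open>V\<close> are ignored, so
  that the notion applies to subquotients without restricting \<open>A\<close>.
\<close>

definition closed_in :: "'g arrow set \<Rightarrow> 'g vertex set \<Rightarrow> 'g vertex set \<Rightarrow> bool" where
  "closed_in A V U \<longleftrightarrow> U \<subseteq> V \<and> (\<forall>(v, w, j)\<in>A. v \<in> U \<longrightarrow> w \<in> V \<longrightarrow> w \<in> U)"

lemma closed_inD: "closed_in A V U \<Longrightarrow> (v, w, j) \<in> A \<Longrightarrow> v \<in> U \<Longrightarrow> w \<in> V \<Longrightarrow> w \<in> U"
  unfolding closed_in_def by blast

lemma closed_in_subset: "closed_in A V U \<Longrightarrow> U \<subseteq> V"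
  by (simp add: closed_in_def)

lemma closed_inI:
  "U \<subseteq> V \<Longrightarrow> (\<And>v w j. (v, w, j) \<in> A \<Longrightarrow> v \<in> U \<Longrightarrow> w \<in> V \<Longrightarrow> w \<in> U) \<Longrightarrow> closed_in A V U"
  unfolding closed_in_def by blast

lemma closed_in_trans:
  assumes "closed_in A U W" "closed_in A V U" shows "closed_in A V W"
proof (rule closed_inI)
  show "W \<subseteq> V" using assms[THEN closed_in_subset] by blast
  fix v w j assume a: "(v, w, j) \<in> A" "v \<in> W" "w \<in> V"
  then have "w \<in> U" using closed_inD[OF assms(2)] closed_in_subset[OF assms(1)] by blast
  then show "w \<in> W" using closed_inD[OF assms(1)] a by blast
qed

lemma closed_in_Un:
  assumes "closed_in A (V - U) W" "closed_in A V U" shows "closed_in A V (W \<union> U)"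
proof (rule closed_inI)
  show "W \<union> U \<subseteq> V" using assms[THEN closed_in_subset] by blast
  fix v w j assume "(v, w, j) \<in> A" "v \<in> W \<union> U" "w \<in> V"
  then show "w \<in> W \<union> U" using closed_inD[OF assms(1), of v w j] closed_inD[OF assms(2), of v w j] by blast
qed

text \<open>
  For \<open>s = -1\<close> this is semistability for a stability function as in the theorem, where a larger slope
  means that the form is negative; for \<open>s = 1\<close> the order of slopes is reversed.
\<close>

definition semistable_conf :: "int \<Rightarrow> 'g arrow set \<Rightarrow> 'g vertex set \<Rightarrow> bool" where
  "semistable_conf s A V \<longleftrightarrow> (\<forall>U. closed_in A V U \<longrightarrow> s * form \<Gamma> (weight U) (weight V) \<le> 0)"

text \<open>
  A Harder-Narasimhan filtration whose subquotients lie on the rays of the list, in that order. Every ray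
  of the list gets a subquotient, which may be empty; the weight of an empty set is \<open>0\<close>, on which
  the form vanishes.
\<close>

fun hn_conf :: "int \<Rightarrow> 'g arrow set \<Rightarrow> 'g list \<Rightarrow> 'g vertex set \<Rightarrow> bool" where
  "hn_conf s A [] V \<longleftrightarrow> V = {}"
| "hn_conf s A (d # ds) V \<longleftrightarrow>
    (\<exists>U. closed_in A V U \<and> form \<Gamma> d (weight U) = 0 \<and> semistable_conf s A U \<and> hn_conf s A ds (V - U))"

abbreviation before :: "int \<Rightarrow> 'g \<Rightarrow> 'g \<Rightarrow> bool" where
  "before s \<alpha> \<beta> \<equiv> s * form \<Gamma> \<alpha> \<beta> > 0"

lemma vertex_set_subset: "vertex_set V \<Longrightarrow> U \<subseteq> V \<Longrightarrow> vertex_set U"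
  unfolding vertex_set_def by (blast intro: finite_subset)

lemma weight_empty [simp]: "weight {} = 0" by (simp add: weight_def)

lemma weight_nz: "vertex_set V \<Longrightarrow> U \<subseteq> V \<Longrightarrow> U \<noteq> {} \<Longrightarrow> weight U \<in> Gplus_nz \<Gamma>"
  using vertex_set_subset[of V U] unfolding weight_def vertex_set_def by (intro Gplus_nz_sum) auto

lemma weight_Un_disjoint:
  "vertex_set V \<Longrightarrow> U \<subseteq> V \<Longrightarrow> W \<subseteq> V \<Longrightarrow> U \<inter> W = {} \<Longrightarrow> weight (U \<union> W) = weight U + weight W"
  unfolding weight_def vertex_set_def by (intro sum.union_disjoint) (auto intro: finite_subset)

lemma weight_split:
  assumes "vertex_set V" "W \<subseteq> V" shows "weight W = weight (W \<inter> U) + weight (W - U)"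
  using weight_Un_disjoint[OF assms(1), of "W \<inter> U" "W - U"] assms(2) by (simp add: Int_Diff_Un Diff_Int_distrib subset_eq)

lemma form_nonneg_of_parallel:
  assumes "vertex_set V" "d \<in> Gplus_nz \<Gamma>" "form \<Gamma> d (weight U) = 0" "U \<subseteq> V" "semistable_conf s A U" "closed_in A U W"
  shows "s * form \<Gamma> d (weight W) \<ge> 0"
proof (cases "W = {}")
  case False
  have WU: "W \<subseteq> U" using assms(6) by (simp add: closed_in_def)
  then have "U \<noteq> {}" "weight U \<in> Gplus_nz \<Gamma>" "weight W \<in> Gplus_nz \<Gamma>"
    using False assms(4) weight_nz[OF assms(1)] by auto
  moreover have "s * form \<Gamma> (weight U) (weight W) \<ge> 0"
    using assms(5,6) form_skew[of "weight U" "weight W"] by (auto simp: semistable_conf_def)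
  ultimately show ?thesis
    using assms(2,3) by (intro form_trans_nonneg[of d "weight U" "weight W"]) auto
qed simp

text \<open>
  If all subquotients lie on rays after that of \<open>l\<close>, then so does every subrepresentation \<open>W\<close>: its
  part in the first subquotient does because of semistability, and the rest by induction.
\<close>

lemma hn_weight_after:
  assumes "hn_conf s A ds V" "vertex_set V" "l \<in> Gplus_nz \<Gamma>" "set ds \<subseteq> Gplus_nz \<Gamma>" "\<forall>d\<in>set ds. before s l d"
    and "closed_in A V W" "W \<noteq> {}"
  shows "before s l (weight W)"
  using assms
proof (induction ds arbitrary: V W)
  case (Cons d ds)
  then obtain U where U: "closed_in A V U" "form \<Gamma> d (weight U) = 0" "semistable_conf s A U" "hn_conf s A ds (V - U)"
    by auto
  have UV: "U \<subseteq> V" and WV: "W \<subseteq> V" using U(1) Cons.prems(6) by (simp_all add: closed_in_def)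
  have 1: "before s l (weight (W \<inter> U))" if ne: "W \<inter> U \<noteq> {}"
  proof -
    have "closed_in A U (W \<inter> U)"
      using Cons.prems(6) UV unfolding closed_in_def by blast
    then have "s * form \<Gamma> d (weight (W \<inter> U)) \<ge> 0"
      using form_nonneg_of_parallel[OF Cons.prems(2) _ U(2) UV U(3)] Cons.prems(4) by auto
    moreover have "weight (W \<inter> U) \<in> Gplus_nz \<Gamma>"
      using weight_nz[OF Cons.prems(2) _ ne] WV by auto
    ultimately show ?thesis
      using Cons.prems(3-5) by (intro form_trans_pos[of l d]) auto
  qed
  have 2: "before s l (weight (W - U))" if "W - U \<noteq> {}"
  proof (rule Cons.IH[OF U(4)])
    show "closed_in A (V - U) (W - U)"
      using Cons.prems(6) unfolding closed_in_def by blast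
  qed (use that Cons.prems vertex_set_subset[of V "V - U"] in auto)
  have "form \<Gamma> l (weight W) = form \<Gamma> l (weight (W \<inter> U)) + form \<Gamma> l (weight (W - U))"
    using weight_split[OF Cons.prems(2) WV, of U] by (simp add: form_add_right)
  then have "s * form \<Gamma> l (weight W) = s * form \<Gamma> l (weight (W \<inter> U)) + s * form \<Gamma> l (weight (W - U))"
    by (simp add: distrib_left)
  then show ?case
    using 1 2 Cons.prems(7) by (cases "W \<inter> U = {}"; cases "W - U = {}") (auto simp: Diff_eq_empty_iff)
qed (auto simp: closed_in_def)

text \<open>
  Uniqueness of the first step. If \<open>U'\<close> is not contained in \<open>U\<close>, then the part of \<open>U'\<close> outside
  \<open>U\<close> is a subrepresentation of the quotient by \<open>U\<close>, hence lies after the ray of \<open>l\<close>, while the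
  part inside \<open>U\<close> does not lie before it because \<open>U'\<close> is semistable. So the weight of \<open>U'\<close>
  cannot be on the ray of \<open>l\<close>.
\<close>

lemma hn_first_subset:
  assumes V: "vertex_set V" and l: "l \<in> Gplus_nz \<Gamma>" "set ds \<subseteq> Gplus_nz \<Gamma>" "\<forall>d\<in>set ds. before s l d"
    and U: "closed_in A V U" "form \<Gamma> l (weight U) = 0" "semistable_conf s A U" "hn_conf s A ds (V - U)"
    and U': "closed_in A V U'" "form \<Gamma> l (weight U') = 0" "semistable_conf s A U'"
  shows "U' \<subseteq> U"
proof (rule ccontr)
  assume "\<not> U' \<subseteq> U"
  then have ne: "U' - U \<noteq> {}" by auto
  have sub: "U \<subseteq> V" "U' \<subseteq> V" using U(1) U'(1) by (simp_all add: closed_in_def)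
  have "closed_in A (V - U) (U' - U)" using U'(1) unfolding closed_in_def by blast
  then have 1: "before s l (weight (U' - U))"
    using hn_weight_after[OF U(4) vertex_set_subset[OF V] l] ne by blast
  have "closed_in A U' (U' \<inter> U)" using U(1) sub unfolding closed_in_def by blast
  then have 2: "s * form \<Gamma> l (weight (U' \<inter> U)) \<ge> 0"
    using form_nonneg_of_parallel[OF V l(1) U'(2) sub(2) U'(3)] by blast
  have "s * form \<Gamma> l (weight U') = s * form \<Gamma> l (weight (U' \<inter> U)) + s * form \<Gamma> l (weight (U' - U))"
    using weight_split[OF V sub(2), of U] by (simp add: form_add_right distrib_left)
  with 1 2 U'(2) show False by simp
qed

text \<open>
  The first step is a subrepresentation on the first ray with the largest number of vertices.
  Maximality implies that the quotient has only subrepresentations on later rays. The last hypothesis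
  speaks of arbitrary sets of vertices: in the induction it guarantees that a weight after the rays
  already used is still on a ray of the list.
\<close>

lemma hn_exists:
  assumes "vertex_set V" "sorted_wrt (before s) ds" "set ds \<subseteq> Gplus_nz \<Gamma>"
    and "\<And>W. closed_in A V W \<Longrightarrow> W \<noteq> {} \<Longrightarrow> \<exists>d\<in>set ds. form \<Gamma> d (weight W) = 0"
    and "\<And>W. W \<subseteq> V \<Longrightarrow> W \<noteq> {} \<Longrightarrow>
      (\<exists>d\<in>set ds. form \<Gamma> d (weight W) = 0) \<or> (\<forall>d\<in>set ds. before s (weight W) d)"
  shows "hn_conf s A ds V"
  using assms
proof (induction ds arbitrary: V)
  case Nil
  have "closed_in A V V" by (simp add: closed_in_def)
  with Nil.prems(4) show ?case by auto
next
  case (Cons l ds)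
  note V = Cons.prems(1)
  have l: "l \<in> Gplus_nz \<Gamma>" "\<forall>d\<in>set ds. before s l d" and ds: "sorted_wrt (before s) ds" "set ds \<subseteq> Gplus_nz \<Gamma>"
    using Cons.prems(2,3) by auto
  let ?C = "{U. closed_in A V U \<and> form \<Gamma> l (weight U) = 0}"
  have "?C \<subseteq> Pow V" by (auto simp: closed_in_def)
  then have fin: "finite ?C"
    by (rule finite_subset) (use V in \<open>simp add: vertex_set_def\<close>)
  have "{} \<in> ?C" by (simp add: closed_in_def)
  then have "Max (card ` ?C) \<in> card ` ?C"
    using fin by (intro Max_in) auto
  then obtain U where U: "U \<in> ?C" "card U = Max (card ` ?C)" by auto
  have max: "card W \<le> card U" if "closed_in A V W" "form \<Gamma> l (weight W) = 0" for W
    unfolding U(2) using fin that by (intro Max_ge) auto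
  note U = U(1)[unfolded mem_Collect_eq, THEN conjunct1] U(1)[unfolded mem_Collect_eq, THEN conjunct2]
  have UV: "U \<subseteq> V" using U(1) by (simp add: closed_in_def)
  have finV: "finite V" using V by (simp add: vertex_set_def)
  have nz: "weight W \<in> Gplus_nz \<Gamma>" if "W \<subseteq> V" "W \<noteq> {}" for W
    using weight_nz[OF V that] .
  have after: "before s (weight U) (weight W)"
    if "U \<noteq> {}" "W \<subseteq> V" "W \<noteq> {}" "before s l (weight W)" for W
  proof (rule form_trans_pos[of "weight U" l "weight W"])
    show "s * form \<Gamma> (weight U) l > 0 \<and> s * form \<Gamma> l (weight W) \<ge> 0 \<or>
      s * form \<Gamma> (weight U) l \<ge> 0 \<and> s * form \<Gamma> l (weight W) > 0"
      using U(2) form_skew[of "weight U" l] that by simp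
  qed (use nz that UV l in auto)
  have beyond: "before s l (weight W)"
    if "W \<subseteq> V" "W \<noteq> {}" "d \<in> set ds" "form \<Gamma> d (weight W) = 0" for W d
    using that l ds nz[OF that(1,2)] by (intro form_trans_pos[of l d "weight W"]) auto
  \<comment> \<open>A subrepresentation of \<open>U\<close> is one of \<open>V\<close>, so that its weight is on the ray of \<open>l\<close> or a later one.\<close>
  have "semistable_conf s A U"
    unfolding semistable_conf_def
  proof (intro allI impI)
    fix W assume W: "closed_in A U W"
    show "s * form \<Gamma> (weight W) (weight U) \<le> 0"
    proof (cases "W = {}")
      case False
      have WU: "W \<subseteq> U" using W by (simp add: closed_in_def)
      have "closed_in A V W" using W U(1) by (rule closed_in_trans)
      then obtain d where d: "d \<in> set (l # ds)" "form \<Gamma> d (weight W) = 0"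
        using Cons.prems(4) False by blast
      have "s * form \<Gamma> l (weight W) \<ge> 0"
        using d beyond[of W d] WU UV False by (auto intro: less_imp_le)
      then have "s * form \<Gamma> (weight U) (weight W) \<ge> 0"
        using U(2) form_skew[of "weight U" l] nz[of U] nz[of W] WU UV False l(1)
        by (intro form_trans_nonneg[of "weight U" l "weight W"]) auto
      then show ?thesis using form_skew[of "weight U" "weight W"] by simp
    qed simp
  qed
  moreover have "hn_conf s A ds (V - U)"
  proof (rule Cons.IH)
    show "vertex_set (V - U)" using V by (rule vertex_set_subset) auto
    show "sorted_wrt (before s) ds" "set ds \<subseteq> Gplus_nz \<Gamma>" by fact+
  next
    fix W assume W: "closed_in A (V - U) W" "W \<noteq> {}"
    have WV: "W \<subseteq> V" "W \<inter> U = {}" using W(1) by (auto simp: closed_in_def)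
    \<comment> \<open>By maximality of \<open>U\<close>, the preimage \<open>W \<union> U\<close> of \<open>W\<close> is not on the ray of \<open>l\<close>. As the form of \<open>l\<close> and \<open>U\<close>
      vanishes, \<open>W\<close> is on the same side of that ray as \<open>W \<union> U\<close>.\<close>
    have cl: "closed_in A V (W \<union> U)" using W(1) U(1) by (rule closed_in_Un)
    have "card (W \<union> U) > card U"
      using WV W(2) finV UV by (intro psubset_card_mono) (auto intro: finite_subset)
    with max[OF cl] have "form \<Gamma> l (weight (W \<union> U)) \<noteq> 0" by auto
    moreover have "\<exists>d\<in>set (l # ds). form \<Gamma> d (weight (W \<union> U)) = 0"
      using Cons.prems(4)[OF cl] W(2) by blast
    ultimately have "before s l (weight (W \<union> U))"
      using beyond[of "W \<union> U"] WV(1) UV W(2) by auto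
    moreover have "form \<Gamma> l (weight (W \<union> U)) = form \<Gamma> l (weight W)"
      using weight_Un_disjoint[OF V WV(1) UV WV(2)] U(2) by (simp add: form_add_right)
    ultimately have b: "before s l (weight W)" by simp
    then have "form \<Gamma> l (weight W) \<noteq> 0" "\<not> before s (weight W) l"
      using form_skew[of l "weight W"] by auto
    with Cons.prems(5)[OF WV(1) W(2)] show "\<exists>d\<in>set ds. form \<Gamma> d (weight W) = 0" by auto
  next
    fix W assume W: "W \<subseteq> V - U" "W \<noteq> {}"
    then have WV: "W \<subseteq> V" by auto
    have "\<forall>d\<in>set ds. before s (weight W) d" if "form \<Gamma> l (weight W) = 0"
      using that l ds nz[OF WV W(2)] form_skew[of l "weight W"]
      by (intro ballI form_trans_pos[of "weight W" l]) auto
    with Cons.prems(5)[OF WV W(2)]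
    show "(\<exists>d\<in>set ds. form \<Gamma> d (weight W) = 0) \<or> (\<forall>d\<in>set ds. before s (weight W) d)"
      by auto
  qed
  ultimately show ?case using U by auto
qed

end

section \<open>Sums over sets of arrows\<close>

context positive_lattice
begin

definition arr :: "'g vertex set \<Rightarrow> 'g vertex set \<Rightarrow> 'g arrow set" where
  "arr V W = {(v, w, j). v \<in> V \<and> w \<in> W \<and> j < nat (form \<Gamma> (fst w) (fst v))}"

lemma arrows_eq: "arrows \<Gamma> m = arr (vertices m) (vertices m)"
  by (simp add: arrows_def arr_def)

lemma arr_Sigma: "arr V W = (\<lambda>((v, w), j). (v, w, j)) ` (SIGMA p:V \<times> W. {..<nat (form \<Gamma> (fst (snd p)) (fst (fst p)))})"
  by (force simp: arr_def)

lemma finite_arr: "finite V \<Longrightarrow> finite W \<Longrightarrow> finite (arr V W)"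
  unfolding arr_Sigma by (intro finite_imageI finite_SigmaI) auto

lemma card_arr:
  assumes "finite V" "finite W"
  shows "card (arr V W) = (\<Sum>v\<in>V. \<Sum>w\<in>W. nat (form \<Gamma> (fst w) (fst v)))"
proof -
  have "card (arr V W) = card (SIGMA p:V \<times> W. {..<nat (form \<Gamma> (fst (snd p)) (fst (fst p)))})"
    unfolding arr_Sigma by (intro card_image inj_onI) auto
  also have "\<dots> = (\<Sum>p\<in>V \<times> W. nat (form \<Gamma> (fst (snd p)) (fst (fst p))))"
    using assms by (subst card_SigmaI) auto
  finally show ?thesis by (simp add: sum.cartesian_product case_prod_unfold)
qed

text \<open>
  For \<open>y = q - 1\<close> this is the class of the semistable locus, as a sum over coordinate strata.
\<close>

definition semistable_sum :: "int \<Rightarrow> 'a::comm_semiring_1 \<Rightarrow> 'g vertex set \<Rightarrow> 'a" where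
  "semistable_sum s y V = (\<Sum>A\<in>Pow (arr V V). if semistable_conf s A V then y ^ card A else 0)"

definition hn_sum :: "int \<Rightarrow> 'a::comm_semiring_1 \<Rightarrow> 'g list \<Rightarrow> 'g vertex set \<Rightarrow> 'a" where
  "hn_sum s y ds V = (\<Sum>A\<in>Pow (arr V V). if hn_conf s A ds V then y ^ card A else 0)"

lemma closed_in_cong:
  assumes "\<And>v w j. v \<in> V \<Longrightarrow> w \<in> V \<Longrightarrow> (v, w, j) \<in> A \<longleftrightarrow> (v, w, j) \<in> B"
  shows "closed_in A V U \<longleftrightarrow> closed_in B V U"
proof -
  have "closed_in B V U" if cl: "closed_in A V U" 
    and AB: "\<And>v w j. v \<in> V \<Longrightarrow> w \<in> V \<Longrightarrow> (v, w, j) \<in> A \<longleftrightarrow> (v, w, j) \<in> B" for A B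
  proof (rule closed_inI)
    show "U \<subseteq> V" using cl by (rule closed_in_subset)
    then show "w \<in> U" if "(v, w, j) \<in> B" "v \<in> U" "w \<in> V" for v w j
      using closed_inD[OF cl, of v w j] AB[of v w j] that by (metis subsetD)
  qed
  from this[of A B] this[of B A] assms show ?thesis by auto
qed

lemma semistable_conf_cong:
  assumes "\<And>v w j. v \<in> V \<Longrightarrow> w \<in> V \<Longrightarrow> (v, w, j) \<in> A \<longleftrightarrow> (v, w, j) \<in> B"
  shows "semistable_conf s A V \<longleftrightarrow> semistable_conf s B V"
  unfolding semistable_conf_def using closed_in_cong[of V A B] assms by auto

lemma hn_cong:
  assumes "\<And>v w j. v \<in> V \<Longrightarrow> w \<in> V \<Longrightarrow> (v, w, j) \<in> A \<longleftrightarrow> (v, w, j) \<in> B"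
  shows "hn_conf s A ds V \<longleftrightarrow> hn_conf s B ds V"
  using assms
proof (induction ds arbitrary: V)
  case (Cons d ds)
  have "closed_in A V U \<and> form \<Gamma> d (weight U) = 0 \<and> semistable_conf s A U \<and> hn_conf s A ds (V - U) \<longleftrightarrow>
    closed_in B V U \<and> form \<Gamma> d (weight U) = 0 \<and> semistable_conf s B U \<and> hn_conf s B ds (V - U)" for U
  proof (cases "U \<subseteq> V")
    case True
    then have "semistable_conf s A U \<longleftrightarrow> semistable_conf s B U" "closed_in A V U \<longleftrightarrow> closed_in B V U"
      "hn_conf s A ds (V - U) \<longleftrightarrow> hn_conf s B ds (V - U)"
      using Cons.prems by (intro semistable_conf_cong closed_in_cong Cons.IH; blast)+
    then show ?thesis by simp
  qed (auto simp: closed_in_def)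
  then show ?case by simp
qed simp

lemma hn_sum_Nil: "hn_sum s y [] V = (if V = {} then 1 else 0)"
proof -
  have "arr {} {} = {}" by (simp add: arr_def)
  then show ?thesis by (simp add: hn_sum_def)
qed

text \<open>
  A set of arrows with first step \<open>U\<close> consists of a semistable set of arrows in \<open>U\<close>, a set of
  arrows with a filtration along \<open>ds\<close> in the complement, no arrow from \<open>U\<close> to the complement, and an arbitrary
  set of arrows from the complement to \<open>U\<close>, which accounts for the power of \<open>1 + y\<close>. Since
  \<open>U\<close> is unique, these sets are counted once.
\<close>

lemma hn_sum_Cons:
  assumes V: "vertex_set V" and ds: "sorted_wrt (before s) (l # ds)" "set (l # ds) \<subseteq> Gplus_nz \<Gamma>"
  shows "hn_sum s y (l # ds) V = (\<Sum>U\<in>Pow V. if form \<Gamma> l (weight U) = 0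
    then semistable_sum s y U * (1 + y) ^ card (arr (V - U) U) * hn_sum s y ds (V - U) else 0)"
proof -
  have finV: "finite V" using V by (simp add: vertex_set_def)
  let ?P = "\<lambda>A U. closed_in A V U \<and> form \<Gamma> l (weight U) = 0 \<and> semistable_conf s A U \<and> hn_conf s A ds (V - U)"
  have unique: "U = U'" if "?P A U" "?P A U'" for A U U'
    using hn_first_subset[OF V, of l ds s A U U'] hn_first_subset[OF V, of l ds s A U' U] ds that by auto
  have single: "(if hn_conf s A (l # ds) V then y ^ card A else 0) = (\<Sum>U\<in>Pow V. if ?P A U then y ^ card A else 0)" for A
  proof (cases "\<exists>U. ?P A U")
    case True
    then obtain U where U: "?P A U" by blast
    then have "U \<in> Pow V" by (auto simp: closed_in_def)
    have "(\<Sum>U\<in>Pow V. if ?P A U then y ^ card A else 0) = (\<Sum>U'\<in>Pow V. if U' = U then y ^ card A else 0)"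
      using unique U by (intro sum.cong refl) metis
    also have "\<dots> = y ^ card A" using finV \<open>U \<in> Pow V\<close> by (subst sum.delta) auto
    finally show ?thesis using True by simp
  next
    case False
    then have none: "?P A U \<longleftrightarrow> False" for U by blast
    show ?thesis unfolding hn_conf.simps none by simp
  qed
  have inner: "(\<Sum>A\<in>Pow (arr V V). if ?P A U then y ^ card A else 0) =
    semistable_sum s y U * (1 + y) ^ card (arr (V - U) U) * hn_sum s y ds (V - U)"
    if U: "U \<subseteq> V" "form \<Gamma> l (weight U) = 0" for U
  proof -
    let ?X = "arr U U" and ?Z = "arr (V - U) U" and ?Y = "arr (V - U) (V - U)" and ?N = "arr U (V - U)"
    have fU: "finite U" "finite (V - U)" using U finV finite_subset by auto
    then have fin: "finite ?X" "finite ?Y" "finite ?Z" by (auto intro: finite_arr)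
    have dec: "arr V V = (?X \<union> ?Z \<union> ?Y) \<union> ?N" and "(?X \<union> ?Z \<union> ?Y) \<inter> ?N = {}"
      using U(1) by (auto simp: arr_def)
    have cl: "closed_in A V U \<longleftrightarrow> A \<subseteq> ?X \<union> ?Z \<union> ?Y" if "A \<subseteq> arr V V" for A
    proof
      assume "closed_in A V U"
      then have "A \<inter> ?N = {}" using closed_inD[of A V U] by (auto simp: arr_def)
      then show "A \<subseteq> ?X \<union> ?Z \<union> ?Y" using that dec by blast
    next
      assume "A \<subseteq> ?X \<union> ?Z \<union> ?Y"
      then show "closed_in A V U" using U(1) by (intro closed_inI) (auto simp: arr_def)
    qed
    have "(\<Sum>A\<in>Pow (arr V V). if ?P A U then y ^ card A else 0) =
      (\<Sum>A\<in>Pow (?X \<union> ?Z \<union> ?Y). if semistable_conf s A U \<and> hn_conf s A ds (V - U) then y ^ card A else 0)"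
    proof (rule sum.mono_neutral_cong_right)
      show "finite (Pow (arr V V))" using finV by (simp add: finite_arr)
      show "Pow (?X \<union> ?Z \<union> ?Y) \<subseteq> Pow (arr V V)" using dec by blast
      show "\<forall>A\<in>Pow (arr V V) - Pow (?X \<union> ?Z \<union> ?Y). (if ?P A U then y ^ card A else 0) = 0"
        using cl by auto
      fix A assume "A \<in> Pow (?X \<union> ?Z \<union> ?Y)"
      then have "closed_in A V U" using cl dec by blast
      then show "(if ?P A U then y ^ card A else 0) = (if semistable_conf s A U \<and> hn_conf s A ds (V - U) then y ^ card A else 0)"
        using U(2) by simp
    qed
    also have "\<dots> = (\<Sum>BC\<in>Pow (?X \<union> ?Z). \<Sum>D\<in>Pow ?Y.
        if semistable_conf s (BC \<union> D) U \<and> hn_conf s (BC \<union> D) ds (V - U) then y ^ card (BC \<union> D) else 0)"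
      using fin by (intro sum_Pow_Un_disjoint) (auto simp: arr_def)
    also have "\<dots> = (\<Sum>B\<in>Pow ?X. \<Sum>C\<in>Pow ?Z. \<Sum>D\<in>Pow ?Y.
        if semistable_conf s (B \<union> C \<union> D) U \<and> hn_conf s (B \<union> C \<union> D) ds (V - U) then y ^ card (B \<union> C \<union> D) else 0)"
      using fin by (intro sum_Pow_Un_disjoint) (auto simp: arr_def)
    also have "\<dots> = (\<Sum>B\<in>Pow ?X. \<Sum>C\<in>Pow ?Z. \<Sum>D\<in>Pow ?Y.
        (if semistable_conf s B U then y ^ card B else 0) * y ^ card C * (if hn_conf s D ds (V - U) then y ^ card D else 0))"
    proof (intro sum.cong refl)
      fix B C D assume BCD: "B \<in> Pow ?X" "C \<in> Pow ?Z" "D \<in> Pow ?Y"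
      have "semistable_conf s (B \<union> C \<union> D) U \<longleftrightarrow> semistable_conf s B U"
        using BCD by (intro semistable_conf_cong) (auto simp: arr_def)
      moreover have "hn_conf s (B \<union> C \<union> D) ds (V - U) \<longleftrightarrow> hn_conf s D ds (V - U)"
        using BCD by (intro hn_cong) (auto simp: arr_def)
      moreover have "card (B \<union> C \<union> D) = card B + card C + card D"
      proof -
        have f: "finite B" "finite C" "finite D" using BCD fin finite_subset by auto
        have "B \<inter> C = {}" "(B \<union> C) \<inter> D = {}" using BCD by (auto simp: arr_def)
        then show ?thesis using f by (simp add: card_Un_disjoint)
      qed
      ultimately show "(if semistable_conf s (B \<union> C \<union> D) U \<and> hn_conf s (B \<union> C \<union> D) ds (V - U) then y ^ card (B \<union> C \<union> D) else 0) =
        (if semistable_conf s B U then y ^ card B else 0) * y ^ card C * (if hn_conf s D ds (V - U) then y ^ card D else 0)"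
        by (simp add: power_add)
    qed
    also have "\<dots> = semistable_sum s y U * (\<Sum>C\<in>Pow ?Z. y ^ card C) * hn_sum s y ds (V - U)"
      unfolding semistable_sum_def hn_sum_def by (simp only: sum_distrib_left[symmetric] sum_distrib_right[symmetric])
    also have "(\<Sum>C\<in>Pow ?Z. y ^ card C) = (1 + y) ^ card ?Z"
      using fin by (intro sum_Pow_power_card)
    finally show ?thesis .
  qed
  have "hn_sum s y (l # ds) V = (\<Sum>A\<in>Pow (arr V V). \<Sum>U\<in>Pow V. if ?P A U then y ^ card A else 0)"
    unfolding hn_sum_def single ..
  also have "\<dots> = (\<Sum>U\<in>Pow V. \<Sum>A\<in>Pow (arr V V). if ?P A U then y ^ card A else 0)"
    by (rule sum.swap)
  also have "\<dots> = (\<Sum>U\<in>Pow V. if form \<Gamma> l (weight U) = 0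
    then semistable_sum s y U * (1 + y) ^ card (arr (V - U) U) * hn_sum s y ds (V - U) else 0)"
    using inner by (intro sum.cong refl) auto
  finally show ?thesis .
qed

text \<open>
  If no ray is missing from the list, every set of arrows has a filtration, and the sum runs over all
  of them.
\<close>

lemma hn_sum_complete:
  assumes V: "vertex_set V" and ds: "sorted_wrt (before s) ds" "set ds \<subseteq> Gplus_nz \<Gamma>"
    and all: "\<And>W. W \<subseteq> V \<Longrightarrow> W \<noteq> {} \<Longrightarrow> \<exists>d\<in>set ds. form \<Gamma> d (weight W) = 0"
  shows "hn_sum s y ds V = (1 + y) ^ card (arr V V)"
proof -
  have "hn_conf s A ds V" for A
    by (rule hn_exists[OF V ds]) (use all closed_in_subset in blast)+
  then have "hn_sum s y ds V = (\<Sum>A\<in>Pow (arr V V). y ^ card A)" by (simp add: hn_sum_def)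
  also have "\<dots> = (1 + y) ^ card (arr V V)"
    using V by (intro sum_Pow_power_card finite_arr) (auto simp: vertex_set_def)
  finally show ?thesis .
qed

lemma semistable_sum_image:
  assumes inj: "inj_on \<phi> V" and fst: "\<And>v. v \<in> V \<Longrightarrow> fst (\<phi> v) = fst v"
  shows "semistable_sum s y (\<phi> ` V) = semistable_sum s y V"
proof -
  define \<Phi> :: "'g arrow \<Rightarrow> 'g arrow" where "\<Phi> = (\<lambda>(v, w, j). (\<phi> v, \<phi> w, j))"
  have arr: "arr (\<phi> ` V) (\<phi> ` V) = \<Phi> ` arr V V"
    unfolding arr_def \<Phi>_def using fst by (force simp: image_iff)
  have inj\<Phi>: "inj_on \<Phi> (arr V V)"
    using inj by (auto simp: inj_on_def arr_def \<Phi>_def)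
  have wt: "weight (\<phi> ` U) = weight U" if "U \<subseteq> V" for U
  proof -
    have "weight (\<phi> ` U) = (\<Sum>v\<in>U. fst (\<phi> v))"
      unfolding weight_def by (subst sum.reindex[OF inj_on_subset[OF inj that]]) simp
    also have "\<dots> = weight U"
      unfolding weight_def by (intro sum.cong refl fst) (use that in blast)
    finally show ?thesis .
  qed
  have cl: "closed_in (\<Phi> ` A) (\<phi> ` V) (\<phi> ` U) \<longleftrightarrow> closed_in A V U" if "A \<subseteq> arr V V" "U \<subseteq> V" for A U
  proof -
    have im: "\<phi> v \<in> \<phi> ` U \<longleftrightarrow> v \<in> U" if "v \<in> V" for v
      using inj that \<open>U \<subseteq> V\<close> by (auto simp: inj_on_def)
    have AV: "v \<in> V \<and> w \<in> V" if "(v, w, j) \<in> A" for v w j using that \<open>A \<subseteq> arr V V\<close> by (auto simp: arr_def)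
    have "(\<forall>(v, w, j)\<in>\<Phi> ` A. v \<in> \<phi> ` U \<longrightarrow> w \<in> \<phi> ` V \<longrightarrow> w \<in> \<phi> ` U) \<longleftrightarrow>
      (\<forall>(v, w, j)\<in>A. \<phi> v \<in> \<phi> ` U \<longrightarrow> \<phi> w \<in> \<phi> ` V \<longrightarrow> \<phi> w \<in> \<phi> ` U)"
      by (simp add: \<Phi>_def case_prod_unfold)
    also have "\<dots> \<longleftrightarrow> (\<forall>(v, w, j)\<in>A. v \<in> U \<longrightarrow> w \<in> V \<longrightarrow> w \<in> U)"
    proof (rule ball_cong[OF refl])
      fix e assume "e \<in> A"
      then show "(case e of (v, w, j) \<Rightarrow> \<phi> v \<in> \<phi> ` U \<longrightarrow> \<phi> w \<in> \<phi> ` V \<longrightarrow> \<phi> w \<in> \<phi> ` U) =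
        (case e of (v, w, j) \<Rightarrow> v \<in> U \<longrightarrow> w \<in> V \<longrightarrow> w \<in> U)"
        using AV im by (cases e) auto
    qed
    finally show ?thesis using that(2) unfolding closed_in_def by (simp add: image_mono)
  qed
  have semistable_conf: "semistable_conf s (\<Phi> ` A) (\<phi> ` V) \<longleftrightarrow> semistable_conf s A V" if A: "A \<subseteq> arr V V" for A
  proof -
    let ?Q = "\<lambda>U. s * form \<Gamma> (weight U) (weight (\<phi> ` V)) \<le> 0"
    have "(\<forall>U. closed_in (\<Phi> ` A) (\<phi> ` V) U \<longrightarrow> ?Q U) \<longleftrightarrow>
      (\<forall>U\<subseteq>V. closed_in (\<Phi> ` A) (\<phi> ` V) (\<phi> ` U) \<longrightarrow> ?Q (\<phi> ` U))" (is "?L \<longleftrightarrow> ?R")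
    proof
      assume R: ?R
      show ?L
      proof (intro allI impI)
        fix U assume U: "closed_in (\<Phi> ` A) (\<phi> ` V) U"
        from closed_in_subset[OF U] obtain U0 where "U0 \<subseteq> V" "U = \<phi> ` U0" by (rule subset_imageE)
        with R U show "?Q U" by simp
      qed
    qed simp
    also have "\<dots> \<longleftrightarrow> (\<forall>U\<subseteq>V. closed_in A V U \<longrightarrow> s * form \<Gamma> (weight U) (weight V) \<le> 0)"
      using cl[OF A] wt by simp
    also have "\<dots> \<longleftrightarrow> (\<forall>U. closed_in A V U \<longrightarrow> s * form \<Gamma> (weight U) (weight V) \<le> 0)"
      by (meson closed_in_subset)
    finally show ?thesis unfolding semistable_conf_def .
  qed
  have "semistable_sum s y (\<phi> ` V) = (\<Sum>A\<in>(`) \<Phi> ` Pow (arr V V). if semistable_conf s A (\<phi> ` V) then y ^ card A else 0)"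
    unfolding semistable_sum_def arr image_Pow_surj[OF refl] ..
  also have "\<dots> = (\<Sum>A\<in>Pow (arr V V). if semistable_conf s (\<Phi> ` A) (\<phi> ` V) then y ^ card (\<Phi> ` A) else 0)"
    using inj_on_image_Pow[OF inj\<Phi>] by (subst sum.reindex) auto
  also have "\<dots> = semistable_sum s y V"
    unfolding semistable_sum_def
  proof (rule sum.cong[OF refl])
    fix A assume "A \<in> Pow (arr V V)"
    then have A: "A \<subseteq> arr V V" by simp
    show "(if semistable_conf s (\<Phi> ` A) (\<phi> ` V) then y ^ card (\<Phi> ` A) else 0) = (if semistable_conf s A V then y ^ card A else 0)"
      unfolding semistable_conf[OF A] using card_image[OF inj_on_subset[OF inj\<Phi> A]] by simp
  qed
  finally show ?thesis .
qed

end

section \<open>Sets of vertices grouped by multiplicity\<close>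

text \<open>
  The multiplicity of a single class is \<open>Poly_Mapping.single \<alpha> 1\<close>; unfolding \<open>1\<close> would hide it from the lemmas below.
\<close>

declare One_nat_def [simp del]

abbreviation unit :: "'g \<Rightarrow> 'g \<Rightarrow>\<^sub>0 nat" where
  "unit \<alpha> \<equiv> Poly_Mapping.single \<alpha> 1"

lemma split_unit:
  assumes "\<alpha> \<in> Poly_Mapping.keys m" shows "m = (m - unit \<alpha>) + unit \<alpha>"
  using assms by (intro poly_mapping_eqI) (auto simp: lookup_add lookup_minus lookup_single when_def in_keys_iff)

lemma sum_keys_superset:
  fixes h :: "'g \<Rightarrow> nat \<Rightarrow> 'b::comm_monoid_add"
  assumes "\<And>\<alpha>. h \<alpha> 0 = 0" "finite S" "Poly_Mapping.keys m \<subseteq> S"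
  shows "(\<Sum>\<alpha>\<in>Poly_Mapping.keys m. h \<alpha> (Poly_Mapping.lookup m \<alpha>)) = (\<Sum>\<alpha>\<in>S. h \<alpha> (Poly_Mapping.lookup m \<alpha>))"
  by (rule sum.mono_neutral_left) (use assms in \<open>auto simp: in_keys_iff\<close>)

lemma prod_keys_superset:
  fixes h :: "'g \<Rightarrow> nat \<Rightarrow> 'b::comm_monoid_mult"
  assumes "\<And>\<alpha>. h \<alpha> 0 = 1" "finite S" "Poly_Mapping.keys m \<subseteq> S"
  shows "(\<Prod>\<alpha>\<in>Poly_Mapping.keys m. h \<alpha> (Poly_Mapping.lookup m \<alpha>)) = (\<Prod>\<alpha>\<in>S. h \<alpha> (Poly_Mapping.lookup m \<alpha>))"
  by (rule prod.mono_neutral_left) (use assms in \<open>auto simp: in_keys_iff\<close>)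

lemma keys_add_nat: "Poly_Mapping.keys (m + n :: 'g \<Rightarrow>\<^sub>0 nat) = Poly_Mapping.keys m \<union> Poly_Mapping.keys n"
  by (auto simp: in_keys_iff lookup_add)

lemma mnorm_add: "mnorm (m + n) = mnorm m + mnorm n"
proof -
  let ?S = "Poly_Mapping.keys m \<union> Poly_Mapping.keys n"
  have "mnorm k = (\<Sum>\<alpha>\<in>?S. zmult (int (Poly_Mapping.lookup k \<alpha>)) \<alpha>)" if "Poly_Mapping.keys k \<subseteq> ?S" for k
    unfolding mnorm_def using that sum_keys_superset[of "\<lambda>\<alpha> k. zmult (int k) \<alpha>" ?S k] by simp
  then show ?thesis by (simp add: keys_add_nat lookup_add zmult_add sum.distrib)
qed

lemma mcard_add: "mcard (m + n) = mcard m + mcard n"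
proof -
  let ?S = "Poly_Mapping.keys m \<union> Poly_Mapping.keys n"
  have "mcard k = (\<Sum>\<alpha>\<in>?S. Poly_Mapping.lookup k \<alpha>)" if "Poly_Mapping.keys k \<subseteq> ?S" for k
    unfolding mcard_def using that sum_keys_superset[of "\<lambda>\<alpha> k. k" ?S k] by simp
  then show ?thesis by (simp add: keys_add_nat lookup_add sum.distrib)
qed

lemma mnorm_0 [simp]: "mnorm 0 = 0" and mcard_0 [simp]: "mcard 0 = 0" and mfact_0 [simp]: "mfact 0 = 1"
  by (simp_all add: mnorm_def mcard_def mfact_def)

lemma mnorm_unit [simp]: "mnorm (unit \<alpha>) = \<alpha>"
  by (simp add: mnorm_def)

lemma mcard_unit [simp]: "mcard (unit \<alpha>) = 1"
  by (simp add: mcard_def)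

lemma mfact_add_unit: "mfact (m + unit \<alpha>) = Suc (Poly_Mapping.lookup m \<alpha>) * mfact m"
proof -
  let ?S = "insert \<alpha> (Poly_Mapping.keys m)"
  have sup: "mfact k = (\<Prod>\<beta>\<in>?S. fact (Poly_Mapping.lookup k \<beta>))" if "Poly_Mapping.keys k \<subseteq> ?S" for k
    unfolding mfact_def using that prod_keys_superset[of "\<lambda>\<alpha> k. fact k" ?S k] by simp
  have "mfact (m + unit \<alpha>) = (\<Prod>\<beta>\<in>?S. fact (Poly_Mapping.lookup (m + unit \<alpha>) \<beta>))"
    by (rule sup) (auto simp: keys_add_nat)
  also have "\<dots> = fact (Poly_Mapping.lookup (m + unit \<alpha>) \<alpha>) *
      (\<Prod>\<beta>\<in>Poly_Mapping.keys m - {\<alpha>}. fact (Poly_Mapping.lookup (m + unit \<alpha>) \<beta>))"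
    by (simp add: prod.insert_remove)
  also have "(\<Prod>\<beta>\<in>Poly_Mapping.keys m - {\<alpha>}. fact (Poly_Mapping.lookup (m + unit \<alpha>) \<beta>)) =
      (\<Prod>\<beta>\<in>Poly_Mapping.keys m - {\<alpha>}. fact (Poly_Mapping.lookup m \<beta>) :: nat)"
    by (intro prod.cong refl) (auto simp: lookup_add lookup_single when_def)
  also have "Poly_Mapping.lookup (m + unit \<alpha>) \<alpha> = Suc (Poly_Mapping.lookup m \<alpha>)"
    by (simp add: lookup_add)
  also have "fact (Suc (Poly_Mapping.lookup m \<alpha>)) *
      (\<Prod>\<beta>\<in>Poly_Mapping.keys m - {\<alpha>}. fact (Poly_Mapping.lookup m \<beta>)) =
     Suc (Poly_Mapping.lookup m \<alpha>) * (\<Prod>\<beta>\<in>?S. fact (Poly_Mapping.lookup m \<beta>))"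
    by (simp add: prod.insert_remove mult.assoc del: mult_Suc)
  also have "(\<Prod>\<beta>\<in>?S. fact (Poly_Mapping.lookup m \<beta>)) = mfact m"
    by (rule sup[symmetric]) auto
  finally show ?thesis .
qed

lemma mfact_pos: "mfact m > 0"
  unfolding mfact_def by (intro prod_pos) auto

lemma mult_induct [case_names zero add]:
  assumes "P 0" "\<And>m \<alpha>. P m \<Longrightarrow> P (m + unit \<alpha>)" shows "P (m :: 'g \<Rightarrow>\<^sub>0 nat)"
proof (induction "mcard m" arbitrary: m)
  case 0
  then have "m = 0" by (auto simp: mcard_def in_keys_iff intro!: poly_mapping_eqI)
  then show ?case using assms(1) by simp
next
  case (Suc k)
  then have "Poly_Mapping.keys m \<noteq> {}" by (auto simp: mcard_def)
  then obtain \<alpha> where "\<alpha> \<in> Poly_Mapping.keys m" by blast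
  then have m: "m = (m - unit \<alpha>) + unit \<alpha>" by (rule split_unit)
  then have "mcard m = mcard (m - unit \<alpha>) + mcard (unit \<alpha>)" by (metis mcard_add)
  then have "P (m - unit \<alpha>)" using Suc by (intro Suc.hyps(1)) simp
  then show ?case using assms(2)[of "m - unit \<alpha>" \<alpha>] m by simp
qed

abbreviation decomp :: "('g \<Rightarrow>\<^sub>0 nat) \<Rightarrow> (('g \<Rightarrow>\<^sub>0 nat) \<times> ('g \<Rightarrow>\<^sub>0 nat)) set" where
  "decomp m \<equiv> {(m1, m2). m1 + m2 = m}"

lemma decomp_add_unit:
  "decomp (m + unit \<alpha>) = (\<lambda>(a, b). (a + unit \<alpha>, b)) ` decomp m \<union> (\<lambda>(a, b). (a, b + unit \<alpha>)) ` decomp m"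
proof (intro equalityI subsetI)
  fix p assume "p \<in> decomp (m + unit \<alpha>)"
  then obtain a b where p: "p = (a, b)" "a + b = m + unit \<alpha>" by auto
  then have "\<alpha> \<in> Poly_Mapping.keys (a + b)" by (simp add: keys_add_nat)
  then consider "\<alpha> \<in> Poly_Mapping.keys a" | "\<alpha> \<in> Poly_Mapping.keys b" by (auto simp: keys_add_nat)
  then show "p \<in> (\<lambda>(a, b). (a + unit \<alpha>, b)) ` decomp m \<union> (\<lambda>(a, b). (a, b + unit \<alpha>)) ` decomp m"
  proof cases
    case 1
    then have a: "a = (a - unit \<alpha>) + unit \<alpha>" by (rule split_unit)
    then have "((a - unit \<alpha>) + b) + unit \<alpha> = m + unit \<alpha>" using p(2) by (metis add.assoc add.commute)
    then have "(a - unit \<alpha>, b) \<in> decomp m" by simp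
    then show ?thesis using a p(1) by (metis (no_types, lifting) UnI1 case_prod_conv image_eqI)
  next
    case 2
    then have b: "b = (b - unit \<alpha>) + unit \<alpha>" by (rule split_unit)
    then have "(a + (b - unit \<alpha>)) + unit \<alpha> = m + unit \<alpha>" using p(2) by (metis add.assoc)
    then have "(a, b - unit \<alpha>) \<in> decomp m" by simp
    then show ?thesis using b p(1) by (metis (no_types, lifting) UnI2 case_prod_conv image_eqI)
  qed
qed (auto simp: add_ac)

lemma decomp_0: "decomp 0 = {(0 :: 'g \<Rightarrow>\<^sub>0 nat, 0)}"
  by (auto simp: poly_mapping_eq_iff fun_eq_iff lookup_add)

lemma finite_decomp: "finite (decomp (m :: 'g \<Rightarrow>\<^sub>0 nat))"
  by (induction m rule: mult_induct) (simp_all add: decomp_0 decomp_add_unit )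

definition mtype :: "'g vertex set \<Rightarrow> 'g \<Rightarrow>\<^sub>0 nat" where
  "mtype V = (\<Sum>v\<in>V. unit (fst v))"

lemma mtype_insert: "finite V \<Longrightarrow> v \<notin> V \<Longrightarrow> mtype (insert v V) = mtype V + unit (fst v)"
  by (simp add: mtype_def add.commute)

lemma mtype_empty [simp]: "mtype {} = 0" by (simp add: mtype_def)

lemma lookup_mtype: "finite V \<Longrightarrow> Poly_Mapping.lookup (mtype V) \<alpha> = card {v \<in> V. fst v = \<alpha>}"
  by (simp add: mtype_def lookup_sum lookup_single when_def sum.If_cases Int_def)

lemma keys_mtype: "finite V \<Longrightarrow> Poly_Mapping.keys (mtype V) = fst ` V"
  by (force simp: in_keys_iff lookup_mtype)

lemma mcard_mtype: "finite V \<Longrightarrow> mcard (mtype V) = card V"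
  by (induction V rule: finite_induct) (simp_all add: mtype_insert mcard_add mcard_unit)

lemma finite_vertices: "finite (vertices m)"
proof -
  have "vertices m \<subseteq> Sigma (Poly_Mapping.keys m) (\<lambda>\<alpha>. {..Poly_Mapping.lookup m \<alpha>})"
    by (auto simp: vertices_def)
  then show ?thesis by (rule finite_subset) auto
qed

lemma mtype_vertices: "mtype (vertices m) = m"
proof (rule poly_mapping_eqI)
  fix \<alpha>
  have "{v \<in> vertices m. fst v = \<alpha>} = Pair \<alpha> ` {1..Poly_Mapping.lookup m \<alpha>}"
    by (auto simp: vertices_def in_keys_iff)
  then show "Poly_Mapping.lookup (mtype (vertices m)) \<alpha> = Poly_Mapping.lookup m \<alpha>"
    by (simp add: lookup_mtype finite_vertices card_image inj_on_def)
qed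

text \<open>
  Raising \<open>a(\<alpha>)\<close> by one multiplies \<open>a!\<close> by the new value; decompositions with
  \<open>a(\<alpha>) = 0\<close>, which are not of this form, have weight zero on the right.
\<close>

lemma sum_decomp_add_unit:
  fixes G :: "('g \<Rightarrow>\<^sub>0 nat) \<Rightarrow> ('g \<Rightarrow>\<^sub>0 nat) \<Rightarrow> 'a::field_char_0"
  shows "(\<Sum>(a, b)\<in>decomp t. x / (of_nat (mfact a) * of_nat (mfact b)) * G (a + unit \<alpha>) b) =
    (\<Sum>(a, b)\<in>decomp (t + unit \<alpha>).
      of_nat (Poly_Mapping.lookup a \<alpha>) * (x / (of_nat (mfact a) * of_nat (mfact b))) * G a b)"
proof -
  let ?u = "unit \<alpha>" and ?k = "\<lambda>a. of_nat (Poly_Mapping.lookup a \<alpha>) :: 'a"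
  let ?w = "\<lambda>a b. x / (of_nat (mfact a) * of_nat (mfact b))"
  have cancel: "?w a b * z = ?k (a + ?u) * ?w (a + ?u) b * z" for z a b
  proof -
    have l: "Poly_Mapping.lookup (a + ?u) \<alpha> = Suc (Poly_Mapping.lookup a \<alpha>)" by (simp add: lookup_add)
    have "of_nat (Suc k) \<noteq> (0 :: 'a)" for k by (simp del: of_nat_Suc)
    then show ?thesis
      unfolding l mfact_add_unit of_nat_mult using mfact_pos by (simp add: divide_simps del: of_nat_Suc)
  qed
  have "(\<Sum>(a, b)\<in>decomp t. ?w a b * G (a + ?u) b) =
      (\<Sum>(a, b)\<in>(\<lambda>(a, b). (a + ?u, b)) ` decomp t. ?k a * ?w a b * G a b)"
  proof (subst sum.reindex)
    show "inj_on (\<lambda>(a, b). (a + ?u, b)) (decomp t)" by (auto simp: inj_on_def)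
    show "(\<Sum>(a, b)\<in>decomp t. ?w a b * G (a + ?u) b) =
      sum ((\<lambda>(a, b). ?k a * ?w a b * G a b) \<circ> (\<lambda>(a, b). (a + ?u, b))) (decomp t)"
      by (intro sum.cong refl) (clarify, simp only: o_apply case_prod_conv, rule cancel)
  qed
  also have "\<dots> = (\<Sum>(a, b)\<in>decomp (t + ?u). ?k a * ?w a b * G a b)"
  proof (rule sum.mono_neutral_left)
    show "\<forall>p\<in>decomp (t + ?u) - (\<lambda>(a, b). (a + ?u, b)) ` decomp t. (case p of (a, b) \<Rightarrow> ?k a * ?w a b * G a b) = 0"
    proof
      fix p assume p: "p \<in> decomp (t + ?u) - (\<lambda>(a, b). (a + ?u, b)) ` decomp t"
      obtain a b where ab: "p = (a, b)" "a + b = t + ?u" using p by auto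
      have "Poly_Mapping.lookup a \<alpha> = 0"
      proof (rule ccontr)
        assume "Poly_Mapping.lookup a \<alpha> \<noteq> 0"
        then have a: "a = (a - ?u) + ?u" by (intro split_unit) (simp add: in_keys_iff)
        then have "((a - ?u) + b) + ?u = t + ?u" using ab(2) by (metis add.assoc add.commute)
        then have "(a - ?u, b) \<in> decomp t" by simp
        then have "p \<in> (\<lambda>(a, b). (a + ?u, b)) ` decomp t"
          using a ab(1) by (metis (no_types, lifting) case_prod_conv image_eqI)
        with p show False by blast
      qed
      then show "(case p of (a, b) \<Rightarrow> ?k a * ?w a b * G a b) = 0" by (simp add: ab)
    qed
  qed (simp_all add: finite_decomp decomp_add_unit)
  finally show ?thesis .
qed

lemma sum_decomp_swap: "(\<Sum>(a, b)\<in>decomp t. h a b) = (\<Sum>(a, b)\<in>decomp t. h b a)"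
  by (rule sum.reindex_bij_witness[of _ prod.swap prod.swap]) (auto simp: add.commute)

text \<open>
  There are \<open>t! / (a! b!)\<close> subsets of multiplicity \<open>a\<close> in a set of multiplicity \<open>t = a + b\<close>. The
  induction adds a vertex to either part and uses Pascal's rule \<open>t(\<alpha>) = a(\<alpha>) + b(\<alpha>)\<close> for these
  multinomial coefficients.
\<close>

lemma sum_Pow_mtype:
  fixes G :: "('g \<Rightarrow>\<^sub>0 nat) \<Rightarrow> ('g \<Rightarrow>\<^sub>0 nat) \<Rightarrow> 'a::field_char_0"
  assumes "finite V"
  shows "(\<Sum>U\<in>Pow V. G (mtype U) (mtype (V - U))) =
    (\<Sum>(a, b)\<in>decomp (mtype V). of_nat (mfact (mtype V)) / (of_nat (mfact a) * of_nat (mfact b)) * G a b)"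
  using assms
proof (induction V arbitrary: G rule: finite_induct)
  case empty
  then show ?case by (simp add: decomp_0)
next
  case (insert v V)
  let ?\<alpha> = "fst v" and ?t = "mtype V"
  let ?u = "unit ?\<alpha>"
  let ?k = "\<lambda>a. of_nat (Poly_Mapping.lookup a ?\<alpha>) :: 'a"
  let ?w = "\<lambda>a b. of_nat (mfact ?t) / (of_nat (mfact a) * of_nat (mfact b)) :: 'a"
  have "(\<Sum>U\<in>Pow (insert v V). G (mtype U) (mtype (insert v V - U))) =
      (\<Sum>U\<in>Pow V. G (mtype U) (mtype (insert v V - U))) +
      (\<Sum>U\<in>insert v ` Pow V. G (mtype U) (mtype (insert v V - U)))"
    unfolding Pow_insert using insert by (intro sum.union_disjoint) auto
  also have "(\<Sum>U\<in>insert v ` Pow V. G (mtype U) (mtype (insert v V - U))) =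
      (\<Sum>U\<in>Pow V. G (mtype (insert v U)) (mtype (insert v V - insert v U)))"
    using insert(2) by (subst sum.reindex) (auto simp: inj_on_def)
  also have "\<dots> = (\<Sum>U\<in>Pow V. G (mtype U + ?u) (mtype (V - U)))"
  proof (intro sum.cong refl)
    fix U assume "U \<in> Pow V"
    then have "finite U" "v \<notin> U" "insert v V - insert v U = V - U"
      using insert finite_subset by auto
    then show "G (mtype (insert v U)) (mtype (insert v V - insert v U)) = G (mtype U + ?u) (mtype (V - U))"
      by (simp add: mtype_insert)
  qed
  also have "\<dots> = (\<Sum>(a, b)\<in>decomp (?t + ?u). ?k a * ?w a b * G a b)"
    using insert.IH[of "\<lambda>a b. G (a + ?u) b"] sum_decomp_add_unit[of _ G ?\<alpha>] by simp
  also have "(\<Sum>U\<in>Pow V. G (mtype U) (mtype (insert v V - U))) = (\<Sum>U\<in>Pow V. G (mtype U) (mtype (V - U) + ?u))"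
  proof (intro sum.cong refl)
    fix U assume "U \<in> Pow V"
    then have "finite (V - U)" "v \<notin> V - U" "insert v V - U = insert v (V - U)"
      using insert by auto
    then show "G (mtype U) (mtype (insert v V - U)) = G (mtype U) (mtype (V - U) + ?u)"
      by (simp add: mtype_insert)
  qed
  also have "\<dots> = (\<Sum>(a, b)\<in>decomp ?t. ?w a b * G b (a + ?u))"
    using insert.IH[of "\<lambda>a b. G a (b + ?u)"] sum_decomp_swap[of "\<lambda>a b. ?w a b * G a (b + ?u)"]
    by (simp add: mult.commute)
  also have "\<dots> = (\<Sum>(a, b)\<in>decomp (?t + ?u). ?k b * ?w a b * G a b)"
    using sum_decomp_add_unit[of _ "\<lambda>a b. G b a" ?\<alpha>] sum_decomp_swap[of "\<lambda>a b. ?k b * ?w a b * G a b"]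
    by (simp add: mult.commute)
  also have "(\<Sum>(a, b)\<in>decomp (?t + ?u). ?k b * ?w a b * G a b) + (\<Sum>(a, b)\<in>decomp (?t + ?u). ?k a * ?w a b * G a b) =
     (\<Sum>(a, b)\<in>decomp (?t + ?u). (?k a + ?k b) * ?w a b * G a b)"
    unfolding sum.distrib[symmetric]
    by (intro sum.cong refl) (clarify, simp only: case_prod_conv distrib_right add.commute)
  also have "\<dots> = (\<Sum>(a, b)\<in>decomp (?t + ?u). of_nat (mfact (?t + ?u)) / (of_nat (mfact a) * of_nat (mfact b)) * G a b)"
  proof (intro sum.cong refl, clarify)
    fix a b assume ab: "a + b = ?t + ?u"
    have "Poly_Mapping.lookup a ?\<alpha> + Poly_Mapping.lookup b ?\<alpha> = Suc (Poly_Mapping.lookup ?t ?\<alpha>)"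
      using arg_cong[OF ab, of "\<lambda>m. Poly_Mapping.lookup m ?\<alpha>"] by (simp add: lookup_add)
    then have "?k a + ?k b = of_nat (Suc (Poly_Mapping.lookup ?t ?\<alpha>))"
      by (metis of_nat_add)
    then show "(?k a + ?k b) * ?w a b * G a b = of_nat (mfact (?t + ?u)) / (of_nat (mfact a) * of_nat (mfact b)) * G a b"
      by (simp only: mfact_add_unit of_nat_mult times_divide_eq_right)
  qed
  finally show ?case using insert by (simp add: mtype_insert)
qed

context positive_lattice
begin

lemma vertex_set_vertices: "m \<in> mults \<Gamma> \<Longrightarrow> vertex_set (vertices m)"
  unfolding vertex_set_def mults_def using finite_vertices[of m] by (auto simp: vertices_def)

lemma mnorm_mtype: "finite V \<Longrightarrow> mnorm (mtype V) = weight V"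
  unfolding weight_def by (induction V rule: finite_induct) (simp_all add: mtype_insert mnorm_add add.commute )

lemma same_mtype_bij:
  assumes "finite V" "finite W" "mtype V = mtype W"
  obtains \<phi> where "inj_on \<phi> V" "\<phi> ` V = W" "\<And>v. v \<in> V \<Longrightarrow> fst (\<phi> v) = fst v"
proof -
  have "\<exists>f. bij_betw f {v \<in> V. fst v = \<alpha>} {v \<in> W. fst v = \<alpha>}" for \<alpha>
    using assms lookup_mtype[OF assms(1), of \<alpha>] lookup_mtype[OF assms(2), of \<alpha>]
    by (intro finite_same_card_bij) auto
  then have "\<exists>f. \<forall>\<alpha>. bij_betw (f \<alpha>) {v \<in> V. fst v = \<alpha>} {v \<in> W. fst v = \<alpha>}"
    by (intro choice allI)
  then obtain f where f: "\<And>\<alpha>. bij_betw (f \<alpha>) {v \<in> V. fst v = \<alpha>} {v \<in> W. fst v = \<alpha>}" by auto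
  define \<phi> where "\<phi> = (\<lambda>v. f (fst v) v)"
  have im: "\<phi> v \<in> W \<and> fst (\<phi> v) = fst v" if "v \<in> V" for v
    using bij_betwE[OF f[of "fst v"]] that unfolding \<phi>_def by blast
  show thesis
  proof (rule that)
    show "inj_on \<phi> V"
    proof (rule inj_onI)
      fix v w assume vw: "v \<in> V" "w \<in> V" "\<phi> v = \<phi> w"
      then have "fst v = fst w" using im by metis
      then show "v = w" using vw inj_onD[OF bij_betw_imp_inj_on[OF f[of "fst v"]], of v w] unfolding \<phi>_def by auto
    qed
    show "\<phi> ` V = W"
    proof (intro equalityI subsetI)
      fix w assume "w \<in> W"
      then have "w \<in> f (fst w) ` {v \<in> V. fst v = fst w}" using f[of "fst w"] unfolding bij_betw_def by blast
      then obtain v where "v \<in> V" "fst v = fst w" "w = f (fst w) v" by blast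
      then have "v \<in> V" "w = \<phi> v" unfolding \<phi>_def by simp_all
      then show "w \<in> \<phi> ` V" by blast
    qed (use im in auto)
    show "fst (\<phi> v) = fst v" if "v \<in> V" for v using im[OF that] by blast
  qed
qed

lemma semistable_sum_mtype:
  assumes "finite V" shows "semistable_sum s y V = semistable_sum s y (vertices (mtype V))"
proof -
  obtain \<phi> where "inj_on \<phi> V" "\<phi> ` V = vertices (mtype V)" "\<And>v. v \<in> V \<Longrightarrow> fst (\<phi> v) = fst v"
    using same_mtype_bij[OF assms finite_vertices] mtype_vertices by metis
  then show ?thesis using semistable_sum_image[of \<phi> V s y] by simp
qed

lemma card_arr_mtype:
  assumes "finite V" shows "card (arr V V) = card (arrows \<Gamma> (mtype V))"
proof -
  obtain \<phi> where \<phi>: "inj_on \<phi> V" "\<phi> ` V = vertices (mtype V)" "\<And>v. v \<in> V \<Longrightarrow> fst (\<phi> v) = fst v"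
    using same_mtype_bij[OF assms finite_vertices] mtype_vertices by metis
  have "card (arrows \<Gamma> (mtype V)) = (\<Sum>v\<in>\<phi> ` V. \<Sum>w\<in>\<phi> ` V. nat (form \<Gamma> (fst w) (fst v)))"
    unfolding arrows_eq \<phi>(2) by (intro card_arr finite_vertices)
  also have "\<dots> = (\<Sum>v\<in>V. \<Sum>w\<in>V. nat (form \<Gamma> (fst w) (fst v)))"
    using \<phi>(1,3) by (simp add: sum.reindex)
  finally show ?thesis using card_arr[OF assms assms] by simp
qed

text \<open>
  Between two vertices all arrows go in the same direction, and their number is the absolute value of
  the form.
\<close>

lemma card_arr_diff:
  assumes "finite V" "finite W"
  shows "int (card (arr W V)) - int (card (arr V W)) = form \<Gamma> (weight V) (weight W)"
proof -
  have e: "int (nat (form \<Gamma> x y)) = form \<Gamma> x y + int (nat (form \<Gamma> y x))" for x y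
    using form_skew[of x y] by linarith
  have "int (card (arr W V)) = (\<Sum>v\<in>V. \<Sum>w\<in>W. int (nat (form \<Gamma> (fst v) (fst w))))"
    unfolding card_arr[OF assms(2,1)] of_nat_sum by (rule sum.swap)
  moreover have "int (card (arr V W)) = (\<Sum>v\<in>V. \<Sum>w\<in>W. int (nat (form \<Gamma> (fst w) (fst v))))"
    unfolding card_arr[OF assms] of_nat_sum ..
  moreover have "(\<Sum>v\<in>V. \<Sum>w\<in>W. int (nat (form \<Gamma> (fst v) (fst w)))) =
      (\<Sum>v\<in>V. \<Sum>w\<in>W. form \<Gamma> (fst v) (fst w)) + (\<Sum>v\<in>V. \<Sum>w\<in>W. int (nat (form \<Gamma> (fst w) (fst v))))"
    unfolding sum.distrib[symmetric] by (intro sum.cong refl e)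
  moreover have "(\<Sum>v\<in>V. \<Sum>w\<in>W. form \<Gamma> (fst v) (fst w)) = (\<Sum>w\<in>W. \<Sum>v\<in>V. form \<Gamma> (fst v) (fst w))"
    by (rule sum.swap)
  ultimately show ?thesis
    unfolding weight_def form_sum_left form_sum_right by simp
qed

lemma card_arr_split:
  assumes "finite V" "U \<subseteq> V"
  shows "card (arr V V) = card (arr U U) + card (arr (V - U) (V - U)) + card (arr U (V - U)) + card (arr (V - U) U)"
proof -
  have f: "finite U" "finite (V - U)" using assms finite_subset by auto
  have s: "(\<Sum>v\<in>V. h v) = (\<Sum>v\<in>U. h v) + (\<Sum>v\<in>V - U. h v)" for h :: "'g vertex \<Rightarrow> nat"
    using sum.subset_diff[OF assms(2,1)] by (simp add: add.commute)
  show ?thesis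
    using f assms(1) by (simp add: card_arr s sum.distrib)
qed

end

section \<open>The Harder-Narasimhan recursion for the coefficients\<close>

abbreviation qm1 :: ratfun where "qm1 \<equiv> qhalf ^ 2 - 1"

lemma qhalf_nz: "qhalf \<noteq> 0" "qm1 \<noteq> 0" "qhalf - 1 / qhalf \<noteq> 0"
proof -
  show nz: "qhalf \<noteq> 0" by (simp add: qhalf_def)
  have "qm1 = to_fract ([:0, 1:] * [:0, 1:] - 1)"
    by (simp only: qhalf_def to_fract_diff to_fract_mult to_fract_1 power2_eq_square)
  moreover have "coeff ([:0, 1:] * [:0, 1:] - 1 :: rat poly) 0 \<noteq> 0" by simp
  then have "[:0, 1:] * [:0, 1:] - 1 \<noteq> (0 :: rat poly)" by (metis coeff_0)
  ultimately show "qm1 \<noteq> 0" by (simp only: to_fract_eq_0_iff not_False_eq_True)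
  then show "qhalf - 1 / qhalf \<noteq> 0" using nz by (simp add: field_simps power2_eq_square)
qed

context positive_lattice
begin

definition conf_factor :: "'g vertex set \<Rightarrow> ratfun" where
  "conf_factor V = qhalf powi (int (card V) - int (card (arr V V))) / qm1 ^ card V"

text \<open>
  The coefficient \<open>f\<^sub>+(m)\<close> for \<open>s = -1\<close>, and its analogue for the reversed order for \<open>s = 1\<close>.
\<close>

definition f_coeff :: "int \<Rightarrow> ('g \<Rightarrow>\<^sub>0 nat) \<Rightarrow> ratfun" where
  "f_coeff s m = qhalf powi (int (mcard m) - int (card (arrows \<Gamma> m))) / qm1 ^ mcard m * semistable_sum s qm1 (vertices m)"

lemma f_coeff_mtype: "finite V \<Longrightarrow> f_coeff s (mtype V) = conf_factor V * semistable_sum s qm1 V"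
  using semistable_sum_mtype[of V s qm1] by (simp add: f_coeff_def conf_factor_def mcard_mtype card_arr_mtype)

text \<open>
  Of the arrows between \<open>U\<close> and its complement, those into \<open>U\<close> contribute \<open>q\<close> to the sum over sets of arrows,
  and all contribute \<open>v\<^sup>-\<^sup>1\<close> to the prefactor. What remains is \<open>v\<close> to the
  difference of the numbers of arrows in the two directions, which is the twist of the quantum torus.
\<close>

lemma conf_factor_split:
  assumes V: "finite V" "U \<subseteq> V"
  shows "conf_factor V * (1 + qm1) ^ card (arr (V - U) U) =
    qhalf powi (form \<Gamma> (weight U) (weight (V - U))) * conf_factor U * conf_factor (V - U)"
proof -
  have f: "finite U" "finite (V - U)" using V finite_subset by auto
  have c: "card V = card U + card (V - U)"
    using card_Un_disjoint[OF f] V(2) by (metis Diff_disjoint Diff_partition)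
  have e: "(int (card V) - int (card (arr V V))) + int (2 * card (arr (V - U) U)) =
    form \<Gamma> (weight U) (weight (V - U)) + (int (card U) - int (card (arr U U))) +
     (int (card (V - U)) - int (card (arr (V - U) (V - U))))"
    using card_arr_split[OF V] card_arr_diff[OF f] c by simp
  have "(1 + qm1) ^ card (arr (V - U) U) = qhalf powi (int (2 * card (arr (V - U) U)))"
    by (simp only: power_int_of_nat power_mult) simp
  then have "conf_factor V * (1 + qm1) ^ card (arr (V - U) U) =
    qhalf powi ((int (card V) - int (card (arr V V))) + int (2 * card (arr (V - U) U))) / qm1 ^ card V"
    unfolding conf_factor_def power_int_add[OF disjI1[OF qhalf_nz(1)]] by (simp only: times_divide_eq_left)
  also have "\<dots> = qhalf powi (form \<Gamma> (weight U) (weight (V - U))) * conf_factor U * conf_factor (V - U)"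
    unfolding e conf_factor_def using qhalf_nz(1) by (simp add: power_int_add c power_add)
  finally show ?thesis .
qed

text \<open>
  The coefficient of \<open>x\<^sup>m\<close> in the ordered product over the list of the series
  \<open>\<Sum> f(m) x\<^sup>m / m!\<close> on the given rays, in the quantum torus with exponents \<open>m\<close>.
\<close>

primrec hn_coeff :: "int \<Rightarrow> 'g list \<Rightarrow> ('g \<Rightarrow>\<^sub>0 nat) \<Rightarrow> ratfun" where
  "hn_coeff s [] m = (if m = 0 then 1 else 0)"
| "hn_coeff s (d # ds) m = (\<Sum>(a, b)\<in>decomp m. if form \<Gamma> d (mnorm a) = 0
     then qhalf powi (form \<Gamma> (mnorm a) (mnorm b)) * (f_coeff s a / of_nat (mfact a)) * hn_coeff s ds b else 0)"

text \<open>
  The recursion for \<open>hn_sum\<close> runs over subsets of vertices and that for \<open>hn_coeff\<close> over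
  decompositions of the multiplicity; the number of subsets for a decomposition is the
  quotient of factorials.
\<close>

lemma hn_coeff_mtype:
  assumes "vertex_set V" "sorted_wrt (before s) ds" "set ds \<subseteq> Gplus_nz \<Gamma>"
  shows "hn_coeff s ds (mtype V) = conf_factor V * hn_sum s qm1 ds V / of_nat (mfact (mtype V))"
  using assms
proof (induction ds arbitrary: V)
  case Nil
  then have f: "finite V" by (simp add: vertex_set_def)
  have "mtype V = 0 \<longleftrightarrow> V = {}" using keys_mtype[OF f] by (metis keys_eq_empty image_is_empty)
  moreover have "arr {} {} = {}" by (simp add: arr_def)
  then have "conf_factor {} = 1" by (simp add: conf_factor_def)
  ultimately show ?case by (auto simp: hn_sum_Nil)
next
  case (Cons d ds)
  note V = Cons.prems(1)
  have finV: "finite V" using V by (simp add: vertex_set_def)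
  let ?F = "\<lambda>m. of_nat (mfact m) :: ratfun"
  have nz: "?F m \<noteq> 0" for m :: "'g \<Rightarrow>\<^sub>0 nat" using mfact_pos[of m] by simp
  let ?G = "\<lambda>a b. if form \<Gamma> d (mnorm a) = 0
     then qhalf powi (form \<Gamma> (mnorm a) (mnorm b)) * f_coeff s a * (?F b * hn_coeff s ds b) else 0"
  have "conf_factor V * hn_sum s qm1 (d # ds) V = (\<Sum>U\<in>Pow V. ?G (mtype U) (mtype (V - U)))"
    unfolding hn_sum_Cons[OF V Cons.prems(2,3)] sum_distrib_left
  proof (rule sum.cong[OF refl])
    fix U assume "U \<in> Pow V"
    then have U: "U \<subseteq> V" "finite U" "finite (V - U)" using finV finite_subset by auto
    have n: "mnorm (mtype U) = weight U" "mnorm (mtype (V - U)) = weight (V - U)"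
      using U by (simp_all add: mnorm_mtype)
    have IH: "?F (mtype (V - U)) * hn_coeff s ds (mtype (V - U)) = conf_factor (V - U) * hn_sum s qm1 ds (V - U)"
      using Cons.IH[of "V - U"] vertex_set_subset[OF V, of "V - U"] Cons.prems nz by simp
    show "conf_factor V * (if form \<Gamma> d (weight U) = 0
        then semistable_sum s qm1 U * (1 + qm1) ^ card (arr (V - U) U) * hn_sum s qm1 ds (V - U) else 0) =
      ?G (mtype U) (mtype (V - U))"
    proof (cases "form \<Gamma> d (weight U) = 0")
      case True
      have "conf_factor V * (semistable_sum s qm1 U * (1 + qm1) ^ card (arr (V - U) U) * hn_sum s qm1 ds (V - U)) =
        (conf_factor V * (1 + qm1) ^ card (arr (V - U) U)) * semistable_sum s qm1 U * hn_sum s qm1 ds (V - U)"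
        by (simp only: mult_ac)
      also have "\<dots> = qhalf powi (form \<Gamma> (weight U) (weight (V - U))) * (conf_factor U * semistable_sum s qm1 U) * (conf_factor (V - U) * hn_sum s qm1 ds (V - U))"
        unfolding conf_factor_split[OF finV U(1)] by (simp only: mult_ac)
      finally show ?thesis unfolding n IH f_coeff_mtype[OF U(2)] using True by simp
    qed (simp add: n)
  qed
  also have "\<dots> = (\<Sum>(a, b)\<in>decomp (mtype V). ?F (mtype V) / (?F a * ?F b) * ?G a b)"
    by (rule sum_Pow_mtype[OF finV])
  also have "\<dots> = ?F (mtype V) * hn_coeff s (d # ds) (mtype V)"
    unfolding hn_coeff.simps sum_distrib_left
    by (rule sum.cong[OF refl]) (clarify, simp add: nz mfact_pos[THEN less_imp_neq, THEN not_sym])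
  finally show ?case using nz by simp
qed

text \<open>
  The right hand side does not mention \<open>s\<close>: this is why the clockwise and the anticlockwise product
  agree.
\<close>

lemma hn_coeff_complete:
  assumes m: "m \<in> mults \<Gamma>" and ds: "sorted_wrt (before s) ds" "set ds \<subseteq> Gplus_nz \<Gamma>"
    and all: "\<And>\<alpha>. \<alpha> \<in> Gplus_nz \<Gamma> \<Longrightarrow> deg \<alpha> \<le> deg (mnorm m) \<Longrightarrow> \<exists>d\<in>set ds. form \<Gamma> d \<alpha> = 0"
  shows "hn_coeff s ds m = conf_factor (vertices m) * (1 + qm1) ^ card (arrows \<Gamma> m) / of_nat (mfact m)"
proof -
  let ?V = "vertices m"
  have V: "vertex_set ?V" by (rule vertex_set_vertices[OF m])
  have "hn_sum s qm1 ds ?V = (1 + qm1) ^ card (arr ?V ?V)"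
  proof (rule hn_sum_complete[OF V ds])
    fix W assume W: "W \<subseteq> ?V" "W \<noteq> {}"
    have "weight ?V = weight (?V \<inter> W) + weight (?V - W)" by (rule weight_split[OF V subset_refl])
    moreover have "?V \<inter> W = W" using W by auto
    moreover have "deg (weight (?V - W)) \<ge> 0"
    proof (cases "?V - W = {}")
      case True
      then show ?thesis by (simp only: weight_empty deg_0 order_refl)
    next
      case False
      then show ?thesis using weight_nz[OF V, of "?V - W"] by (auto intro!: deg_nonneg)
    qed
    moreover have "weight ?V = mnorm m"
      using mnorm_mtype[OF finite_vertices, of m] by (simp add: mtype_vertices)
    ultimately have "deg (weight W) \<le> deg (mnorm m)" by (simp add: deg_add)
    then show "\<exists>d\<in>set ds. form \<Gamma> d (weight W) = 0" using all weight_nz[OF V W] by blast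
  qed
  then show ?thesis using hn_coeff_mtype[OF V ds] by (simp add: mtype_vertices arrows_eq)
qed

text \<open>
  For the reversed order, take a class \<open>\<gamma>\<close> of smallest slope. No arrow leaves the vertices on the ray of
  \<open>\<gamma>\<close> for a vertex on another ray, so they form a subrepresentation for every set of arrows. It
  destabilizes unless all vertices are on that ray; then there are no arrows at all.
\<close>

lemma f_coeff_plus:
  assumes m: "m \<in> mults \<Gamma>"
  shows "f_coeff 1 m = (if \<forall>\<alpha>\<in>Poly_Mapping.keys m. \<forall>\<beta>\<in>Poly_Mapping.keys m. form \<Gamma> \<alpha> \<beta> = 0
    then (1 / (qhalf - 1 / qhalf)) ^ mcard m else 0)"
proof (cases "\<forall>\<alpha>\<in>Poly_Mapping.keys m. \<forall>\<beta>\<in>Poly_Mapping.keys m. form \<Gamma> \<alpha> \<beta> = 0")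
  case True
  let ?V = "vertices m"
  have "arr ?V ?V = {}" using True by (auto simp: arr_def vertices_def)
  moreover have "semistable_conf 1 {} ?V"
  proof -
    have "form \<Gamma> (weight U) (weight ?V) = 0" if "U \<subseteq> ?V" for U
    proof -
      have "fst v \<in> Poly_Mapping.keys m" if "v \<in> ?V" for v using that by (auto simp: vertices_def)
      then show ?thesis using True \<open>U \<subseteq> ?V\<close> unfolding weight_def form_sum_left form_sum_right
        by (intro sum.neutral ballI) blast
    qed
    then show ?thesis by (auto simp: semistable_conf_def closed_in_def)
  qed
  ultimately have "f_coeff 1 m = qhalf powi (int (mcard m)) / qm1 ^ mcard m"
    by (simp add: f_coeff_def semistable_sum_def arrows_eq)
  also have "\<dots> = (qhalf / qm1) ^ mcard m" by (simp add: power_divide)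
  also have "qhalf / qm1 = 1 / (qhalf - 1 / qhalf)"
    using qhalf_nz by (simp add: field_simps power2_eq_square)
  finally show ?thesis using True by simp
next
  case False
  let ?V = "vertices m"
  have V: "vertex_set ?V" by (rule vertex_set_vertices[OF m])
  have keys: "Poly_Mapping.keys m \<subseteq> Gplus_nz \<Gamma>" using m by (simp add: mults_def)
  obtain \<alpha>0 \<beta>0 where ab: "\<alpha>0 \<in> Poly_Mapping.keys m" "\<beta>0 \<in> Poly_Mapping.keys m" "form \<Gamma> \<alpha>0 \<beta>0 \<noteq> 0"
    using False by blast
  have "\<exists>\<gamma>\<in>Poly_Mapping.keys m. \<forall>\<alpha>\<in>Poly_Mapping.keys m. form \<Gamma> \<gamma> \<alpha> \<ge> 0"
  proof -
    have min: "\<exists>\<gamma>\<in>S. \<forall>\<alpha>\<in>S. form \<Gamma> \<gamma> \<alpha> \<ge> 0" if "finite S" "S \<noteq> {}" "S \<subseteq> Gplus_nz \<Gamma>" for S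
      using that
    proof (induction S rule: finite_ne_induct)
      case (insert x S)
      then obtain \<gamma> where \<gamma>: "\<gamma> \<in> S" "\<forall>\<alpha>\<in>S. form \<Gamma> \<gamma> \<alpha> \<ge> 0" by auto
      show ?case
      proof (cases "form \<Gamma> \<gamma> x \<ge> 0")
        case True
        then show ?thesis using \<gamma> by auto
      next
        case False
        then have "form \<Gamma> x \<gamma> \<ge> 0" using form_skew[of x \<gamma>] by simp
        moreover have "form \<Gamma> x \<alpha> \<ge> 0" if "\<alpha> \<in> S" for \<alpha>
        proof -
          have "x \<in> Gplus_nz \<Gamma>" "\<gamma> \<in> Gplus_nz \<Gamma>" "\<alpha> \<in> Gplus_nz \<Gamma>"
            using insert.prems \<gamma>(1) that by blast+
          then show ?thesis using form_trans_nonneg[of x \<gamma> \<alpha> 1] calculation \<gamma>(2) that by simp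
        qed
        ultimately show ?thesis using \<gamma> by auto
      qed
    qed simp
    show ?thesis using min[OF finite_keys _ keys] ab(1) by blast
  qed
  then obtain \<gamma> where \<gamma>: "\<gamma> \<in> Poly_Mapping.keys m" "\<And>\<alpha>. \<alpha> \<in> Poly_Mapping.keys m \<Longrightarrow> form \<Gamma> \<gamma> \<alpha> \<ge> 0" by auto
  have \<gamma>G: "\<gamma> \<in> Gplus_nz \<Gamma>" using \<gamma> keys by auto
  define U where "U = {v \<in> ?V. form \<Gamma> \<gamma> (fst v) = 0}"
  have key: "fst v \<in> Poly_Mapping.keys m" if "v \<in> ?V" for v using that by (auto simp: vertices_def)
  have le: "form \<Gamma> (fst u) (fst v) \<ge> 0" if "u \<in> U" "v \<in> ?V" for u v
  proof -
    have "fst u \<in> Gplus_nz \<Gamma>" "fst v \<in> Gplus_nz \<Gamma>" "form \<Gamma> \<gamma> (fst u) = 0"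
      using that key keys unfolding U_def by blast+
    then show ?thesis
      using form_trans_nonneg[of "fst u" \<gamma> "fst v" 1] \<gamma>G \<gamma>(2)[OF key[OF that(2)]] form_skew[of "fst u" \<gamma>] by simp
  qed
  have "\<not> semistable_conf 1 A ?V" if A: "A \<subseteq> arr ?V ?V" for A
  proof -
    have "closed_in A ?V U"
    proof (rule closed_inI)
      show "U \<subseteq> ?V" by (auto simp: U_def)
      fix v w j assume "(v, w, j) \<in> A" "v \<in> U" "w \<in> ?V"
      then have "form \<Gamma> (fst w) (fst v) > 0" using A by (auto simp: arr_def)
      moreover have "form \<Gamma> (fst v) (fst w) \<ge> 0" using le \<open>v \<in> U\<close> \<open>w \<in> ?V\<close> by blast
      ultimately show "w \<in> U" using form_skew[of "fst v" "fst w"] by simp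
    qed
    \<comment> \<open>All terms of this form are nonnegative, and a class \<open>\<beta>\<close> outside the ray of \<open>\<gamma>\<close> gives a positive one.\<close>
    moreover have "form \<Gamma> (weight U) (weight ?V) > 0"
    proof -
      have v\<gamma>: "(\<gamma>, 1) \<in> U" using \<gamma>(1) by (auto simp: U_def vertices_def in_keys_iff)
      have "\<exists>\<beta>\<in>Poly_Mapping.keys m. form \<Gamma> \<gamma> \<beta> > 0"
      proof (rule ccontr)
        assume "\<not> ?thesis"
        then have "form \<Gamma> \<gamma> \<alpha>0 = 0" "form \<Gamma> \<gamma> \<beta>0 = 0"
          using \<gamma>(2)[OF ab(1)] \<gamma>(2)[OF ab(2)] ab by force+
        moreover have "\<alpha>0 \<in> Gplus_nz \<Gamma>" "\<beta>0 \<in> Gplus_nz \<Gamma>" using keys ab by blast+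
        ultimately have "form \<Gamma> \<alpha>0 \<beta>0 = 0"
          using form_trans_nonneg[of \<alpha>0 \<gamma> \<beta>0 1] form_trans_nonneg[of \<alpha>0 \<gamma> \<beta>0 "-1"] form_skew[of \<alpha>0 \<gamma>] \<gamma>G by simp
        with ab(3) show False by simp
      qed
      then obtain \<beta> where \<beta>: "\<beta> \<in> Poly_Mapping.keys m" "form \<Gamma> \<gamma> \<beta> > 0" by blast
      have v\<beta>: "(\<beta>, 1) \<in> ?V" using \<beta>(1) by (auto simp: vertices_def in_keys_iff)
      have finV: "finite ?V" by (rule finite_vertices)
      have finU: "finite U" using finV by (simp add: U_def)
      have "0 < (\<Sum>u\<in>U. \<Sum>v\<in>?V. form \<Gamma> (fst u) (fst v))"
      proof (rule sum_pos2[OF finU v\<gamma>])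
        show "0 < (\<Sum>v\<in>?V. form \<Gamma> (fst (\<gamma>, 1)) (fst v))"
          by (rule sum_pos2[OF finV v\<beta>]) (use \<beta>(2) \<gamma>(2) key in auto)
        show "0 \<le> (\<Sum>v\<in>?V. form \<Gamma> (fst u) (fst v))" if "u \<in> U" for u
          using le[OF that] by (intro sum_nonneg)
      qed
      then show ?thesis unfolding weight_def form_sum_left form_sum_right by (subst sum.swap)
    qed
    ultimately show ?thesis by (auto simp: semistable_conf_def)
  qed
  then have "semistable_sum 1 qm1 ?V = 0" unfolding semistable_sum_def by (intro sum.neutral) auto
  then have "f_coeff 1 m = 0" by (simp add: f_coeff_def)
  with False show ?thesis by (simp only: if_False)
qed

end

section \<open>The class of the semistable locus\<close>

lemma complex_subspace:
  fixes S :: "complex set"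
  assumes "vector_space_over_itself.subspace S" shows "S = {0} \<or> S = UNIV"
proof (cases "S = {0}")
  case False
  have "0 \<in> S" using assms by (rule vector_space_over_itself.subspace_0)
  with False obtain z where z: "z \<in> S" "z \<noteq> 0" by auto
  have "w \<in> S" for w
    using vector_space_over_itself.subspace_scale[OF assms z(1), of "w / z"] z(2) by simp
  then show ?thesis by auto
qed simp

lemma complex_dim: "vector_space_over_itself.dim (UNIV :: complex set) = 1" "vector_space_over_itself.dim ({0} :: complex set) = 0"
proof -
  show "vector_space_over_itself.dim (UNIV :: complex set) = 1"
    using vector_space_over_itself.dim_UNIV[where ?'a = complex] by (simp add: dimension_eq_1)
  show "vector_space_over_itself.dim ({0} :: complex set) = 0"
    using vector_space_over_itself.dim_span[of "{} :: complex set"] by simp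
qed

lemma UNIV_not_0: "(UNIV :: complex set) \<noteq> {0}"
  by (metis UNIV_I singletonD zero_neq_one)

context positive_lattice
begin

text \<open>
  For finite slopes, clearing denominators leaves the product of the determinant of \<open>Z(e\<^sub>1), Z(e\<^sub>2)\<close>, which is positive
  since \<open>e\<^sub>1\<close> has the smaller slope, and of \<open>\<langle>\<alpha>,\<beta>\<rangle>\<close> up to a positive factor. The slope
  is infinite only for multiples of \<open>e\<^sub>2\<close>.
\<close>

lemma slope_le_iff:
  assumes Z: "stability_function \<Gamma> Z" and \<alpha>: "\<alpha> \<in> Gplus_nz \<Gamma>" and \<beta>: "\<beta> \<in> Gplus_nz \<Gamma>"
  shows "slope Z \<alpha> \<le> slope Z \<beta> \<longleftrightarrow> form \<Gamma> \<alpha> \<beta> \<ge> 0"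
proof -
  have add: "Z (x + y) = Z x + Z y" for x y using Z by (auto simp: stability_function_def)
  have zmul: "zmult k (w :: complex) = of_int k * w" for k w
  proof -
    have n: "zmult (int n) w = of_nat n * w" for n by (simp add: zmult_of_nat)
    show ?thesis
      using n[of "nat k"] n[of "nat (- k)"] zmult_minus[of "- k" w] by (cases "k \<ge> 0") auto
  qed
  define r1 r2 d1 d2 where "r1 = Im (Z (e1 \<Gamma>))" and "r2 = Im (Z (e2 \<Gamma>))"
    and "d1 = - Re (Z (e1 \<Gamma>))" and "d2 = - Re (Z (e2 \<Gamma>))"
  have Zc: "Z \<gamma> = of_int (cx \<gamma>) * Z (e1 \<Gamma>) + of_int (cy \<gamma>) * Z (e2 \<Gamma>)" for \<gamma>
  proof -
    have "Z \<gamma> = Z (zmult (cx \<gamma>) (e1 \<Gamma>) + zmult (cy \<gamma>) (e2 \<Gamma>))" using coords[of \<gamma>] by simp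
    then show ?thesis by (simp add: add additive_zmult[of Z] zmul)
  qed
  have Im: "Im (Z \<gamma>) = cx \<gamma> * r1 + cy \<gamma> * r2" and Re: "- Re (Z \<gamma>) = cx \<gamma> * d1 + cy \<gamma> * d2" for \<gamma>
    unfolding Zc[of \<gamma>] r1_def r2_def d1_def d2_def by simp_all
  have half: "Im (Z e) > 0 \<or> Im (Z e) = 0 \<and> - Re (Z e) > 0" if "e \<in> {e1 \<Gamma>, e2 \<Gamma>}" for e
  proof -
    obtain r \<phi> where r: "r > 0" "0 < \<phi>" "\<phi> \<le> 1" "Z e = rcis r (pi * \<phi>)"
      using Z \<open>e \<in> _\<close> unfolding stability_function_def by blast
    show ?thesis
    proof (cases "\<phi> = 1")
      case False
      then have "sin (pi * \<phi>) > 0" using r by (intro sin_gt_zero) auto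
      then show ?thesis using r by simp
    qed (use r in simp)
  qed
  have sl: "slope Z (e1 \<Gamma>) < slope Z (e2 \<Gamma>)" using Z by (simp add: stability_function_def)
  have r1: "r1 > 0"
    using half[of "e1 \<Gamma>"] sl unfolding slope_def r1_def by auto
  have r2: "r2 > 0 \<or> r2 = 0 \<and> d2 > 0" using half[of "e2 \<Gamma>"] by (simp add: r2_def d2_def)
  have D: "d2 * r1 - d1 * r2 > 0"
  proof (cases "r2 = 0")
    case False
    then have "d1 / r1 < d2 / r2" using sl r1 unfolding slope_def r1_def r2_def d1_def d2_def by simp
    then show ?thesis using r1 r2 False by (simp add: field_simps)
  qed (use r1 r2 in auto)
  let ?a = "\<lambda>\<gamma>. real_of_int (cx \<gamma>)" and ?b = "\<lambda>\<gamma>. real_of_int (cy \<gamma>)"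
  have nn: "?a \<gamma> \<ge> 0" "?b \<gamma> \<ge> 0" "?a \<gamma> > 0 \<or> ?b \<gamma> > 0" if "\<gamma> \<in> Gplus_nz \<Gamma>" for \<gamma>
    using that deg_pos[OF that] by (auto simp: Gplus_iff deg_def)
  have form: "form \<Gamma> \<alpha> \<beta> \<ge> 0 \<longleftrightarrow> ?a \<alpha> * ?b \<beta> - ?b \<alpha> * ?a \<beta> \<ge> 0"
  proof -
    have "form \<Gamma> \<alpha> \<beta> \<ge> 0 \<longleftrightarrow> cx \<alpha> * cy \<beta> - cy \<alpha> * cx \<beta> \<ge> 0"
      unfolding form_coords[of \<alpha>] using form_pos by (simp add: zero_le_mult_iff)
    also have "\<dots> \<longleftrightarrow> ?a \<alpha> * ?b \<beta> - ?b \<alpha> * ?a \<beta> \<ge> 0"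
      by (simp flip: of_int_mult)
    finally show ?thesis .
  qed
  have Im_nn: "Im (Z \<gamma>) \<ge> 0" if "\<gamma> \<in> Gplus_nz \<Gamma>" for \<gamma>
    unfolding Im using nn[OF that] r1 r2 by (intro add_nonneg_nonneg mult_nonneg_nonneg) auto
  have Im0: "?a \<gamma> = 0 \<and> r2 = 0 \<and> ?b \<gamma> > 0" if "Im (Z \<gamma>) = 0" "\<gamma> \<in> Gplus_nz \<Gamma>" for \<gamma>
  proof -
    have "?a \<gamma> * r1 \<ge> 0" "?b \<gamma> * r2 \<ge> 0" using nn[OF that(2)] r1 r2 by auto
    then have "?a \<gamma> * r1 = 0" "?b \<gamma> * r2 = 0" using that(1) unfolding Im by linarith+
    then show ?thesis using r1 nn[OF that(2)] by auto
  qed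
  show ?thesis
  proof (cases "Im (Z \<beta>) = 0")
    case True
    then have "?a \<beta> = 0" "?b \<beta> > 0" using Im0 \<beta> by blast+
    then show ?thesis unfolding form using True nn[OF \<alpha>] by (simp add: slope_def)
  next
    case False
    then have I\<beta>: "Im (Z \<beta>) > 0" using Im_nn[OF \<beta>] by simp
    show ?thesis
    proof (cases "Im (Z \<alpha>) = 0")
      case True
      then have a: "?a \<alpha> = 0" "r2 = 0" "?b \<alpha> > 0" using Im0 \<alpha> by blast+
      then have "?a \<beta> > 0" using I\<beta> r1 unfolding Im by (simp add: zero_less_mult_iff)
      with a have "?b \<alpha> * ?a \<beta> > 0" by simp
      then show ?thesis unfolding form using a True False by (simp add: slope_def)
    next
      case False
      then have I\<alpha>: "Im (Z \<alpha>) > 0" using Im_nn[OF \<alpha>] by simp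
      have "slope Z \<alpha> \<le> slope Z \<beta> \<longleftrightarrow> - Re (Z \<alpha>) / Im (Z \<alpha>) \<le> - Re (Z \<beta>) / Im (Z \<beta>)"
        using I\<alpha> I\<beta> by (simp add: slope_def)
      also have "\<dots> \<longleftrightarrow> - Re (Z \<alpha>) * Im (Z \<beta>) \<le> - Re (Z \<beta>) * Im (Z \<alpha>)"
        using I\<alpha> I\<beta> by (simp add: field_simps)
      also have "\<dots> \<longleftrightarrow> 0 \<le> (d2 * r1 - d1 * r2) * (?a \<alpha> * ?b \<beta> - ?b \<alpha> * ?a \<beta>)"
        unfolding Re Im by (simp add: algebra_simps)
      also have "\<dots> \<longleftrightarrow> ?a \<alpha> * ?b \<beta> - ?b \<alpha> * ?a \<beta> \<ge> 0"
        using D by (simp add: zero_le_mult_iff)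
      finally show ?thesis unfolding form .
    qed
  qed
qed

abbreviation supp :: "('g \<Rightarrow>\<^sub>0 nat) \<Rightarrow> point \<Rightarrow> 'g arrow set" where
  "supp m x \<equiv> {a \<in> arrows \<Gamma> m. arrow_map \<Gamma> m x a \<noteq> 0}"

text \<open>
  The spaces at the vertices are lines, so a subrepresentation is given by the set of vertices where it
  is not zero.
\<close>

lemma semistable_iff:
  assumes Z: "stability_function \<Gamma> Z" and m: "m \<in> mults \<Gamma>"
  shows "semistable \<Gamma> Z m x \<longleftrightarrow> semistable_conf (-1) (supp m x) (vertices m)"
proof -
  let ?V = "vertices m" and ?A = "supp m x"
  have V: "vertex_set ?V" by (rule vertex_set_vertices[OF m])
  have cl: "cl m N = weight {v \<in> ?V. N v \<noteq> {0}}"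
    if "\<And>v. v \<in> ?V \<Longrightarrow> N v = {0} \<or> N v = UNIV" for N
  proof -
    have "cl m N = (\<Sum>v\<in>?V. if N v \<noteq> {0} then fst v else 0)"
      unfolding cl_def
    proof (intro sum.cong refl)
      fix v assume "v \<in> ?V"
      then have "N v = {0} \<or> N v = UNIV" by (rule that)
      then show "zmult (int (vector_space_over_itself.dim (N v))) (fst v) = (if N v \<noteq> {0} then fst v else 0)"
      proof
        assume "N v = {0}"
        then show ?thesis by (simp add: complex_dim)
      next
        assume "N v = UNIV"
        then show ?thesis by (simp add: complex_dim UNIV_not_0)
      qed
    qed
    then show ?thesis unfolding weight_def by (simp add: sum.If_cases finite_vertices Int_def)
  qed
  have clV: "cl m (\<lambda>_. UNIV) = weight ?V"
    using cl[of "\<lambda>_. UNIV"] by (simp add: UNIV_not_0)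
  have ss_iff: "semistable_conf (-1) ?A ?V \<longleftrightarrow> (\<forall>U. closed_in ?A ?V U \<longrightarrow> U \<noteq> {} \<longrightarrow> U \<noteq> ?V \<longrightarrow>
      slope Z (weight U) \<le> slope Z (weight ?V))"
  proof -
    have "-1 * form \<Gamma> (weight U) (weight ?V) \<le> 0 \<longleftrightarrow> (U \<noteq> {} \<longrightarrow> U \<noteq> ?V \<longrightarrow> slope Z (weight U) \<le> slope Z (weight ?V))"
      if "closed_in ?A ?V U" for U
    proof (cases "U = {} \<or> U = ?V")
      case False
      have "U \<subseteq> ?V" using that by (rule closed_in_subset)
      then have "weight U \<in> Gplus_nz \<Gamma>" "weight ?V \<in> Gplus_nz \<Gamma>"
        using weight_nz[OF V, of U] weight_nz[OF V, of ?V] False by auto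
      from slope_le_iff[OF Z this] show ?thesis using False by simp
    qed auto
    then show ?thesis unfolding semistable_conf_def by auto
  qed
  show ?thesis
  proof
    assume sst: "semistable \<Gamma> Z m x"
    show "semistable_conf (-1) ?A ?V"
      unfolding ss_iff
    proof (intro allI impI)
      fix U assume U: "closed_in ?A ?V U" "U \<noteq> {}" "U \<noteq> ?V"
      have UV: "U \<subseteq> ?V" using U(1) by (rule closed_in_subset)
      define N where "N = (\<lambda>v. if v \<in> U then UNIV else {0 :: complex})"
      have "subrep \<Gamma> m x N"
        unfolding subrep_def
      proof (intro conjI ballI)
        show "vector_space_over_itself.subspace (N v)" for v
          by (simp add: N_def vector_space_over_itself.subspace_UNIV vector_space_over_itself.subspace_single_0)
        fix a assume a: "a \<in> arrows \<Gamma> m"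
        obtain v w j where vwj: "a = (v, w, j)" by (cases a)
        have wV: "w \<in> ?V" using a vwj by (simp add: arrows_def)
        have "arrow_map \<Gamma> m x a * z \<in> N w" if z: "z \<in> N v" for z
        proof (cases "v \<in> U \<and> arrow_map \<Gamma> m x a \<noteq> 0")
          case True
          then have "w \<in> U" using closed_inD[OF U(1), of v w j] a vwj wV by auto
          then show ?thesis by (simp add: N_def)
        qed (use z in \<open>auto simp: N_def split: if_splits\<close>)
        then show "case a of (v, w, j) \<Rightarrow> \<forall>z\<in>N v. arrow_map \<Gamma> m x (v, w, j) * z \<in> N w"
          by (simp add: vwj)
      qed
      moreover have N0: "N v \<noteq> {0} \<longleftrightarrow> v \<in> U" "N v \<noteq> UNIV \<longleftrightarrow> v \<notin> U" for v
        unfolding N_def using UNIV_not_0 UNIV_not_0[symmetric] by simp_all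
      moreover have "\<exists>v\<in>?V. v \<in> U" "\<exists>v\<in>?V. v \<notin> U" using U(2,3) UV by blast+
      ultimately have "slope Z (cl m N) \<le> slope Z (cl m (\<lambda>_. UNIV))"
        using sst unfolding semistable_def by metis
      moreover have "cl m N = weight {v \<in> ?V. N v \<noteq> {0}}"
        by (rule cl) (simp add: N_def)
      moreover have "{v \<in> ?V. N v \<noteq> {0}} = U" unfolding N0 using UV by blast
      ultimately show "slope Z (weight U) \<le> slope Z (weight ?V)"
        unfolding clV by simp
    qed
  next
    assume s: "semistable_conf (-1) ?A ?V"
    show "semistable \<Gamma> Z m x"
      unfolding semistable_def
    proof (intro allI impI)
      fix N assume N: "subrep \<Gamma> m x N" "\<exists>v\<in>?V. N v \<noteq> {0}" "\<exists>v\<in>?V. N v \<noteq> UNIV"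
      have N01: "N v = {0} \<or> N v = UNIV" if "v \<in> ?V" for v
        using N(1) that complex_subspace unfolding subrep_def by blast
      let ?U = "{v \<in> ?V. N v \<noteq> {0}}"
      have "closed_in ?A ?V ?U"
      proof (rule closed_inI)
        fix v w j assume a: "(v, w, j) \<in> ?A" "v \<in> ?U" "w \<in> ?V"
        then have "v \<in> ?V" "N v \<noteq> {0}" by simp_all
        then have "N v = UNIV" using N01[of v] by blast
        then have "1 \<in> N v" by simp
        moreover have "\<forall>z\<in>N v. arrow_map \<Gamma> m x (v, w, j) * z \<in> N w"
          using N(1) a(1) unfolding subrep_def by blast
        ultimately have "arrow_map \<Gamma> m x (v, w, j) * 1 \<in> N w" by blast
        moreover have "arrow_map \<Gamma> m x (v, w, j) \<noteq> 0" using a(1) by simp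
        ultimately have "N w \<noteq> {0}" by (metis mult_1_right singletonD)
        then show "w \<in> ?U" using a(3) by simp
      qed blast
      moreover have "?U \<noteq> {}" using N(2) by blast
      moreover have "?U \<noteq> ?V"
      proof -
        obtain v where v: "v \<in> ?V" "N v \<noteq> UNIV" using N(3) by blast
        then have "N v = {0}" using N01[of v] by blast
        then have "v \<notin> ?U" by simp
        with v(1) show ?thesis by blast
      qed
      ultimately have "slope Z (weight ?U) \<le> slope Z (weight ?V)"
        using s[unfolded ss_iff, rule_format, of ?U] by simp
      then show "slope Z (cl m N) \<le> slope Z (cl m (\<lambda>_. UNIV))"
        using cl[of N] N01 unfolding clV by simp
    qed
  qed
qed

lemma closed_in_mono: "A \<subseteq> B \<Longrightarrow> closed_in B V U \<Longrightarrow> closed_in A V U"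
  unfolding closed_in_def by blast

lemma semistable_conf_mono: "A \<subseteq> B \<Longrightarrow> semistable_conf s A V \<Longrightarrow> semistable_conf s B V"
  unfolding semistable_conf_def using closed_in_mono by blast

text \<open>
  Enlarging the set of nonzero arrows leaves fewer subrepresentations. Hence the supports of
  semistable points are closed under enlarging.
\<close>

lemma motive_of_semistable_locus:
  assumes Z: "stability_function \<Gamma> Z" and m: "m \<in> mults \<Gamma>"
  shows "motive_of (semistable_locus \<Gamma> Z m) = scalar (semistable_sum (-1) qm1 (vertices m))"
proof -
  let ?R = "arrows \<Gamma> m" and ?V = "vertices m"
  let ?n = "card ?R" and ?e = "to_nat_on ?R"
  have fin: "finite ?R" unfolding arrows_eq by (intro finite_arr finite_vertices)
  have bij: "bij_betw ?e ?R {..<?n}" by (rule to_nat_on_finite[OF fin])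
  then have inj: "inj_on ?e ?R" and im: "?e ` ?R = {..<?n}" by (auto simp: bij_betw_def)
  define \<S> where "\<S> = (`) ?e ` {A \<in> Pow ?R. semistable_conf (-1) A ?V}"
  have img_inj: "A = B" if "A \<subseteq> ?R" "B \<subseteq> ?R" "?e ` A = ?e ` B" for A B
    using inj that by (simp add: inj_on_image_eq_iff)
  have mem: "?e ` A \<in> \<S> \<longleftrightarrow> semistable_conf (-1) A ?V" if "A \<subseteq> ?R" for A
    unfolding \<S>_def using img_inj that by auto
  have supp: "{i. x i \<noteq> 0} = ?e ` supp m x" if x: "x \<in> affine_points ?n" for x
  proof -
    have "{i. x i \<noteq> 0} \<subseteq> ?e ` ?R" unfolding im by (rule support_subset[OF x])
    then show ?thesis by (auto simp: arrow_map_def)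
  qed
  have "{x \<in> points (affine_space ?n). semistable \<Gamma> Z m x} = strata ?n \<S>"
  proof (rule set_eqI)
    fix x
    have sub: "supp m x \<subseteq> ?R" by auto
    show "x \<in> {x \<in> points (affine_space ?n). semistable \<Gamma> Z m x} \<longleftrightarrow> x \<in> strata ?n \<S>"
    proof (cases "x \<in> affine_points ?n")
      case True
      show ?thesis
        unfolding strata_def affine_space_simps mem_Collect_eq semistable_iff[OF Z m] supp[OF True] mem[OF sub]
        using True by (simp only: simp_thms topspace_zariski)
    qed (simp add: strata_def)
  qed
  moreover have up: "up_closed ?n \<S>"
    unfolding up_closed_def
  proof (intro conjI ballI allI impI)
    show "\<S> \<subseteq> Pow {..<?n}" unfolding \<S>_def im[symmetric] by auto
    fix S T assume "S \<in> \<S>" and T: "S \<subseteq> T" "T \<subseteq> {..<?n}"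
    then obtain A where A: "A \<subseteq> ?R" "semistable_conf (-1) A ?V" "S = ?e ` A" unfolding \<S>_def by auto
    from T(2) obtain B where B: "B \<subseteq> ?R" "T = ?e ` B" unfolding im[symmetric] by (rule subset_imageE)
    have "A \<subseteq> B" using inj_on_image_subset_iff[OF inj A(1) B(1)] T(1) A(3) B(2) by simp
    then show "T \<in> \<S>" using mem[OF B(1)] semistable_conf_mono[OF _ A(2)] B(2) by simp
  qed
  ultimately have "motive_of (semistable_locus \<Gamma> Z m) = scalar (\<Sum>S\<in>\<S>. qm1 ^ card S)"
    unfolding semistable_locus_def Let_def using motive_of_strata[OF up] by simp
  also have "(\<Sum>S\<in>\<S>. qm1 ^ card S) = (\<Sum>A\<in>{A \<in> Pow ?R. semistable_conf (-1) A ?V}. qm1 ^ card (?e ` A))"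
    unfolding \<S>_def using img_inj by (subst sum.reindex) (auto simp: inj_on_def)
  also have "\<dots> = (\<Sum>A\<in>{A \<in> Pow ?R. semistable_conf (-1) A ?V}. qm1 ^ card A)"
    using inj by (intro sum.cong refl) (auto simp: card_image inj_on_subset)
  also have "\<dots> = semistable_sum (-1) qm1 ?V"
    unfolding semistable_sum_def arrows_eq[symmetric] using fin by (intro sum.inter_filter) simp
  finally show ?thesis .
qed

lemma f_plus_eq:
  assumes "stability_function \<Gamma> Z" "m \<in> mults \<Gamma>"
  shows "f_plus \<Gamma> Z m = scalar (f_coeff (-1) m)"
  unfolding f_plus_def motive_of_semistable_locus[OF assms] f_coeff_def scalar_mult ..

end

section \<open>Exponentials in twisted power series\<close>

text \<open>
  Common setting for the quantum torus and for the series whose exponents are multiplicities, with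
  or without twist. The function \<open>dg\<close> is a degree, which makes recursion on coefficients possible.
\<close>

locale graded_series =
  fixes S :: "'i::comm_monoid_add set" and \<sigma> :: "'i \<Rightarrow> 'i \<Rightarrow> motive" and dg :: "'i \<Rightarrow> int"
  assumes S0: "0 \<in> S" and S_add: "\<alpha> \<in> S \<Longrightarrow> \<beta> \<in> S \<Longrightarrow> \<alpha> + \<beta> \<in> S"
    and finite_dec: "finite {(\<alpha>, \<beta>). \<alpha> \<in> S \<and> \<beta> \<in> S \<and> \<alpha> + \<beta> = \<gamma>}"
    and dg_add: "dg (\<alpha> + \<beta>) = dg \<alpha> + dg \<beta>"
    and dg_nonneg: "\<alpha> \<in> S \<Longrightarrow> 0 \<le> dg \<alpha>" and dg_eq_0: "\<alpha> \<in> S \<Longrightarrow> dg \<alpha> = 0 \<Longrightarrow> \<alpha> = 0"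
    and \<sigma>_left: "\<sigma> (\<alpha> + \<beta>) \<gamma> = \<sigma> \<alpha> \<gamma> * \<sigma> \<beta> \<gamma>" and \<sigma>_right: "\<sigma> \<alpha> (\<beta> + \<gamma>) = \<sigma> \<alpha> \<beta> * \<sigma> \<alpha> \<gamma>"
    and \<sigma>_0: "\<sigma> 0 \<alpha> = 1" "\<sigma> \<alpha> 0 = 1"
begin

abbreviation dec :: "'i \<Rightarrow> ('i \<times> 'i) set" where
  "dec \<gamma> \<equiv> {(\<alpha>, \<beta>). \<alpha> \<in> S \<and> \<beta> \<in> S \<and> \<alpha> + \<beta> = \<gamma>}"

abbreviation mul :: "('i \<Rightarrow> motive) \<Rightarrow> ('i \<Rightarrow> motive) \<Rightarrow> 'i \<Rightarrow> motive" where
  "mul \<equiv> ser_mult S \<sigma>"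

lemma dg_0: "dg 0 = 0"
  using dg_add[of 0 0] by simp

lemma dg_pos: "\<alpha> \<in> S \<Longrightarrow> \<alpha> \<noteq> 0 \<Longrightarrow> 0 < dg \<alpha>"
  using dg_nonneg dg_eq_0 by fastforce

lemma mul_cong:
  assumes "\<And>\<alpha> \<beta>. \<alpha> \<in> S \<Longrightarrow> \<beta> \<in> S \<Longrightarrow> \<alpha> + \<beta> = \<gamma> \<Longrightarrow> \<sigma> \<alpha> \<beta> * F \<alpha> * G \<beta> = \<sigma> \<alpha> \<beta> * F' \<alpha> * G' \<beta>"
  shows "mul F G \<gamma> = mul F' G' \<gamma>"
  unfolding ser_mult_def by (intro sum.cong refl) (use assms in auto)

lemma mul_eq: "mul F G \<gamma> = (\<Sum>p\<in>dec \<gamma>. \<sigma> (fst p) (snd p) * F (fst p) * G (snd p))"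
  unfolding ser_mult_def
proof (rule sum.cong[OF refl])
  fix p
  show "(case p of (\<alpha>, \<beta>) \<Rightarrow> \<sigma> \<alpha> \<beta> * F \<alpha> * G \<beta>) = \<sigma> (fst p) (snd p) * F (fst p) * G (snd p)"
    by (cases p) simp
qed

lemma mul_zeroI:
  assumes "\<And>\<alpha> \<beta>. \<alpha> \<in> S \<Longrightarrow> \<beta> \<in> S \<Longrightarrow> \<alpha> + \<beta> = \<gamma> \<Longrightarrow> \<sigma> \<alpha> \<beta> * F \<alpha> * G \<beta> = 0"
  shows "mul F G \<gamma> = 0"
  unfolding ser_mult_def by (rule sum.neutral) (use assms in auto)

lemma mul_outside: "\<gamma> \<notin> S \<Longrightarrow> mul F G \<gamma> = 0"
proof -
  assume "\<gamma> \<notin> S"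
  then have "dec \<gamma> = {}" using S_add by auto
  then show ?thesis unfolding ser_mult_def by (simp only: sum.empty)
qed

lemma mul_scale: "mul F (\<lambda>\<beta>. c * G \<beta>) \<gamma> = c * mul F G \<gamma>"
  unfolding mul_eq sum_distrib_left by (intro sum.cong refl) (simp only: mult_ac)

lemma mul_sum: "finite N \<Longrightarrow> mul F (\<lambda>\<beta>. \<Sum>n\<in>N. G n \<beta>) \<gamma> = (\<Sum>n\<in>N. mul F (G n) \<gamma>)"
  unfolding mul_eq by (subst sum.swap) (simp only: sum_distrib_left)

lemma mul_mul: "mul F (mul G H) \<gamma> = (\<Sum>(p, r)\<in>Sigma (dec \<gamma>) (\<lambda>p. dec (snd p)).
     \<sigma> (fst p) (snd p) * F (fst p) * (\<sigma> (fst r) (snd r) * G (fst r) * H (snd r)))"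
proof -
  let ?t = "\<lambda>p r. \<sigma> (fst p) (snd p) * F (fst p) * (\<sigma> (fst r) (snd r) * G (fst r) * H (snd r))"
  have "mul F (mul G H) \<gamma> = (\<Sum>p\<in>dec \<gamma>. \<Sum>r\<in>dec (snd p). ?t p r)"
    unfolding mul_eq[of F "mul G H"] mul_eq[of G H] sum_distrib_left by (rule refl)
  also have "\<dots> = (\<Sum>(p, r)\<in>Sigma (dec \<gamma>) (\<lambda>p. dec (snd p)). ?t p r)"
    using finite_dec by (intro sum.Sigma) blast+
  finally show ?thesis .
qed

text \<open>
  The twists which involve an exponent of \<open>H\<close> are the same on both sides, so that the sides only differ by
  the twist between \<open>F\<close> and \<open>G\<close>.
\<close>

lemma mul_left_commute:
  assumes sym: "\<And>\<alpha> \<beta>. \<alpha> \<in> S \<Longrightarrow> \<beta> \<in> S \<Longrightarrow> F \<alpha> \<noteq> 0 \<Longrightarrow> G \<beta> \<noteq> 0 \<Longrightarrow> \<sigma> \<alpha> \<beta> = \<sigma> \<beta> \<alpha>"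
  shows "mul F (mul G H) = mul G (mul F H)"
proof
  fix \<gamma>
  define i :: "('i \<times> 'i) \<times> ('i \<times> 'i) \<Rightarrow> ('i \<times> 'i) \<times> ('i \<times> 'i)" where
    "i = (\<lambda>((a, b), (c, d)). ((c, a + d), (a, d)))"
  have swap: "\<sigma> a (b + c) * F a * (\<sigma> b c * G b * H c) = \<sigma> b (a + c) * G b * (\<sigma> a c * F a * H c)"
    if "a \<in> S" "b \<in> S" for a b c
  proof (cases "F a = 0 \<or> G b = 0")
    case False
    then show ?thesis using sym[OF that] by (simp add: \<sigma>_right mult_ac)
  qed auto
  show "mul F (mul G H) \<gamma> = mul G (mul F H) \<gamma>"
    unfolding mul_mul
  proof (rule sum.reindex_bij_witness[of _ i i])
    fix x assume "x \<in> Sigma (dec \<gamma>) (\<lambda>p. dec (snd p))"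
    then obtain a c d where x: "x = ((a, c + d), (c, d))" "a \<in> S" "c \<in> S" "d \<in> S" "a + (c + d) = \<gamma>"
      by auto
    then have "c + (a + d) = \<gamma>" by (simp add: add.left_commute)
    with x show "i x \<in> Sigma (dec \<gamma>) (\<lambda>p. dec (snd p))" "i x \<in> Sigma (dec \<gamma>) (\<lambda>p. dec (snd p))"
      by (simp_all add: S_add i_def)
    show "i (i x) = x" "i (i x) = x"
      by (simp_all add: x(1) i_def)
    show "(case i x of (p, r) \<Rightarrow>
        \<sigma> (fst p) (snd p) * G (fst p) * (\<sigma> (fst r) (snd r) * F (fst r) * H (snd r))) =
      (case x of (p, r) \<Rightarrow> \<sigma> (fst p) (snd p) * F (fst p) * (\<sigma> (fst r) (snd r) * G (fst r) * H (snd r)))"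
      using swap[OF x(2,3), of d] by (simp add: x(1) i_def)
  qed
qed

definition der :: "('i \<Rightarrow> motive) \<Rightarrow> 'i \<Rightarrow> motive" where
  "der F = (\<lambda>\<gamma>. scalar (of_int (dg \<gamma>)) * F \<gamma>)"

lemma der_mul: "der (mul F G) \<gamma> = mul (der F) G \<gamma> + mul F (der G) \<gamma>"
  unfolding der_def mul_eq sum_distrib_left sum.distrib[symmetric]
proof (rule sum.cong[OF refl])
  fix p assume "p \<in> dec \<gamma>"
  then have dg: "dg \<gamma> = dg (fst p) + dg (snd p)" by (auto simp: dg_add)
  show "scalar (of_int (dg \<gamma>)) * (\<sigma> (fst p) (snd p) * F (fst p) * G (snd p)) =
    \<sigma> (fst p) (snd p) * (scalar (of_int (dg (fst p))) * F (fst p)) * G (snd p) +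
    \<sigma> (fst p) (snd p) * F (fst p) * (scalar (of_int (dg (snd p))) * G (snd p))"
    unfolding dg of_int_add scalar_add by (simp only: distrib_left distrib_right mult_ac)
qed

lemma der_one: "der ser_one = (\<lambda>_. 0)"
  by (auto simp: der_def ser_one_def dg_0)

abbreviation pow :: "('i \<Rightarrow> motive) \<Rightarrow> nat \<Rightarrow> 'i \<Rightarrow> motive" where
  "pow F n \<equiv> (mul F ^^ n) ser_one"

text \<open>
  As \<open>F\<close> commutes with its derivative, the usual formula for the derivative of a power holds.
\<close>

lemma der_pow:
  assumes sym: "\<And>\<alpha> \<beta>. \<alpha> \<in> S \<Longrightarrow> \<beta> \<in> S \<Longrightarrow> F \<alpha> \<noteq> 0 \<Longrightarrow> F \<beta> \<noteq> 0 \<Longrightarrow> \<sigma> \<alpha> \<beta> = \<sigma> \<beta> \<alpha>"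
  shows "der (pow F (Suc n)) = (\<lambda>\<gamma>. scalar (of_nat (Suc n)) * mul (der F) (pow F n) \<gamma>)"
proof (induction n)
  case 0
  have "mul F (\<lambda>_. 0) \<gamma> = 0" for \<gamma> by (simp add: ser_mult_def)
  then show ?case by (auto simp: der_mul der_one)
next
  case (Suc n)
  have comm: "mul F (mul (der F) (pow F n)) = mul (der F) (mul F (pow F n))"
    by (rule mul_left_commute) (auto simp: der_def intro: sym)
  show ?case
  proof
    fix \<gamma>
    have "der (pow F (Suc (Suc n))) \<gamma> = mul (der F) (pow F (Suc n)) \<gamma> + mul F (der (pow F (Suc n))) \<gamma>"
      using der_mul[of F "pow F (Suc n)"] by simp
    also have "mul F (der (pow F (Suc n))) \<gamma> = scalar (of_nat (Suc n)) * mul (der F) (pow F (Suc n)) \<gamma>"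
      unfolding Suc.IH mul_scale comm by simp
    also have "mul (der F) (pow F (Suc n)) \<gamma> + scalar (of_nat (Suc n)) * mul (der F) (pow F (Suc n)) \<gamma> =
      scalar (1 + of_nat (Suc n)) * mul (der F) (pow F (Suc n)) \<gamma>"
      by (simp only: scalar_add distrib_right scalar_1 mult_1_left)
    also have "(1 + of_nat (Suc n) :: ratfun) = of_nat (Suc (Suc n))" by simp
    finally show "der (pow F (Suc (Suc n))) \<gamma> = scalar (of_nat (Suc (Suc n))) * mul (der F) (pow F (Suc n)) \<gamma>" .
  qed
qed

lemma pow_outside: "\<gamma> \<notin> S \<Longrightarrow> pow F n \<gamma> = 0"
  using S0 by (cases n) (auto simp: mul_outside ser_one_def)

lemma pow_eq_0:
  assumes "F 0 = 0" shows "dg \<gamma> < int n \<Longrightarrow> pow F n \<gamma> = 0"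
proof (induction n arbitrary: \<gamma>)
  case 0
  then show ?case using pow_outside[of \<gamma> 0 F] dg_nonneg[of \<gamma>] by fastforce
next
  case (Suc n)
  have "mul F (pow F n) \<gamma> = 0"
  proof (rule mul_zeroI)
    fix \<alpha> \<beta> assume ab: "\<alpha> \<in> S" "\<beta> \<in> S" "\<alpha> + \<beta> = \<gamma>"
    show "\<sigma> \<alpha> \<beta> * F \<alpha> * pow F n \<beta> = 0"
    proof (cases "\<alpha> = 0")
      case False
      then have "dg \<beta> < int n" using Suc.prems dg_pos[OF ab(1)] dg_add[of \<alpha> \<beta>] ab(3) by simp
      then show ?thesis using Suc.IH by simp
    qed (simp add: assms)
  qed
  then show ?case by simp
qed

lemma ser_exp_finite:
  assumes F0: "F 0 = 0" and N: "dg \<gamma> < int N"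
  shows "ser_exp mul F \<gamma> = (\<Sum>n<N. scalar (1 / of_nat (fact n)) * pow F n \<gamma>)"
proof -
  have "{n. scalar (1 / of_nat (fact n)) * pow F n \<gamma> \<noteq> 0} \<subseteq> {..<N}"
  proof
    fix n assume "n \<in> {n. scalar (1 / of_nat (fact n)) * pow F n \<gamma> \<noteq> 0}"
    then have "pow F n \<gamma> \<noteq> 0" by auto
    then have "\<not> dg \<gamma> < int n" using pow_eq_0[of F \<gamma> n] F0 by auto
    then show "n \<in> {..<N}" using N by auto
  qed
  then show ?thesis unfolding ser_exp_def by (intro Sum_any.expand_superset) simp_all
qed

lemma ser_exp_0: "F 0 = 0 \<Longrightarrow> ser_exp mul F 0 = 1"
  using ser_exp_finite[of F 0 1] by (simp add: dg_0 ser_one_def One_nat_def)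

text \<open>
  Both sides are truncated at the degree of \<open>\<gamma>\<close>. On the right one power less is needed, since
  \<open>D F\<close> has no constant term.
\<close>

lemma ser_exp_ode:
  assumes F0: "F 0 = 0"
    and sym: "\<And>\<alpha> \<beta>. \<alpha> \<in> S \<Longrightarrow> \<beta> \<in> S \<Longrightarrow> F \<alpha> \<noteq> 0 \<Longrightarrow> F \<beta> \<noteq> 0 \<Longrightarrow> \<sigma> \<alpha> \<beta> = \<sigma> \<beta> \<alpha>"
  shows "der (ser_exp mul F) \<gamma> = mul (der F) (ser_exp mul F) \<gamma>"
proof -
  define N where "N = nat (dg \<gamma>)"
  let ?c = "\<lambda>n. scalar (1 / of_nat (fact n))"
  have c: "?c (Suc n) * scalar (of_nat (Suc n)) = ?c n" for n
  proof -
    have "1 / of_nat (fact (Suc n)) * of_nat (Suc n) = (1 / of_nat (fact n) :: ratfun)"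
      unfolding fact_Suc of_nat_mult by (simp del: of_nat_Suc)
    then show ?thesis by (simp only: scalar_mult[symmetric])
  qed
  have "der (ser_exp mul F) \<gamma> = (\<Sum>n<Suc N. ?c n * der (pow F n) \<gamma>)"
    unfolding der_def using ser_exp_finite[of F \<gamma> "Suc N", OF F0]
    by (simp add: N_def sum_distrib_left mult_ac del: sum.lessThan_Suc)
  also have "\<dots> = (\<Sum>n<N. ?c (Suc n) * der (pow F (Suc n)) \<gamma>)"
    by (subst sum.lessThan_Suc_shift) (simp add: der_one)
  also have "\<dots> = (\<Sum>n<N. ?c n * mul (der F) (pow F n) \<gamma>)"
  proof (rule sum.cong[OF refl])
    fix n
    have d: "der (pow F (Suc n)) \<gamma> = scalar (of_nat (Suc n)) * mul (der F) (pow F n) \<gamma>"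
      by (rule fun_cong[OF der_pow]) (rule sym)
    show "?c (Suc n) * der (pow F (Suc n)) \<gamma> = ?c n * mul (der F) (pow F n) \<gamma>"
      unfolding d mult.assoc[symmetric] c ..
  qed
  also have "\<dots> = mul (der F) (\<lambda>\<beta>. \<Sum>n<N. ?c n * pow F n \<beta>) \<gamma>"
    by (simp add: mul_sum mul_scale)
  also have "\<dots> = mul (der F) (ser_exp mul F) \<gamma>"
  proof (rule mul_cong)
    fix \<alpha> \<beta> assume ab: "\<alpha> \<in> S" "\<beta> \<in> S" "\<alpha> + \<beta> = \<gamma>"
    show "\<sigma> \<alpha> \<beta> * der F \<alpha> * (\<Sum>n<N. ?c n * pow F n \<beta>) = \<sigma> \<alpha> \<beta> * der F \<alpha> * ser_exp mul F \<beta>"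
    proof (cases "\<alpha> = 0")
      case False
      then have "dg \<beta> < int N" using dg_pos[OF ab(1)] dg_nonneg[OF ab(2)] dg_add[of \<alpha> \<beta>] ab(3) by (simp add: N_def)
      then show ?thesis using ser_exp_finite[of F \<beta> N, OF F0] by simp
    qed (simp add: der_def F0)
  qed
  finally show ?thesis .
qed

lemma scalar_cancel:
  assumes "k \<noteq> 0" "scalar k * a = scalar k * b" shows "a = b"
proof -
  have "scalar (1 / k) * (scalar k * c) = c" for c
    using assms(1) by (simp add: mult.assoc[symmetric] scalar_mult[symmetric])
  then show ?thesis using assms(2) by metis
qed

text \<open>
  In the equation at \<open>\<gamma>\<close> the right hand side involves \<open>E\<close> only in degrees below that of \<open>\<gamma>\<close>, and the
  factor \<open>deg \<gamma>\<close> on the left is invertible.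
\<close>

lemma ode_unique:
  assumes F0: "F 0 = 0" and 0: "E 0 = E' 0"
    and E: "\<And>\<gamma>. \<gamma> \<in> S \<Longrightarrow> der E \<gamma> = mul (der F) E \<gamma>" and E': "\<And>\<gamma>. \<gamma> \<in> S \<Longrightarrow> der E' \<gamma> = mul (der F) E' \<gamma>"
  shows "\<gamma> \<in> S \<Longrightarrow> E \<gamma> = E' \<gamma>"
proof (induction "nat (dg \<gamma>)" arbitrary: \<gamma> rule: less_induct)
  case less
  show ?case
  proof (cases "\<gamma> = 0")
    case False
    then have pos: "dg \<gamma> > 0" using dg_pos less.prems by simp
    have "mul (der F) E \<gamma> = mul (der F) E' \<gamma>"
    proof (rule mul_cong)
      fix \<alpha> \<beta> assume ab: "\<alpha> \<in> S" "\<beta> \<in> S" "\<alpha> + \<beta> = \<gamma>"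
      show "\<sigma> \<alpha> \<beta> * der F \<alpha> * E \<beta> = \<sigma> \<alpha> \<beta> * der F \<alpha> * E' \<beta>"
      proof (cases "\<alpha> = 0")
        case False
        then have "nat (dg \<beta>) < nat (dg \<gamma>)"
          using dg_pos[OF ab(1)] dg_nonneg[OF ab(2)] dg_add[of \<alpha> \<beta>] ab(3) by simp
        then show ?thesis using less.hyps ab(2) by simp
      qed (simp add: der_def F0)
    qed
    then have "scalar (of_int (dg \<gamma>)) * E \<gamma> = scalar (of_int (dg \<gamma>)) * E' \<gamma>"
      using E[OF less.prems] E'[OF less.prems] by (simp add: der_def)
    then show ?thesis using pos scalar_cancel[of "of_int (dg \<gamma>)" "E \<gamma>" "E' \<gamma>"] by simp
  qed (use 0 in simp)
qed

text \<open>
  By the differential equation, \<open>E(\<gamma>) - F(\<gamma>)\<close> is determined by the coefficients of lower degree.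
\<close>

lemma exp_injective:
  assumes F0: "F 0 = 0" "F' 0 = 0"
    and sym: "\<And>\<alpha> \<beta>. \<alpha> \<in> S \<Longrightarrow> \<beta> \<in> S \<Longrightarrow> F \<alpha> \<noteq> 0 \<Longrightarrow> F \<beta> \<noteq> 0 \<Longrightarrow> \<sigma> \<alpha> \<beta> = \<sigma> \<beta> \<alpha>"
      "\<And>\<alpha> \<beta>. \<alpha> \<in> S \<Longrightarrow> \<beta> \<in> S \<Longrightarrow> F' \<alpha> \<noteq> 0 \<Longrightarrow> F' \<beta> \<noteq> 0 \<Longrightarrow> \<sigma> \<alpha> \<beta> = \<sigma> \<beta> \<alpha>"
    and \<gamma>: "\<gamma> \<in> S" "\<gamma> \<noteq> 0"
    and lower: "\<And>\<alpha>. \<alpha> \<in> S \<Longrightarrow> dg \<alpha> < dg \<gamma> \<Longrightarrow> F \<alpha> = F' \<alpha> \<and> ser_exp mul F \<alpha> = ser_exp mul F' \<alpha>"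
  shows "ser_exp mul F \<gamma> = ser_exp mul F' \<gamma> \<longleftrightarrow> F \<gamma> = F' \<gamma>"
proof -
  let ?E = "ser_exp mul F" and ?E' = "ser_exp mul F'"
  let ?R = "\<lambda>G E. \<Sum>(\<alpha>, \<beta>)\<in>dec \<gamma> - {(\<gamma>, 0)}. \<sigma> \<alpha> \<beta> * der G \<alpha> * E \<beta>"
  have pos: "dg \<gamma> > 0" using \<gamma> dg_pos by blast
  have split: "mul (der G) E \<gamma> = scalar (of_int (dg \<gamma>)) * G \<gamma> + ?R G E" if "E 0 = 1" for G E
    unfolding ser_mult_def using \<gamma> S0 that
    by (subst sum.remove[OF finite_dec, of "(\<gamma>, 0)"]) (simp_all add: \<sigma>_0 der_def)
  have R: "?R F ?E = ?R F' ?E'"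
  proof (intro sum.cong refl)
    fix p assume p: "p \<in> dec \<gamma> - {(\<gamma>, 0)}"
    obtain \<alpha> \<beta> where ab: "p = (\<alpha>, \<beta>)" "\<alpha> \<in> S" "\<beta> \<in> S" "\<gamma> = \<alpha> + \<beta>" using p by auto
    have "\<sigma> \<alpha> \<beta> * der F \<alpha> * ?E \<beta> = \<sigma> \<alpha> \<beta> * der F' \<alpha> * ?E' \<beta>"
    proof (cases "\<alpha> = 0")
      case False
      have "\<beta> \<noteq> 0" using ab p by auto
      then have "dg \<alpha> < dg \<gamma>" "dg \<beta> < dg \<gamma>" using False ab dg_pos dg_add by simp_all
      then show ?thesis using lower ab by (simp add: der_def)
    qed (simp add: der_def F0)
    then show "(case p of (\<alpha>, \<beta>) \<Rightarrow> \<sigma> \<alpha> \<beta> * der F \<alpha> * ?E \<beta>) = (case p of (\<alpha>, \<beta>) \<Rightarrow> \<sigma> \<alpha> \<beta> * der F' \<alpha> * ?E' \<beta>)"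
      by (simp add: ab(1))
  qed
  have "scalar (of_int (dg \<gamma>)) * ?E \<gamma> = scalar (of_int (dg \<gamma>)) * F \<gamma> + ?R F ?E"
    using ser_exp_ode[of F \<gamma>, OF F0(1) sym(1)] split[of ?E F] ser_exp_0[of F, OF F0(1)] by (simp add: der_def)
  moreover have "scalar (of_int (dg \<gamma>)) * ?E' \<gamma> = scalar (of_int (dg \<gamma>)) * F' \<gamma> + ?R F ?E"
    unfolding R using ser_exp_ode[of F' \<gamma>, OF F0(2) sym(2)] split[of ?E' F'] ser_exp_0[of F', OF F0(2)] by (simp add: der_def)
  moreover have cancel: "scalar (of_int (dg \<gamma>)) * a = scalar (of_int (dg \<gamma>)) * b \<longleftrightarrow> a = b" for a b
    using scalar_cancel[of "of_int (dg \<gamma>)" a b] pos by auto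
  ultimately have "?E \<gamma> = ?E' \<gamma> \<longleftrightarrow> scalar (of_int (dg \<gamma>)) * F \<gamma> + ?R F ?E = scalar (of_int (dg \<gamma>)) * F' \<gamma> + ?R F ?E"
    by (simp only: cancel[symmetric, of "?E \<gamma>"])
  then show ?thesis by (simp only: add_right_cancel cancel)
qed

end

section \<open>From multiplicities to the quantum torus\<close>

context positive_lattice
begin

abbreviation \<tau> :: "'g \<Rightarrow> 'g \<Rightarrow> motive" where
  "\<tau> \<alpha> \<beta> \<equiv> scalar (qhalf powi form \<Gamma> \<alpha> \<beta>)"

abbreviation \<tau>m :: "('g \<Rightarrow>\<^sub>0 nat) \<Rightarrow> ('g \<Rightarrow>\<^sub>0 nat) \<Rightarrow> motive" where
  "\<tau>m m n \<equiv> \<tau> (mnorm m) (mnorm n)"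

abbreviation mdeg :: "('g \<Rightarrow>\<^sub>0 nat) \<Rightarrow> int" where
  "mdeg m \<equiv> deg (mnorm m)"

lemma \<tau>_bimult: "\<tau> (\<alpha> + \<beta>) \<gamma> = \<tau> \<alpha> \<gamma> * \<tau> \<beta> \<gamma>" "\<tau> \<alpha> (\<beta> + \<gamma>) = \<tau> \<alpha> \<beta> * \<tau> \<alpha> \<gamma>"
  "\<tau> 0 \<alpha> = 1" "\<tau> \<alpha> 0 = 1"
  using qhalf_nz(1) by (simp_all add: form_add_left form_add_right power_int_add scalar_mult)

lemma mults_0 [simp]: "0 \<in> mults \<Gamma>" by (simp add: mults_def)

lemma mults_add_iff: "m + n \<in> mults \<Gamma> \<longleftrightarrow> m \<in> mults \<Gamma> \<and> n \<in> mults \<Gamma>"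
  by (auto simp: mults_def keys_add_nat)

lemma mults_unit_iff: "unit \<alpha> \<in> mults \<Gamma> \<longleftrightarrow> \<alpha> \<in> Gplus_nz \<Gamma>"
  by (simp add: mults_def)

lemma mnorm_Gplus: "m \<in> mults \<Gamma> \<Longrightarrow> mnorm m \<in> Gplus \<Gamma>"
proof (induction m rule: mult_induct)
  case (add m \<alpha>)
  then show ?case by (auto simp: mults_add_iff mults_unit_iff mnorm_add intro: Gplus_add)
qed simp

lemma mults_cases:
  assumes "m \<in> mults \<Gamma>" "m \<noteq> 0"
  obtains n \<alpha> where "m = n + unit \<alpha>" "n \<in> mults \<Gamma>" "\<alpha> \<in> Gplus_nz \<Gamma>"
proof -
  obtain \<alpha> where a: "\<alpha> \<in> Poly_Mapping.keys m" using assms(2) by (metis all_not_in_conv keys_eq_empty)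
  show thesis
    by (rule that[of "m - unit \<alpha>" \<alpha>]) (use split_unit[OF a] assms(1) in \<open>metis mults_add_iff mults_unit_iff\<close>)+
qed

lemma mnorm_nz: "m \<in> mults \<Gamma> \<Longrightarrow> m \<noteq> 0 \<Longrightarrow> mnorm m \<in> Gplus_nz \<Gamma>"
  by (erule (1) mults_cases) (metis mnorm_add mnorm_unit mnorm_Gplus Gplus_nz_add add.commute)

lemma finite_mults_bounded: "finite {m \<in> mults \<Gamma>. mdeg m \<le> int k}"
proof (induction k)
  case 0
  have "{m \<in> mults \<Gamma>. mdeg m \<le> int 0} \<subseteq> {0}"
    using mnorm_nz deg_pos by force
  then show ?case by (rule finite_subset) simp
next
  case (Suc k)
  let ?A = "{m \<in> mults \<Gamma>. mdeg m \<le> int k}" and ?B = "{\<alpha> \<in> Gplus \<Gamma>. deg \<alpha> \<le> int (Suc k)}"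
  have "{m \<in> mults \<Gamma>. mdeg m \<le> int (Suc k)} \<subseteq> insert 0 ((\<lambda>(n, \<alpha>). n + unit \<alpha>) ` (?A \<times> ?B))"
  proof
    fix m assume m: "m \<in> {m \<in> mults \<Gamma>. mdeg m \<le> int (Suc k)}"
    show "m \<in> insert 0 ((\<lambda>(n, \<alpha>). n + unit \<alpha>) ` (?A \<times> ?B))"
    proof (cases "m = 0")
      case False
      then obtain n \<alpha> where n: "m = n + unit \<alpha>" "n \<in> mults \<Gamma>" "\<alpha> \<in> Gplus_nz \<Gamma>"
        using m mults_cases by blast
      have "mdeg m = mdeg n + deg \<alpha>" by (simp add: n(1) mnorm_add deg_add)
      moreover have "deg \<alpha> > 0" "mdeg n \<ge> 0" using n deg_pos deg_nonneg[OF mnorm_Gplus] by auto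
      ultimately have "(n, \<alpha>) \<in> ?A \<times> ?B" using n m by auto
      then show ?thesis unfolding n(1) by (intro insertI2 image_eqI[of _ _ "(n, \<alpha>)"]) simp_all
    qed simp
  qed
  moreover have "finite (insert 0 ((\<lambda>(n, \<alpha>). n + unit \<alpha>) ` (?A \<times> ?B)))"
    by (intro finite.insertI finite_imageI finite_cartesian_product Suc.IH finite_Gplus_bounded)
  ultimately show ?case by (rule finite_subset)
qed

definition fibre :: "'g \<Rightarrow> ('g \<Rightarrow>\<^sub>0 nat) set" where
  "fibre \<gamma> = {m \<in> mults \<Gamma>. mnorm m = \<gamma>}"

lemma finite_fibre: "finite (fibre \<gamma>)"
proof (rule finite_subset)
  show "fibre \<gamma> \<subseteq> {m \<in> mults \<Gamma>. mdeg m \<le> int (nat (deg \<gamma>))}" by (auto simp: fibre_def)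
qed (rule finite_mults_bounded)

lemma dec_mults: "m \<in> mults \<Gamma> \<Longrightarrow> {(a, b). a \<in> mults \<Gamma> \<and> b \<in> mults \<Gamma> \<and> a + b = m} = decomp m"
  by (auto simp: mults_add_iff)

lemma finite_dec_mults: "finite {(a, b). a \<in> mults \<Gamma> \<and> b \<in> mults \<Gamma> \<and> a + b = m}"
  by (rule finite_subset[OF _ finite_decomp[of m]]) auto

sublocale T: graded_series "Gplus \<Gamma>" \<tau> deg
  by unfold_locales
    (simp_all add: Gplus_add finite_decompositions deg_add deg_nonneg deg_eq_0 \<tau>_bimult)

sublocale M: graded_series "mults \<Gamma>" \<tau>m mdeg
proof unfold_locales
  fix m assume "m \<in> mults \<Gamma>" "mdeg m = 0"
  then show "m = 0" using mnorm_nz[of m] deg_pos[of "mnorm m"] by (cases "m = 0") auto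
qed (simp_all add: mults_add_iff finite_dec_mults mnorm_add deg_add deg_nonneg mnorm_Gplus \<tau>_bimult)

sublocale M1: graded_series "mults \<Gamma>" "\<lambda>_ _. 1" mdeg
  by unfold_locales
    (simp_all add: mults_add_iff finite_dec_mults mnorm_add deg_add deg_nonneg mnorm_Gplus M.dg_eq_0)

lemma torus_mult_eq: "torus_mult \<Gamma> = T.mul"
  by (simp add: torus_mult_def)

definition mpow :: "('g \<Rightarrow> motive) \<Rightarrow> ('g \<Rightarrow>\<^sub>0 nat) \<Rightarrow> motive" where
  "mpow \<Omega> m = (\<Prod>\<alpha>\<in>Poly_Mapping.keys m. \<Omega> \<alpha> ^ Poly_Mapping.lookup m \<alpha>)"

lemma mpow_0 [simp]: "mpow \<Omega> 0 = 1" and mpow_unit [simp]: "mpow \<Omega> (unit \<alpha>) = \<Omega> \<alpha>"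
  by (simp_all add: mpow_def)

lemma mpow_add: "mpow \<Omega> (m + n) = mpow \<Omega> m * mpow \<Omega> n"
proof -
  let ?S = "Poly_Mapping.keys m \<union> Poly_Mapping.keys n"
  have "mpow \<Omega> k = (\<Prod>\<alpha>\<in>?S. \<Omega> \<alpha> ^ Poly_Mapping.lookup k \<alpha>)" if "Poly_Mapping.keys k \<subseteq> ?S" for k
    unfolding mpow_def using that prod_keys_superset[of "\<lambda>\<alpha> k. \<Omega> \<alpha> ^ k" ?S k] by simp
  then show ?thesis by (simp add: keys_add_nat lookup_add power_add prod.distrib)
qed

text \<open>
  The substitution of \<open>\<Omega>\<^sub>\<alpha> x\<^sup>\<alpha>\<close> for the variable \<open>x\<^sub>\<alpha>\<close>.
\<close>

definition specialize :: "('g \<Rightarrow> motive) \<Rightarrow> (('g \<Rightarrow>\<^sub>0 nat) \<Rightarrow> motive) \<Rightarrow> 'g \<Rightarrow> motive" where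
  "specialize \<Omega> F \<gamma> = (\<Sum>m\<in>fibre \<gamma>. F m * mpow \<Omega> m)"

lemma specialize_cong: "(\<And>m. m \<in> mults \<Gamma> \<Longrightarrow> mnorm m = \<gamma> \<Longrightarrow> F m = G m) \<Longrightarrow> specialize \<Omega> F \<gamma> = specialize \<Omega> G \<gamma>"
  unfolding specialize_def by (intro sum.cong refl) (auto simp: fibre_def)

lemma specialize_scale: "specialize \<Omega> (\<lambda>m. c * F m) \<gamma> = c * specialize \<Omega> F \<gamma>"
  unfolding specialize_def sum_distrib_left by (intro sum.cong refl) (simp only: mult_ac)

lemma specialize_sum: "specialize \<Omega> (\<lambda>m. \<Sum>n\<in>N. F n m) \<gamma> = (\<Sum>n\<in>N. specialize \<Omega> (F n) \<gamma>)"
  unfolding specialize_def sum_distrib_right by (rule sum.swap)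

lemma fibre_0: "fibre 0 = {0}"
  using mnorm_nz by (fastforce simp: fibre_def)

lemma specialize_one: "specialize \<Omega> ser_one = ser_one"
proof
  fix \<gamma>
  show "specialize \<Omega> ser_one \<gamma> = ser_one \<gamma>"
  proof (cases "\<gamma> = 0")
    case True
    then show ?thesis by (simp add: specialize_def fibre_0 ser_one_def)
  next
    case False
    then show ?thesis unfolding specialize_def by (subst sum.neutral) (auto simp: fibre_def ser_one_def)
  qed
qed

text \<open>
  Pairs of multiplicities correspond to pairs of classes with a multiplicity over each of them.
\<close>

lemma specialize_mul: "specialize \<Omega> (M.mul F G) = T.mul (specialize \<Omega> F) (specialize \<Omega> G)"
proof
  fix \<gamma>
  let ?t = "\<lambda>q. \<tau>m (fst q) (snd q) * F (fst q) * G (snd q) * (mpow \<Omega> (fst q) * mpow \<Omega> (snd q))"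
  have "specialize \<Omega> (M.mul F G) \<gamma> = (\<Sum>m\<in>fibre \<gamma>. \<Sum>q\<in>M.dec m. ?t q)"
    unfolding specialize_def M.mul_eq sum_distrib_right
    by (intro sum.cong refl) (auto simp: mpow_add)
  also have "\<dots> = (\<Sum>(m, q)\<in>Sigma (fibre \<gamma>) M.dec. ?t q)"
    by (rule sum.Sigma[OF finite_fibre]) (simp add: finite_dec_mults)
  also have "\<dots> = (\<Sum>(p, q)\<in>Sigma (T.dec \<gamma>) (\<lambda>p. fibre (fst p) \<times> fibre (snd p)). ?t q)"
    by (rule sum.reindex_bij_witness[of _ "\<lambda>(p, q). (fst q + snd q, q)" "\<lambda>(m, q). ((mnorm (fst q), mnorm (snd q)), q)"])
      (auto simp: fibre_def mults_add_iff mnorm_add mnorm_Gplus)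
  also have "\<dots> = (\<Sum>p\<in>T.dec \<gamma>. \<Sum>q\<in>fibre (fst p) \<times> fibre (snd p). ?t q)"
    by (rule sum.Sigma[symmetric, OF finite_decompositions]) (simp add: finite_fibre)
  also have "\<dots> = (\<Sum>p\<in>T.dec \<gamma>. \<tau> (fst p) (snd p) * specialize \<Omega> F (fst p) * specialize \<Omega> G (snd p))"
  proof (rule sum.cong[OF refl])
    fix p
    have "(\<Sum>q\<in>fibre (fst p) \<times> fibre (snd p). ?t q) = (\<Sum>m\<in>fibre (fst p). \<Sum>n\<in>fibre (snd p). ?t (m, n))"
      by (simp add: sum.cartesian_product case_prod_unfold)
    also have "\<dots> = (\<Sum>m\<in>fibre (fst p). \<Sum>n\<in>fibre (snd p). \<tau> (fst p) (snd p) * (F m * mpow \<Omega> m) * (G n * mpow \<Omega> n))"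
      by (intro sum.cong refl) (simp add: fibre_def mult_ac)
    also have "\<dots> = \<tau> (fst p) (snd p) * specialize \<Omega> F (fst p) * specialize \<Omega> G (snd p)"
      unfolding specialize_def by (simp only: sum_distrib_left[symmetric] sum_distrib_right[symmetric])
    finally show "(\<Sum>q\<in>fibre (fst p) \<times> fibre (snd p). ?t q) = \<tau> (fst p) (snd p) * specialize \<Omega> F (fst p) * specialize \<Omega> G (snd p)" .
  qed
  also have "\<dots> = T.mul (specialize \<Omega> F) (specialize \<Omega> G) \<gamma>" by (rule T.mul_eq[symmetric])
  finally show "specialize \<Omega> (M.mul F G) \<gamma> = T.mul (specialize \<Omega> F) (specialize \<Omega> G) \<gamma>" .
qed

definition ray_supported :: "'g \<Rightarrow> (('g \<Rightarrow>\<^sub>0 nat) \<Rightarrow> motive) \<Rightarrow> bool" where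
  "ray_supported d F \<longleftrightarrow> (\<forall>m\<in>mults \<Gamma>. F m \<noteq> 0 \<longrightarrow> form \<Gamma> d (mnorm m) = 0)"

lemma ray_supported_pow:
  assumes "ray_supported d F" shows "ray_supported d (M1.pow F n)"
proof (induction n)
  case 0
  then show ?case by (simp add: ray_supported_def ser_one_def)
next
  case (Suc n)
  show ?case
    unfolding ray_supported_def
  proof (intro ballI impI, rule ccontr)
    fix m assume m: "m \<in> mults \<Gamma>" "M1.pow F (Suc n) m \<noteq> 0" "form \<Gamma> d (mnorm m) \<noteq> 0"
    have "M1.mul F (M1.pow F n) m = 0"
    proof (rule M1.mul_zeroI)
      fix a b assume ab: "a \<in> mults \<Gamma>" "b \<in> mults \<Gamma>" "a + b = m"
      then have "form \<Gamma> d (mnorm a) \<noteq> 0 \<or> form \<Gamma> d (mnorm b) \<noteq> 0"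
        using m(3) by (auto simp: mnorm_add form_add_right)
      then have "F a = 0 \<or> M1.pow F n b = 0"
        using assms Suc.IH ab unfolding ray_supported_def by blast
      then show "1 * F a * M1.pow F n b = 0" by auto
    qed
    with m(2) show False by simp
  qed
qed

lemma form_parallel:
  assumes "d \<in> Gplus_nz \<Gamma>" "\<alpha> \<in> Gplus \<Gamma>" "\<beta> \<in> Gplus \<Gamma>" "form \<Gamma> d \<alpha> = 0" "form \<Gamma> d \<beta> = 0"
  shows "form \<Gamma> \<alpha> \<beta> = 0"
  using form_cocycle[of \<alpha> d \<beta>] assms deg_pos[OF assms(1)] form_skew[of \<alpha> d] by simp

lemma mul_ray_supported:
  assumes d: "d \<in> Gplus_nz \<Gamma>" and "ray_supported d F" "ray_supported d G"
  shows "M1.mul F G m = M.mul F G m"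
  unfolding M1.mul_eq M.mul_eq
proof (rule sum.cong[OF refl])
  fix q assume "q \<in> M1.dec m"
  then have q: "fst q \<in> mults \<Gamma>" "snd q \<in> mults \<Gamma>" by auto
  show "1 * F (fst q) * G (snd q) = \<tau>m (fst q) (snd q) * F (fst q) * G (snd q)"
  proof (cases "F (fst q) = 0 \<or> G (snd q) = 0")
    case False
    then have "form \<Gamma> (mnorm (fst q)) (mnorm (snd q)) = 0"
      using assms q mnorm_Gplus form_parallel[OF d] unfolding ray_supported_def by blast
    then show ?thesis by simp
  qed auto
qed

text \<open>
  The invariants \<open>g(m)\<close> are defined by an exponential without twist. On a ray the twist is trivial,
  so there the substitution is multiplicative for this product as well.
\<close>

lemma specialize_exp:
  assumes d: "d \<in> Gplus_nz \<Gamma>" and F: "ray_supported d F" and F0: "F 0 = 0"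
  shows "specialize \<Omega> (ser_exp M1.mul F) = ser_exp T.mul (specialize \<Omega> F)"
proof
  fix \<gamma>
  have pow: "specialize \<Omega> (M1.pow F n) = T.pow (specialize \<Omega> F) n" for n
  proof (induction n)
    case (Suc n)
    have "M1.mul F (M1.pow F n) = M.mul F (M1.pow F n)"
      using mul_ray_supported[OF d F ray_supported_pow[OF F]] by blast
    then show ?case using Suc.IH by (simp add: specialize_mul)
  qed (simp add: specialize_one)
  have P0: "specialize \<Omega> F 0 = 0" by (simp add: specialize_def fibre_0 F0)
  define N where "N = nat (deg \<gamma>) + 1"
  have N: "deg \<gamma> < int N" by (simp add: N_def)
  have "specialize \<Omega> (ser_exp M1.mul F) \<gamma> = specialize \<Omega> (\<lambda>m. \<Sum>n<N. scalar (1 / of_nat (fact n)) * M1.pow F n m) \<gamma>"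
    using N by (intro specialize_cong M1.ser_exp_finite F0) simp
  also have "\<dots> = (\<Sum>n<N. scalar (1 / of_nat (fact n)) * T.pow (specialize \<Omega> F) n \<gamma>)"
    by (simp only: specialize_sum specialize_scale pow)
  also have "\<dots> = ser_exp T.mul (specialize \<Omega> F) \<gamma>"
    using T.ser_exp_finite[of "specialize \<Omega> F", OF P0 N] by simp
  finally show "specialize \<Omega> (ser_exp M1.mul F) \<gamma> = ser_exp T.mul (specialize \<Omega> F) \<gamma>" .
qed

end

section \<open>The factor of a ray\<close>

context positive_lattice
begin

abbreviation \<kappa> :: ratfun where "\<kappa> \<equiv> 1 / (qhalf - 1 / qhalf)"

lemma in_ray_iff':
  assumes "d \<in> Gplus_nz \<Gamma>"
  shows "plane \<Gamma> \<gamma> \<in> ray d \<longleftrightarrow> \<gamma> \<in> Gplus_nz \<Gamma> \<and> form \<Gamma> d \<gamma> = 0"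
proof -
  have "form \<Gamma> d \<gamma> = 0 \<longleftrightarrow> form \<Gamma> \<gamma> d = 0" using form_skew[of d \<gamma>] by linarith
  then show ?thesis using in_ray_iff[OF _ assms, of \<gamma>] in_ray_Gplus_nz[OF assms, of \<gamma>] by blast
qed

lemma form_zmult_right: "form \<Gamma> z (zmult k x) = k * form \<Gamma> z x"
  using additive_zmult[of "\<lambda>x. form \<Gamma> z x" k x] by (simp add: form_add_right zmult_int)

lemma deg_zmult: "deg (zmult k x) = k * deg x"
  using additive_zmult[of deg k x] by (simp add: deg_add zmult_int)

lemma deg_sum: "deg (sum f A) = (\<Sum>a\<in>A. deg (f a))"
  by (induction A rule: infinite_finite_induct) (simp_all add: deg_add)

lemma form_mnorm: "form \<Gamma> z (mnorm m) = (\<Sum>\<alpha>\<in>Poly_Mapping.keys m. int (Poly_Mapping.lookup m \<alpha>) * form \<Gamma> z \<alpha>)"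
  unfolding mnorm_def form_sum_right form_zmult_right ..

lemma mdeg_eq: "mdeg m = (\<Sum>\<alpha>\<in>Poly_Mapping.keys m. int (Poly_Mapping.lookup m \<alpha>) * deg \<alpha>)"
  unfolding mnorm_def deg_sum deg_zmult ..

text \<open>
  The sum of \<open>x\<^sub>\<alpha> / (v - v\<^sup>-\<^sup>1)\<close> over the classes \<open>\<alpha>\<close> on the ray of \<open>d\<close>.
\<close>

definition generators :: "'g \<Rightarrow> ('g \<Rightarrow>\<^sub>0 nat) \<Rightarrow> motive" where
  "generators d m = (if \<exists>\<alpha>. m = unit \<alpha> \<and> form \<Gamma> d \<alpha> = 0 then scalar \<kappa> else 0)"

definition exp_generators :: "'g \<Rightarrow> ('g \<Rightarrow>\<^sub>0 nat) \<Rightarrow> motive" where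
  "exp_generators d m = (if \<forall>\<alpha>\<in>Poly_Mapping.keys m. form \<Gamma> d \<alpha> = 0
     then scalar (\<kappa> ^ mcard m / of_nat (mfact m)) else 0)"

lemma unit_nz: "unit \<alpha> \<noteq> 0"
proof
  assume "unit \<alpha> = 0"
  then have "Poly_Mapping.lookup (unit \<alpha>) \<alpha> = Poly_Mapping.lookup 0 \<alpha>" by simp
  then show False by simp
qed

lemma generators_0: "generators d 0 = 0"
  by (simp add: generators_def unit_nz unit_nz[symmetric])

lemma unit_inject:
  assumes "unit \<alpha> = unit \<beta>" shows "\<alpha> = \<beta>"
  using arg_cong[OF assms, of Poly_Mapping.keys] by simp

lemma generators_unit: "generators d (unit \<alpha>) = (if form \<Gamma> d \<alpha> = 0 then scalar \<kappa> else 0)"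
  by (auto simp: generators_def dest: unit_inject)

lemma generators_ray_supported: "ray_supported d (generators d)"
  unfolding ray_supported_def generators_def by auto

text \<open>
  The coefficient of the right hand side at \<open>m\<close> is a sum over the classes \<open>\<alpha>\<close> of \<open>m\<close>. As
  \<open>1 / (m - \<alpha>)! = m(\<alpha>) / m!\<close>, the term of \<open>\<alpha>\<close> is \<open>m(\<alpha>) deg \<alpha>\<close> times the coefficient of \<open>E\<close> at \<open>m\<close>, and
  these factors add up to the degree of \<open>m\<close>.
\<close>

lemma exp_generators_ode:
  assumes m: "m \<in> mults \<Gamma>"
  shows "M1.der (exp_generators d) m = M1.mul (M1.der (generators d)) (exp_generators d) m"
proof -
  let ?K = "Poly_Mapping.keys m"
  let ?t = "\<lambda>\<alpha>. scalar (of_int (deg \<alpha>)) * generators d (unit \<alpha>) * exp_generators d (m - unit \<alpha>)"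
  have "M1.mul (M1.der (generators d)) (exp_generators d) m =
      (\<Sum>q\<in>(\<lambda>\<alpha>. (unit \<alpha>, m - unit \<alpha>)) ` ?K. 1 * M1.der (generators d) (fst q) * exp_generators d (snd q))"
    unfolding M1.mul_eq
  proof (rule sum.mono_neutral_right[OF finite_dec_mults])
    show "(\<lambda>\<alpha>. (unit \<alpha>, m - unit \<alpha>)) ` ?K \<subseteq> M1.dec m"
    proof
      fix q assume "q \<in> (\<lambda>\<alpha>. (unit \<alpha>, m - unit \<alpha>)) ` ?K"
      then obtain \<alpha> where a: "\<alpha> \<in> ?K" "q = (unit \<alpha>, m - unit \<alpha>)" by blast
      then have "unit \<alpha> + (m - unit \<alpha>) = m" using split_unit[OF a(1)] by (simp add: add.commute)
      then show "q \<in> M1.dec m" using m a(2) mults_add_iff[of "unit \<alpha>" "m - unit \<alpha>"] by simp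
    qed
    show "\<forall>q\<in>M1.dec m - (\<lambda>\<alpha>. (unit \<alpha>, m - unit \<alpha>)) ` ?K. 1 * M1.der (generators d) (fst q) * exp_generators d (snd q) = 0"
    proof
      fix q assume q: "q \<in> M1.dec m - (\<lambda>\<alpha>. (unit \<alpha>, m - unit \<alpha>)) ` ?K"
      have "generators d (fst q) = 0"
      proof (rule ccontr)
        assume "generators d (fst q) \<noteq> 0"
        then obtain \<alpha> where \<alpha>: "fst q = unit \<alpha>" unfolding generators_def by meson
        then have m': "m = unit \<alpha> + snd q" using q by auto
        then have "\<alpha> \<in> ?K" by (simp add: keys_add_nat)
        moreover have "snd q = m - unit \<alpha>" unfolding m' by simp
        with \<alpha> have "q = (unit \<alpha>, m - unit \<alpha>)" by (cases q) simp
        ultimately show False using q by blast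
      qed
      then show "1 * M1.der (generators d) (fst q) * exp_generators d (snd q) = 0" by (simp add: M1.der_def)
    qed
  qed
  also have "\<dots> = (\<Sum>\<alpha>\<in>?K. ?t \<alpha>)"
  proof -
    have "inj_on (\<lambda>\<alpha>. (unit \<alpha>, m - unit \<alpha>)) ?K"
    proof (rule inj_onI)
      fix \<alpha> \<beta> assume "(unit \<alpha>, m - unit \<alpha>) = (unit \<beta>, m - unit \<beta>)"
      then have "unit \<alpha> = unit \<beta>" by (rule Pair_inject)
      then show "\<alpha> = \<beta>" by (rule unit_inject)
    qed
    then show ?thesis by (simp add: sum.reindex M1.der_def)
  qed
  also have "\<dots> = M1.der (exp_generators d) m"
  proof (cases "\<forall>\<alpha>\<in>?K. form \<Gamma> d \<alpha> = 0")
    case True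
    have "?t \<alpha> = scalar (of_int (int (Poly_Mapping.lookup m \<alpha>) * deg \<alpha>)) * scalar (\<kappa> ^ mcard m / of_nat (mfact m))"
      if a: "\<alpha> \<in> ?K" for \<alpha>
    proof -
      define n where "n = m - unit \<alpha>"
      have mn: "m = n + unit \<alpha>" unfolding n_def by (rule split_unit[OF a])
      have l: "Poly_Mapping.lookup m \<alpha> = Suc (Poly_Mapping.lookup n \<alpha>)"
        unfolding mn by (simp add: lookup_add)
      have c: "mcard m = Suc (mcard n)" unfolding mn by (simp add: mcard_add)
      have f: "mfact m = Poly_Mapping.lookup m \<alpha> * mfact n"
        unfolding l unfolding mn by (rule mfact_add_unit)
      have "Poly_Mapping.keys n \<subseteq> ?K" unfolding mn by (auto simp: keys_add_nat)
      then have "\<forall>\<alpha>\<in>Poly_Mapping.keys n. form \<Gamma> d \<alpha> = 0" using True by blast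
      then have e: "exp_generators d n = scalar (\<kappa> ^ mcard n / of_nat (mfact n))"
        unfolding exp_generators_def by (rule if_P)
      have g: "generators d (unit \<alpha>) = scalar \<kappa>" using True a by (simp add: generators_unit)
      have "of_int (deg \<alpha>) * \<kappa> * (\<kappa> ^ mcard n / of_nat (mfact n)) =
        of_int (int (Poly_Mapping.lookup m \<alpha>) * deg \<alpha>) * (\<kappa> ^ mcard m / of_nat (mfact m))"
      proof -
        have nz: "of_nat (Poly_Mapping.lookup m \<alpha>) \<noteq> (0 :: ratfun)" using a by (simp add: in_keys_iff)
        have "x * y * (y ^ j / F) = l * x * (y ^ Suc j / (l * F))" if "l \<noteq> 0" for x y F l :: ratfun and j
          using that by simp
        from this[OF nz] show ?thesis
          unfolding c f of_nat_mult of_int_mult of_int_of_nat_eq by blast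
      qed
      then show ?thesis unfolding n_def[symmetric] e g by (simp only: scalar_mult[symmetric])
    qed
    then have "(\<Sum>\<alpha>\<in>?K. ?t \<alpha>) = (\<Sum>\<alpha>\<in>?K. scalar (of_int (int (Poly_Mapping.lookup m \<alpha>) * deg \<alpha>))) * scalar (\<kappa> ^ mcard m / of_nat (mfact m))"
      unfolding sum_distrib_right by (intro sum.cong refl)
    also have "(\<Sum>\<alpha>\<in>?K. scalar (of_int (int (Poly_Mapping.lookup m \<alpha>) * deg \<alpha>))) = scalar (of_int (mdeg m))"
      unfolding mdeg_eq of_int_sum scalar_sum ..
    finally show ?thesis using True by (simp add: M1.der_def exp_generators_def)
  next
    case False
    then obtain \<beta> where \<beta>: "\<beta> \<in> ?K" "form \<Gamma> d \<beta> \<noteq> 0" by blast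
    have "?t \<alpha> = 0" if a: "\<alpha> \<in> ?K" for \<alpha>
    proof (cases "form \<Gamma> d \<alpha> = 0")
      case True
      then have "\<beta> \<noteq> \<alpha>" using \<beta> by auto
      then have "\<beta> \<in> Poly_Mapping.keys (m - unit \<alpha>)"
        using \<beta>(1) by (simp add: in_keys_iff lookup_minus lookup_single when_def)
      then have "exp_generators d (m - unit \<alpha>) = 0"
        unfolding exp_generators_def using \<beta>(2) by (intro if_not_P) blast
      then show ?thesis by simp
    qed (simp add: generators_unit)
    then have "(\<Sum>\<alpha>\<in>?K. ?t \<alpha>) = 0" by (rule sum.neutral[OF ballI])
    then show ?thesis using False by (auto simp: M1.der_def exp_generators_def)
  qed
  finally show ?thesis ..
qed

lemma exp_generators_eq:
  assumes "m \<in> mults \<Gamma>" shows "exp_generators d m = ser_exp M1.mul (generators d) m"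
proof (rule M1.ode_unique[of "generators d", OF generators_0 _ _ _ assms])
  show "exp_generators d 0 = ser_exp M1.mul (generators d) 0"
    using M1.ser_exp_0[of "generators d", OF generators_0] by (simp add: exp_generators_def)
  show "M1.der (exp_generators d) m = M1.mul (M1.der (generators d)) (exp_generators d) m" if "m \<in> mults \<Gamma>" for m
    by (rule exp_generators_ode[OF that])
  show "M1.der (ser_exp M1.mul (generators d)) m = M1.mul (M1.der (generators d)) (ser_exp M1.mul (generators d)) m" for m
    by (rule M1.ser_exp_ode[of "generators d", OF generators_0]) simp
qed

lemma specialize_generators:
  assumes d: "d \<in> Gplus_nz \<Gamma>"
  shows "specialize \<Omega> (generators d) \<gamma> = (if plane \<Gamma> \<gamma> \<in> ray d then scalar \<kappa> * \<Omega> \<gamma> else 0)"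
proof -
  have "specialize \<Omega> (generators d) \<gamma> = (\<Sum>m\<in>fibre \<gamma>. if m = unit \<gamma> then generators d (unit \<gamma>) * \<Omega> \<gamma> else 0)"
    unfolding specialize_def
  proof (rule sum.cong[OF refl])
    fix m assume m: "m \<in> fibre \<gamma>"
    show "generators d m * mpow \<Omega> m = (if m = unit \<gamma> then generators d (unit \<gamma>) * \<Omega> \<gamma> else 0)"
    proof (cases "m = unit \<gamma>")
      case False
      have "generators d m = 0"
      proof (rule ccontr)
        assume "generators d m \<noteq> 0"
        then obtain \<alpha> where "m = unit \<alpha>" unfolding generators_def by (auto split: if_splits)
        with m False show False by (auto simp: fibre_def)
      qed
      with False show ?thesis by simp
    qed simp
  qed
  also have "\<dots> = (if unit \<gamma> \<in> fibre \<gamma> then generators d (unit \<gamma>) * \<Omega> \<gamma> else 0)"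
    by (rule sum.delta[OF finite_fibre])
  also have "\<dots> = (if plane \<Gamma> \<gamma> \<in> ray d then scalar \<kappa> * \<Omega> \<gamma> else 0)"
    using in_ray_iff'[OF d, of \<gamma>] by (auto simp: fibre_def mults_unit_iff generators_unit)
  finally show ?thesis .
qed

lemma ray_factor_generators:
  assumes d: "d \<in> Gplus_nz \<Gamma>" shows "ray_factor \<Gamma> \<Omega> (ray d) = specialize \<Omega> (exp_generators d)"
proof -
  have "ray_factor \<Gamma> \<Omega> (ray d) = ser_exp T.mul (specialize \<Omega> (generators d))"
    unfolding ray_factor_def torus_mult_eq using specialize_generators[OF d, of \<Omega>] by (intro arg_cong[of _ _ "ser_exp T.mul"] ext) simp
  also have "\<dots> = specialize \<Omega> (ser_exp M1.mul (generators d))"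
    by (rule specialize_exp[symmetric, OF d generators_ray_supported generators_0])
  also have "\<dots> = specialize \<Omega> (exp_generators d)"
    by (intro ext specialize_cong exp_generators_eq[symmetric])
  finally show ?thesis .
qed

definition f_series :: "int \<Rightarrow> 'g \<Rightarrow> ('g \<Rightarrow>\<^sub>0 nat) \<Rightarrow> motive" where
  "f_series s d m = (if form \<Gamma> d (mnorm m) = 0 then scalar (f_coeff s m / of_nat (mfact m)) else 0)"

text \<open>
  By lemma \<open>f_coeff_plus\<close> only multiplicities supported on one ray have nonzero coefficient, and \<open>f_coeff\<close> is
  then a power of \<open>1 / (v - v\<^sup>-\<^sup>1)\<close>.
\<close>

lemma f_series_plus:
  assumes d: "d \<in> Gplus_nz \<Gamma>" and m: "m \<in> mults \<Gamma>" shows "f_series 1 d m = exp_generators d m"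
proof -
  let ?K = "Poly_Mapping.keys m"
  have K: "?K \<subseteq> Gplus_nz \<Gamma>" using m by (simp add: mults_def)
  have "form \<Gamma> d (mnorm m) = 0 \<and> (\<forall>\<alpha>\<in>?K. \<forall>\<beta>\<in>?K. form \<Gamma> \<alpha> \<beta> = 0) \<longleftrightarrow> (\<forall>\<alpha>\<in>?K. form \<Gamma> d \<alpha> = 0)"
  proof
    assume L: "form \<Gamma> d (mnorm m) = 0 \<and> (\<forall>\<alpha>\<in>?K. \<forall>\<beta>\<in>?K. form \<Gamma> \<alpha> \<beta> = 0)"
    show "\<forall>\<alpha>\<in>?K. form \<Gamma> d \<alpha> = 0"
    proof
      fix \<alpha> assume \<alpha>: "\<alpha> \<in> ?K"
      then have "m \<noteq> 0" by auto
      then have nz: "mnorm m \<in> Gplus_nz \<Gamma>" by (rule mnorm_nz[OF m])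
      have "form \<Gamma> \<alpha> (mnorm m) = 0" unfolding form_mnorm using L \<alpha> by (intro sum.neutral) auto
      then have "form \<Gamma> (mnorm m) \<alpha> = 0" "form \<Gamma> (mnorm m) d = 0"
        using L form_skew[of "mnorm m" \<alpha>] form_skew[of "mnorm m" d] by simp_all
      then show "form \<Gamma> d \<alpha> = 0" using form_parallel[OF nz, of d \<alpha>] d K \<alpha> by blast
    qed
  next
    assume R: "\<forall>\<alpha>\<in>?K. form \<Gamma> d \<alpha> = 0"
    have "form \<Gamma> d (mnorm m) = 0" unfolding form_mnorm using R by (intro sum.neutral) auto
    moreover have "form \<Gamma> \<alpha> \<beta> = 0" if "\<alpha> \<in> ?K" "\<beta> \<in> ?K" for \<alpha> \<beta>
      using form_parallel[OF d, of \<alpha> \<beta>] R K that by blast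
    ultimately show "form \<Gamma> d (mnorm m) = 0 \<and> (\<forall>\<alpha>\<in>?K. \<forall>\<beta>\<in>?K. form \<Gamma> \<alpha> \<beta> = 0)" by blast
  qed
  then show ?thesis unfolding f_series_def exp_generators_def f_coeff_plus[OF m]
    by (cases "\<forall>\<alpha>\<in>?K. form \<Gamma> d \<alpha> = 0") auto
qed

definition mps_sum :: "(('g \<Rightarrow>\<^sub>0 nat) \<Rightarrow> motive) \<Rightarrow> ('g \<Rightarrow> motive) \<Rightarrow> 'g \<Rightarrow> motive" where
  "mps_sum g \<Omega> \<gamma> = (\<Sum>m\<in>fibre \<gamma>. scalar (1 / of_nat (mfact m)) * g m * mpow \<Omega> m)"

lemma f_coeff_0: "f_coeff s 0 = 1"
proof -
  have "vertices (0 :: 'g \<Rightarrow>\<^sub>0 nat) = {}" by (simp add: vertices_def)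
  moreover have "arr {} {} = {}" by (simp add: arr_def)
  moreover have "semistable_conf s {} {}" by (simp add: semistable_conf_def closed_in_def)
  ultimately show ?thesis by (simp add: f_coeff_def semistable_sum_def arrows_eq)
qed

text \<open>
  The defining equation of \<open>g\<close> on the ray of \<open>d\<close>, after substitution.
\<close>

lemma ray_factor_mps_sum:
  assumes Z: "stability_function \<Gamma> Z" and g: "abelian_invariants \<Gamma> Z g" and d: "d \<in> Gplus_nz \<Gamma>"
  shows "ray_factor \<Gamma> (mps_sum g \<Omega>) (ray d) = specialize \<Omega> (f_series (-1) d)"
proof -
  let ?G = "\<lambda>m. if m \<in> mults \<Gamma> \<and> plane \<Gamma> (mnorm m) \<in> ray d
       then scalar \<kappa> * (scalar (1 / of_nat (mfact m)) * g m) else 0"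
  have "ray d \<in> rays \<Gamma>" using d by (simp add: rays_eq)
  then have exp: "ser_exp M1.mul ?G = (\<lambda>m. ser_one m +
      (if m \<in> mults \<Gamma> \<and> plane \<Gamma> (mnorm m) \<in> ray d
       then scalar (1 / of_nat (mfact m)) * f_plus \<Gamma> Z m else 0))"
    using g unfolding abelian_invariants_def by simp
  have G0: "?G 0 = 0" using in_ray_iff'[OF d, of 0] by simp
  have Gs: "ray_supported d ?G" using in_ray_iff'[OF d] by (auto simp: ray_supported_def)
  have "specialize \<Omega> ?G \<gamma> = (if plane \<Gamma> \<gamma> \<in> ray d then scalar \<kappa> * mps_sum g \<Omega> \<gamma> else 0)" for \<gamma>
    unfolding specialize_def mps_sum_def sum_distrib_left
    by (cases "plane \<Gamma> \<gamma> \<in> ray d") (auto simp: fibre_def mult.assoc intro!: sum.cong)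
  then have "ray_factor \<Gamma> (mps_sum g \<Omega>) (ray d) = ser_exp T.mul (specialize \<Omega> ?G)"
    unfolding ray_factor_def torus_mult_eq by (intro arg_cong[of _ _ "ser_exp T.mul"] ext) simp
  also have "\<dots> = specialize \<Omega> (ser_exp M1.mul ?G)"
    by (rule specialize_exp[symmetric, OF d Gs G0])
  also have "\<dots> = specialize \<Omega> (f_series (-1) d)"
    unfolding exp
  proof (intro ext specialize_cong)
    fix m assume m: "m \<in> mults \<Gamma>"
    show "ser_one m + (if m \<in> mults \<Gamma> \<and> plane \<Gamma> (mnorm m) \<in> ray d
       then scalar (1 / of_nat (mfact m)) * f_plus \<Gamma> Z m else 0) = f_series (-1) d m"
    proof (cases "m = 0")
      case True
      then show ?thesis using in_ray_iff'[OF d, of 0] by (simp add: f_series_def f_coeff_0 ser_one_def)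
    next
      case False
      then have "plane \<Gamma> (mnorm m) \<in> ray d \<longleftrightarrow> form \<Gamma> d (mnorm m) = 0"
        using in_ray_iff'[OF d, of "mnorm m"] mnorm_nz[OF m] by blast
      then show ?thesis
        using False m by (simp add: f_series_def ser_one_def f_plus_eq[OF Z m] scalar_mult[symmetric])
    qed
  qed
  finally show ?thesis .
qed

lemma foldr_f_series:
  assumes "m \<in> mults \<Gamma>"
  shows "foldr M.mul (map (f_series s) ds) ser_one m = scalar (hn_coeff s ds m)"
  using assms
proof (induction ds arbitrary: m)
  case (Cons d ds)
  have "foldr M.mul (map (f_series s) (d # ds)) ser_one m =
      (\<Sum>q\<in>decomp m. \<tau>m (fst q) (snd q) * f_series s d (fst q) * foldr M.mul (map (f_series s) ds) ser_one (snd q))"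
    by (simp add: M.mul_eq dec_mults[OF Cons.prems])
  also have "\<dots> = (\<Sum>q\<in>decomp m. scalar (case q of (a, b) \<Rightarrow> if form \<Gamma> d (mnorm a) = 0
     then qhalf powi (form \<Gamma> (mnorm a) (mnorm b)) * (f_coeff s a / of_nat (mfact a)) * hn_coeff s ds b else 0))"
  proof (rule sum.cong[OF refl])
    fix q assume q: "q \<in> decomp m"
    obtain a b where ab: "q = (a, b)" by (cases q)
    have "b \<in> mults \<Gamma>" using q Cons.prems ab mults_add_iff[of a b] by auto
    then have IH: "foldr M.mul (map (f_series s) ds) ser_one b = scalar (hn_coeff s ds b)" by (rule Cons.IH)
    show "\<tau>m (fst q) (snd q) * f_series s d (fst q) * foldr M.mul (map (f_series s) ds) ser_one (snd q) =
      scalar (case q of (a, b) \<Rightarrow> if form \<Gamma> d (mnorm a) = 0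
     then qhalf powi (form \<Gamma> (mnorm a) (mnorm b)) * (f_coeff s a / of_nat (mfact a)) * hn_coeff s ds b else 0)"
      unfolding ab fst_conv snd_conv IH by (simp add: f_series_def scalar_mult[symmetric])
  qed
  also have "\<dots> = scalar (hn_coeff s (d # ds) m)" by (simp add: scalar_sum)
  finally show ?case .
qed (simp add: ser_one_def)

lemma specialize_foldr: "specialize \<Omega> (foldr M.mul (map H ds) ser_one) = foldr T.mul (map (\<lambda>d. specialize \<Omega> (H d)) ds) ser_one"
  by (induction ds) (simp_all add: specialize_one specialize_mul)

text \<open>
  Both products are substitutions of products in the torus of multiplicities, whose coefficients are
  \<open>hn_coeff\<close>; those agree because no ray below the degree of \<open>\<gamma>\<close> is missing from either list.
\<close>

lemma wall_crossing_lists: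
  assumes Z: "stability_function \<Gamma> Z" and g: "abelian_invariants \<Gamma> Z g"
    and ds: "sorted_wrt (before 1) ds" "set ds \<subseteq> Gplus_nz \<Gamma>"
      "\<And>\<alpha>. \<alpha> \<in> Gplus_nz \<Gamma> \<Longrightarrow> deg \<alpha> \<le> deg \<gamma> \<Longrightarrow> \<exists>d\<in>set ds. form \<Gamma> d \<alpha> = 0"
    and ds': "sorted_wrt (before (-1)) ds'" "set ds' \<subseteq> Gplus_nz \<Gamma>"
      "\<And>\<alpha>. \<alpha> \<in> Gplus_nz \<Gamma> \<Longrightarrow> deg \<alpha> \<le> deg \<gamma> \<Longrightarrow> \<exists>d\<in>set ds'. form \<Gamma> d \<alpha> = 0"
  shows "foldr T.mul (map (\<lambda>d. ray_factor \<Gamma> \<Omega> (ray d)) ds) ser_one \<gamma> =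
    foldr T.mul (map (\<lambda>d. ray_factor \<Gamma> (mps_sum g \<Omega>) (ray d)) ds') ser_one \<gamma>"
proof -
  have "map (\<lambda>d. ray_factor \<Gamma> \<Omega> (ray d)) ds = map (\<lambda>d. specialize \<Omega> (f_series 1 d)) ds"
  proof (rule map_cong[OF refl])
    fix d assume "d \<in> set ds"
    then have d: "d \<in> Gplus_nz \<Gamma>" using ds(2) by blast
    show "ray_factor \<Gamma> \<Omega> (ray d) = specialize \<Omega> (f_series 1 d)"
      unfolding ray_factor_generators[OF d] by (intro ext specialize_cong f_series_plus[symmetric] d)
  qed
  moreover have "map (\<lambda>d. ray_factor \<Gamma> (mps_sum g \<Omega>) (ray d)) ds' = map (\<lambda>d. specialize \<Omega> (f_series (-1) d)) ds'"
    using ds'(2) by (intro map_cong refl ray_factor_mps_sum[OF Z g]) blast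
  moreover have "specialize \<Omega> (foldr M.mul (map (f_series 1) ds) ser_one) \<gamma> = specialize \<Omega> (foldr M.mul (map (f_series (-1)) ds') ser_one) \<gamma>"
  proof (rule specialize_cong)
    fix m assume m: "m \<in> mults \<Gamma>" "mnorm m = \<gamma>"
    have "hn_coeff 1 ds m = hn_coeff (-1) ds' m"
      using hn_coeff_complete[OF m(1) ds(1,2)] hn_coeff_complete[OF m(1) ds'(1,2)] ds(3) ds'(3) m(2) by simp
    then show "foldr M.mul (map (f_series 1) ds) ser_one m = foldr M.mul (map (f_series (-1)) ds') ser_one m"
      by (simp add: foldr_f_series[OF m(1)])
  qed
  ultimately show ?thesis by (simp only: specialize_foldr)
qed

end

section \<open>Ordered products over all rays\<close>

lemma sorted_wrt_unique:
  assumes asym: "\<And>x y. x \<in> A \<Longrightarrow> y \<in> A \<Longrightarrow> R x y \<Longrightarrow> \<not> R y x"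
    and "sorted_wrt R xs" "sorted_wrt R ys" "set xs = A" "set ys = A"
  shows "xs = ys"
  using assms
proof (induction xs arbitrary: ys A)
  case (Cons x xs)
  obtain y ys' where ys: "ys = y # ys'" using Cons.prems(4,5) by (cases ys) auto
  have "x = y"
  proof (rule ccontr)
    assume "x \<noteq> y"
    then have "y \<in> set xs" "x \<in> set ys'" using Cons.prems(4,5) ys by auto
    then have "R x y" "R y x" using Cons.prems(2,3) ys by auto
    moreover have "x \<in> A" "y \<in> A" using Cons.prems(4,5) ys by auto
    ultimately show False using Cons.prems(1) by blast
  qed
  have irr: "\<not> R x x" using Cons.prems(1)[of x x] Cons.prems(4) by auto
  then have "x \<notin> set xs" "y \<notin> set ys'" using Cons.prems(2,3) ys \<open>x = y\<close> by auto
  then have "set xs = A - {x}" "set ys' = A - {x}" using Cons.prems(4,5) ys \<open>x = y\<close> by auto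
  then have "xs = ys'"
    using Cons.prems(1-3) ys by (intro Cons.IH[of "A - {x}"]) auto
  then show ?case using ys \<open>x = y\<close> by simp
qed simp

lemma sorted_wrt_comparable:
  "sorted_wrt R xs \<Longrightarrow> x \<in> set xs \<Longrightarrow> y \<in> set xs \<Longrightarrow> x \<noteq> y \<Longrightarrow> R x y \<or> R y x"
  by (induction xs) auto

lemma sorted_wrt_distinctI: "sorted_wrt R xs \<Longrightarrow> (\<And>x. \<not> R x x) \<Longrightarrow> distinct xs"
  by (induction xs) auto

context positive_lattice
begin

definition ray_order :: "int \<Rightarrow> ((real \<times> real) set \<Rightarrow> (real \<times> real) set \<Rightarrow> bool) \<Rightarrow> bool" where
  "ray_order s R \<longleftrightarrow> (\<forall>\<alpha>\<in>Gplus_nz \<Gamma>. \<forall>\<beta>\<in>Gplus_nz \<Gamma>. R (ray \<alpha>) (ray \<beta>) \<longleftrightarrow> before s \<alpha> \<beta>)"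

lemma ray_order_clockwise: "ray_order (-1) clockwise"
  by (simp add: ray_order_def clockwise_iff)

lemma ray_order_anticlockwise: "ray_order 1 anticlockwise"
proof -
  have "form \<Gamma> \<beta> \<alpha> < 0 \<longleftrightarrow> form \<Gamma> \<alpha> \<beta> > 0" for \<alpha> \<beta> using form_skew[of \<alpha> \<beta>] by linarith
  then show ?thesis by (simp add: ray_order_def clockwise_iff)
qed

text \<open>
  A new vector splits the list into the vectors before and after it, as no vector of the list is
  on its ray.
\<close>

lemma sorted_representatives:
  assumes s: "s = 1 \<or> s = -1" and B: "finite B" "B \<subseteq> Gplus_nz \<Gamma>"
  shows "\<exists>ds. sorted_wrt (before s) ds \<and> set ds \<subseteq> Gplus_nz \<Gamma> \<and> ray ` set ds = ray ` B"
  using B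
proof (induction B rule: finite_induct)
  case empty
  show ?case by (intro exI[of _ "[]"]) simp
next
  case (insert b B)
  then obtain ds where ds: "sorted_wrt (before s) ds" "set ds \<subseteq> Gplus_nz \<Gamma>" "ray ` set ds = ray ` B"
    by auto
  have b: "b \<in> Gplus_nz \<Gamma>" using insert.prems by auto
  show ?case
  proof (cases "ray b \<in> ray ` B")
    case True
    then show ?thesis using ds by (intro exI[of _ ds]) auto
  next
    case False
    let ?l = "filter (\<lambda>d. before s d b) ds" and ?r = "filter (\<lambda>d. before s b d) ds"
    have dich: "before s d b \<or> before s b d" if d: "d \<in> set ds" for d
    proof -
      have "d \<in> Gplus_nz \<Gamma>" using d ds(2) by blast
      then have "form \<Gamma> b d \<noteq> 0" using ray_eq_iff[OF b, of d] False d ds(3) by auto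
      then show ?thesis using s form_skew[of b d] by auto
    qed
    have "before s d d'" if "d \<in> set ?l" "d' \<in> set ?r" for d d'
      using form_trans_pos[of d b d' s] that b ds(2) by auto
    then have "sorted_wrt (before s) (?l @ b # ?r)"
      using ds(1) by (auto simp: sorted_wrt_append sorted_wrt_filter)
    moreover have "set (?l @ b # ?r) = insert b (set ds)" using dich by auto
    ultimately show ?thesis using ds b by (intro exI[of _ "?l @ b # ?r"]) auto
  qed
qed

lemma finite_ordered_prod_eq:
  assumes R: "ray_order s R" and ds: "sorted_wrt (before s) ds" "set ds \<subseteq> Gplus_nz \<Gamma>"
  shows "finite_ordered_prod \<Gamma> R (ray ` set ds) E = foldr T.mul (map (\<lambda>d. E (ray d)) ds) ser_one"
proof -
  have srt: "sorted_wrt R (map ray ds)"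
    unfolding sorted_wrt_map using ds(1)
    by (rule sorted_wrt_mono_rel[rotated]) (use R ds(2) in \<open>auto simp: ray_order_def\<close>)
  have asym: "\<not> R y x" if xy: "x \<in> ray ` set ds" "y \<in> ray ` set ds" "R x y" for x y
  proof -
    obtain a b where ab: "x = ray a" "y = ray b" "a \<in> Gplus_nz \<Gamma>" "b \<in> Gplus_nz \<Gamma>" using xy(1,2) ds(2) by blast
    then have "before s a b" using xy(3) R unfolding ray_order_def by blast
    then have "\<not> before s b a" using form_skew[of b a] by simp
    then show ?thesis using ab R unfolding ray_order_def by blast
  qed
  have "(THE ls. sorted_wrt R ls \<and> set ls = ray ` set ds) = map ray ds"
    by (rule the_equality) (use srt sorted_wrt_unique[of "ray ` set ds" R] asym in auto)
  then show ?thesis unfolding finite_ordered_prod_def torus_mult_eq by (simp add: comp_def)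
qed

definition unital_on_ray :: "'g \<Rightarrow> ('g \<Rightarrow> motive) \<Rightarrow> bool" where
  "unital_on_ray d E \<longleftrightarrow> E 0 = 1 \<and> (\<forall>\<gamma>\<in>Gplus_nz \<Gamma>. form \<Gamma> d \<gamma> \<noteq> 0 \<longrightarrow> E \<gamma> = 0)"

lemma T_mul_outside: "\<gamma> \<notin> Gplus \<Gamma> \<Longrightarrow> foldr T.mul Es ser_one \<gamma> = 0"
  by (cases Es) (auto simp: T.mul_outside ser_one_def)

text \<open>
  A factor which is \<open>1\<close> up to degree \<open>k\<close> does not change the coefficients up to degree \<open>k\<close>.
\<close>

lemma foldr_filter:
  fixes ds :: "'g list"
  assumes E: "\<And>d. d \<in> set ds \<Longrightarrow> unital_on_ray d (E d)" and ds: "set ds \<subseteq> Gplus_nz \<Gamma>"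
    and P: "\<And>d \<alpha>. d \<in> set ds \<Longrightarrow> \<not> P d \<Longrightarrow> \<alpha> \<in> Gplus_nz \<Gamma> \<Longrightarrow> deg \<alpha> \<le> k \<Longrightarrow> form \<Gamma> d \<alpha> \<noteq> 0"
    and "deg \<gamma> \<le> k"
  shows "foldr T.mul (map E (filter P ds)) ser_one \<gamma> = foldr T.mul (map E ds) ser_one \<gamma>"
  using assms
proof (induction ds arbitrary: \<gamma>)
  case (Cons d ds)
  have IH: "foldr T.mul (map E (filter P ds)) ser_one \<beta> = foldr T.mul (map E ds) ser_one \<beta>" if "deg \<beta> \<le> k" for \<beta>
    using Cons.prems that by (intro Cons.IH) auto
  let ?G = "foldr T.mul (map E ds) ser_one" and ?G' = "foldr T.mul (map E (filter P ds)) ser_one"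
  have le: "deg \<beta> \<le> k" if "\<alpha> \<in> Gplus \<Gamma>" "\<alpha> + \<beta> = \<gamma>" for \<alpha> \<beta>
    using that Cons.prems(4) deg_nonneg[of \<alpha>] deg_add[of \<alpha> \<beta>] by simp
  show ?case
  proof (cases "P d")
    case True
    have "T.mul (E d) ?G' \<gamma> = T.mul (E d) ?G \<gamma>"
      by (rule T.mul_cong) (simp add: IH le)
    with True show ?thesis by simp
  next
    case False
    have d: "unital_on_ray d (E d)" "d \<in> Gplus_nz \<Gamma>" using Cons.prems by auto
    have "T.mul (E d) ?G \<gamma> = T.mul ser_one ?G \<gamma>"
    proof (rule T.mul_cong)
      fix \<alpha> \<beta> assume ab: "\<alpha> \<in> Gplus \<Gamma>" "\<beta> \<in> Gplus \<Gamma>" "\<alpha> + \<beta> = \<gamma>"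
      have "E d \<alpha> = ser_one \<alpha>"
      proof (cases "\<alpha> = 0")
        case True
        then show ?thesis using d(1) by (simp add: unital_on_ray_def ser_one_def)
      next
        case nz: False
        have "deg \<alpha> \<le> k" using ab Cons.prems(4) deg_nonneg[of \<beta>] deg_add[of \<alpha> \<beta>] by simp
        then have "form \<Gamma> d \<alpha> \<noteq> 0" using Cons.prems(3)[of d \<alpha>] False ab(1) nz by simp
        then show ?thesis using d(1) ab(1) nz by (simp add: unital_on_ray_def ser_one_def)
      qed
      then show "\<tau> \<alpha> \<beta> * E d \<alpha> * ?G \<beta> = \<tau> \<alpha> \<beta> * ser_one \<alpha> * ?G \<beta>" by simp
    qed
    also have "\<dots> = ?G \<gamma>"
    proof (cases "\<gamma> \<in> Gplus \<Gamma>")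
      case True
      have "T.mul ser_one ?G \<gamma> = (\<Sum>p\<in>T.dec \<gamma>. \<tau> (fst p) (snd p) * ser_one (fst p) * ?G (snd p))"
        by (rule T.mul_eq)
      also have "\<dots> = (\<Sum>p\<in>T.dec \<gamma>. if p = (0, \<gamma>) then ?G \<gamma> else 0)"
      proof (rule sum.cong[OF refl])
        fix p assume "p \<in> T.dec \<gamma>"
        then obtain a b where p: "p = (a, b)" "a + b = \<gamma>" by auto
        show "\<tau> (fst p) (snd p) * ser_one (fst p) * ?G (snd p) = (if p = (0, \<gamma>) then ?G \<gamma> else 0)"
          by (cases "a = 0") (use p in \<open>auto simp: ser_one_def \<tau>_bimult\<close>)
      qed
      also have "\<dots> = ?G \<gamma>" using True by (subst sum.delta[OF finite_decompositions]) simp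
      finally show ?thesis .
    qed (simp add: T.mul_outside T_mul_outside)
    finally show ?thesis using False IH[OF Cons.prems(4)] by simp
  qed
qed simp

definition bounded_rays :: "'g \<Rightarrow> (real \<times> real) set set" where
  "bounded_rays \<gamma> = ray ` {\<alpha> \<in> Gplus_nz \<Gamma>. deg \<alpha> \<le> deg \<gamma>}"

text \<open>
  The coefficient at \<open>\<gamma>\<close> of a finite product only depends on the factors of rays which contain a
  class of degree at most \<open>deg \<gamma>\<close>. There are finitely many, so the net of partial products is
  eventually constant.
\<close>

lemma ordered_prod_eq:
  assumes s: "s = 1 \<or> s = -1" and R: "ray_order s R"
    and E: "\<And>d. d \<in> Gplus_nz \<Gamma> \<Longrightarrow> unital_on_ray d (E (ray d))"
    and ds: "sorted_wrt (before s) ds" "set ds \<subseteq> Gplus_nz \<Gamma>" "ray ` set ds = bounded_rays \<gamma>"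
  shows "ordered_prod \<Gamma> R (rays \<Gamma>) E \<gamma> = foldr T.mul (map (\<lambda>d. E (ray d)) ds) ser_one \<gamma>"
proof -
  let ?c = "foldr T.mul (map (\<lambda>d. E (ray d)) ds) ser_one \<gamma>"
  have fin: "finite (bounded_rays \<gamma>)" unfolding ds(3)[symmetric] by simp
  have sub: "bounded_rays \<gamma> \<subseteq> rays \<Gamma>" unfolding bounded_rays_def rays_eq by auto
  have val: "finite_ordered_prod \<Gamma> R Y E \<gamma> = ?c" if Y: "finite Y" "bounded_rays \<gamma> \<subseteq> Y" "Y \<subseteq> rays \<Gamma>" for Y
  proof -
    obtain B where B: "B \<subseteq> Gplus_nz \<Gamma>" "finite B" "Y = ray ` B"
      using finite_subset_image[OF Y(1), of ray "Gplus_nz \<Gamma>"] Y(3) unfolding rays_eq by auto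
    obtain ds' where ds': "sorted_wrt (before s) ds'" "set ds' \<subseteq> Gplus_nz \<Gamma>" "ray ` set ds' = Y"
      using sorted_representatives[OF s B(2,1)] B(3) by auto
    let ?P = "\<lambda>d. ray d \<in> bounded_rays \<gamma>"
    have im: "ray ` set (filter ?P ds') = bounded_rays \<gamma>" using ds'(3) Y(2) by auto
    have "finite_ordered_prod \<Gamma> R Y E \<gamma> = foldr T.mul (map (\<lambda>d. E (ray d)) ds') ser_one \<gamma>"
      using finite_ordered_prod_eq[OF R ds'(1,2), of E] unfolding ds'(3) by simp
    also have "\<dots> = foldr T.mul (map (\<lambda>d. E (ray d)) (filter ?P ds')) ser_one \<gamma>"
    proof (rule foldr_filter[symmetric, where k = "deg \<gamma>"])
      show "form \<Gamma> d \<alpha> \<noteq> 0" if "d \<in> set ds'" "ray d \<notin> bounded_rays \<gamma>" "\<alpha> \<in> Gplus_nz \<Gamma>" "deg \<alpha> \<le> deg \<gamma>" for d \<alpha>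
      proof
        assume "form \<Gamma> d \<alpha> = 0"
        then have "ray d = ray \<alpha>" using ray_eq_iff[of d \<alpha>] that(1,3) ds'(2) by blast
        then show False using that(2-4) unfolding bounded_rays_def by blast
      qed
    qed (use E ds'(2) in auto)
    also have "\<dots> = finite_ordered_prod \<Gamma> R (bounded_rays \<gamma>) E \<gamma>"
    proof -
      have "sorted_wrt (before s) (filter ?P ds')" "set (filter ?P ds') \<subseteq> Gplus_nz \<Gamma>"
        using ds'(1,2) by (auto simp: sorted_wrt_filter)
      from finite_ordered_prod_eq[OF R this, of E] show ?thesis unfolding im by simp
    qed
    also have "\<dots> = ?c" using finite_ordered_prod_eq[OF R ds(1,2), of E] unfolding ds(3) by simp
    finally show ?thesis .
  qed
  have ev: "\<forall>\<^sub>F A in finite_subsets_at_top (rays \<Gamma>). finite_ordered_prod \<Gamma> R A E \<gamma> = ?c"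
    unfolding eventually_finite_subsets_at_top using fin sub val by blast
  show ?thesis
    unfolding ordered_prod_def
  proof (rule the_equality)
    show "\<forall>\<^sub>F A in finite_subsets_at_top (rays \<Gamma>). finite_ordered_prod \<Gamma> R A E \<gamma> = ?c" by (rule ev)
    fix c assume "\<forall>\<^sub>F A in finite_subsets_at_top (rays \<Gamma>). finite_ordered_prod \<Gamma> R A E \<gamma> = c"
    with ev have "\<forall>\<^sub>F A in finite_subsets_at_top (rays \<Gamma>). c = ?c"
      by eventually_elim simp
    then show "c = ?c" by simp
  qed
qed

definition ray_list :: "int \<Rightarrow> 'g \<Rightarrow> 'g list \<Rightarrow> bool" where
  "ray_list s \<gamma> ds \<longleftrightarrow> sorted_wrt (before s) ds \<and> set ds \<subseteq> Gplus_nz \<Gamma> \<and> ray ` set ds = bounded_rays \<gamma>"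

lemma ray_listD:
  assumes "ray_list s \<gamma> ds"
  shows "sorted_wrt (before s) ds" "set ds \<subseteq> Gplus_nz \<Gamma>" "ray ` set ds = bounded_rays \<gamma>"
    "\<And>\<alpha>. \<alpha> \<in> Gplus_nz \<Gamma> \<Longrightarrow> deg \<alpha> \<le> deg \<gamma> \<Longrightarrow> \<exists>d\<in>set ds. form \<Gamma> d \<alpha> = 0"
proof -
  show "sorted_wrt (before s) ds" and ds: "set ds \<subseteq> Gplus_nz \<Gamma>" "ray ` set ds = bounded_rays \<gamma>"
    using assms by (simp_all only: ray_list_def)
  fix \<alpha> assume a: "\<alpha> \<in> Gplus_nz \<Gamma>" "deg \<alpha> \<le> deg \<gamma>"
  then have "ray \<alpha> \<in> ray ` set ds" unfolding ds(2) bounded_rays_def by (intro imageI CollectI conjI)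
  then obtain d where d: "ray \<alpha> = ray d" "d \<in> set ds" by (rule imageE)
  have "d \<in> Gplus_nz \<Gamma>" using ds(1) d(2) by (rule subsetD)
  from ray_eq_iff[OF this a(1)] d(1) have "form \<Gamma> d \<alpha> = 0" by simp
  with d(2) show "\<exists>d\<in>set ds. form \<Gamma> d \<alpha> = 0" by (rule bexI[rotated])
qed

lemma ray_list_exists:
  assumes "s = 1 \<or> s = -1" shows "\<exists>ds. ray_list s \<gamma> ds"
proof -
  let ?B = "{\<alpha> \<in> Gplus_nz \<Gamma>. deg \<alpha> \<le> deg \<gamma>}"
  have fin: "finite ?B" by (rule finite_subset[OF _ finite_Gplus_bounded[of "deg \<gamma>"]]) auto
  have sub: "?B \<subseteq> Gplus_nz \<Gamma>" by (rule Collect_subset)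
  from sorted_representatives[OF assms fin sub] show ?thesis
    by (simp only: ray_list_def bounded_rays_def)
qed

definition ray_part :: "('g \<Rightarrow> motive) \<Rightarrow> 'g \<Rightarrow> 'g \<Rightarrow> motive" where
  "ray_part \<Omega> d = (\<lambda>\<gamma>. if plane \<Gamma> \<gamma> \<in> ray d then scalar \<kappa> * \<Omega> \<gamma> else 0)"

lemma ray_factor_eq: "ray_factor \<Gamma> \<Omega> (ray d) = ser_exp T.mul (ray_part \<Omega> d)"
  unfolding ray_factor_def torus_mult_eq ray_part_def ..

lemma ray_part_0: "d \<in> Gplus_nz \<Gamma> \<Longrightarrow> ray_part \<Omega> d 0 = 0"
  using in_ray_iff'[of d 0] by (simp add: ray_part_def)

lemma ray_part_sym:
  assumes "d \<in> Gplus_nz \<Gamma>" "ray_part \<Omega> d \<alpha> \<noteq> 0" "ray_part \<Omega> d \<beta> \<noteq> 0" shows "\<tau> \<alpha> \<beta> = \<tau> \<beta> \<alpha>"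
proof -
  have "plane \<Gamma> \<alpha> \<in> ray d" "plane \<Gamma> \<beta> \<in> ray d" using assms(2,3) unfolding ray_part_def by meson+
  then have "form \<Gamma> \<alpha> \<beta> = 0" using in_ray_iff'[OF assms(1)] form_parallel[OF assms(1), of \<alpha> \<beta>] by blast
  then show ?thesis using form_skew[of \<alpha> \<beta>] by simp
qed

lemma unital_ray_factor:
  assumes d: "d \<in> Gplus_nz \<Gamma>" shows "unital_on_ray d (ray_factor \<Gamma> \<Omega> (ray d))"
proof -
  have 0: "ray_part \<Omega> d 0 = 0" by (rule ray_part_0[OF d])
  have pow: "T.pow (ray_part \<Omega> d) n \<gamma> = 0" if "form \<Gamma> d \<gamma> \<noteq> 0" for n \<gamma>
    using that
  proof (induction n arbitrary: \<gamma>)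
    case 0
    then show ?case by (auto simp: ser_one_def)
  next
    case (Suc n)
    have "T.mul (ray_part \<Omega> d) (T.pow (ray_part \<Omega> d) n) \<gamma> = 0"
    proof (rule T.mul_zeroI)
      fix \<alpha> \<beta> assume ab: "\<alpha> \<in> Gplus \<Gamma>" "\<beta> \<in> Gplus \<Gamma>" "\<alpha> + \<beta> = \<gamma>"
      have "ray_part \<Omega> d \<alpha> = 0 \<or> form \<Gamma> d \<alpha> = 0"
        using in_ray_iff'[OF d, of \<alpha>] by (simp add: ray_part_def)
      moreover have "form \<Gamma> d \<gamma> = form \<Gamma> d \<alpha> + form \<Gamma> d \<beta>" using ab(3) form_add_right by blast
      ultimately have "ray_part \<Omega> d \<alpha> = 0 \<or> T.pow (ray_part \<Omega> d) n \<beta> = 0"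
        using Suc by auto
      then show "\<tau> \<alpha> \<beta> * ray_part \<Omega> d \<alpha> * T.pow (ray_part \<Omega> d) n \<beta> = 0" by auto
    qed
    then show ?case by simp
  qed
  show ?thesis
    unfolding unital_on_ray_def ray_factor_eq
    using T.ser_exp_0[of "ray_part \<Omega> d", OF 0] pow by (auto simp: ser_exp_def)
qed

text \<open>
  In top degree, the product depends on the top coefficients of the factors through their sum. The
  statement avoids subtraction so that both sides stay products.
\<close>

lemma foldr_top_degree:
  fixes ds :: "'g list"
  assumes \<gamma>: "\<gamma> \<in> Gplus_nz \<Gamma>"
    and E: "\<And>d. d \<in> set ds \<Longrightarrow> E d 0 = 1 \<and> E' d 0 = 1"
    and lower: "\<And>d \<alpha>. d \<in> set ds \<Longrightarrow> \<alpha> \<in> Gplus \<Gamma> \<Longrightarrow> deg \<alpha> < deg \<gamma> \<Longrightarrow> E d \<alpha> = E' d \<alpha>"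
  shows "(\<forall>\<alpha>\<in>Gplus \<Gamma>. deg \<alpha> < deg \<gamma> \<longrightarrow> foldr T.mul (map E ds) ser_one \<alpha> = foldr T.mul (map E' ds) ser_one \<alpha>) \<and>
    foldr T.mul (map E ds) ser_one \<gamma> + (\<Sum>d\<leftarrow>ds. E' d \<gamma>) = foldr T.mul (map E' ds) ser_one \<gamma> + (\<Sum>d\<leftarrow>ds. E d \<gamma>)"
  using E lower
proof (induction ds)
  case (Cons d ds)
  let ?G = "foldr T.mul (map E ds) ser_one" and ?G' = "foldr T.mul (map E' ds) ser_one"
  have IH: "\<And>\<alpha>. \<alpha> \<in> Gplus \<Gamma> \<Longrightarrow> deg \<alpha> < deg \<gamma> \<Longrightarrow> ?G \<alpha> = ?G' \<alpha>"
    "?G \<gamma> + (\<Sum>d\<leftarrow>ds. E' d \<gamma>) = ?G' \<gamma> + (\<Sum>d\<leftarrow>ds. E d \<gamma>)"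
    using Cons.IH Cons.prems by auto
  have E0: "E d 0 = 1" "E' d 0 = 1" using Cons.prems(1) by auto
  have G0: "foldr T.mul (map F fs) ser_one 0 = 1" if "\<And>f. f \<in> set fs \<Longrightarrow> F f 0 = 1" for F and fs :: "'g list"
    using that
  proof (induction fs)
    case (Cons f fs)
    have "T.dec 0 = {(0, 0)}"
    proof -
      have "a = 0 \<and> b = 0" if "a \<in> Gplus \<Gamma>" "b \<in> Gplus \<Gamma>" "a + b = 0" for a b
        using that deg_nonneg[of a] deg_nonneg[of b] deg_add[of a b] deg_eq_0[of a] deg_eq_0[of b] by auto
      then show ?thesis by auto
    qed
    then show ?case using Cons by (simp add: T.mul_eq)
  qed (simp add: ser_one_def)
  have split: "T.mul F G \<gamma> = G \<gamma> + F \<gamma> + (\<Sum>p\<in>T.dec \<gamma> - {(0, \<gamma>)} - {(\<gamma>, 0)}. \<tau> (fst p) (snd p) * F (fst p) * G (snd p))"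
    if "F 0 = 1" "G 0 = 1" for F G
  proof -
    have "T.mul F G \<gamma> = G \<gamma> + (\<Sum>p\<in>T.dec \<gamma> - {(0, \<gamma>)}. \<tau> (fst p) (snd p) * F (fst p) * G (snd p))"
      unfolding T.mul_eq using \<gamma> that by (subst sum.remove[OF finite_decompositions, of "(0, \<gamma>)"]) (simp_all add: \<tau>_bimult)
    also have "(\<Sum>p\<in>T.dec \<gamma> - {(0, \<gamma>)}. \<tau> (fst p) (snd p) * F (fst p) * G (snd p)) =
      F \<gamma> + (\<Sum>p\<in>T.dec \<gamma> - {(0, \<gamma>)} - {(\<gamma>, 0)}. \<tau> (fst p) (snd p) * F (fst p) * G (snd p))"
      using \<gamma> that finite_decompositions by (subst sum.remove[of _ "(\<gamma>, 0)"]) (simp_all add: \<tau>_bimult)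
    finally show ?thesis by (simp add: add.assoc)
  qed
  have low: "(\<Sum>p\<in>T.dec \<gamma> - {(0, \<gamma>)} - {(\<gamma>, 0)}. \<tau> (fst p) (snd p) * E d (fst p) * ?G (snd p)) =
    (\<Sum>p\<in>T.dec \<gamma> - {(0, \<gamma>)} - {(\<gamma>, 0)}. \<tau> (fst p) (snd p) * E' d (fst p) * ?G' (snd p))"
  proof (rule sum.cong[OF refl])
    fix p assume p: "p \<in> T.dec \<gamma> - {(0, \<gamma>)} - {(\<gamma>, 0)}"
    obtain a b where ab: "p = (a, b)" by (cases p)
    have m: "a \<in> Gplus \<Gamma>" "b \<in> Gplus \<Gamma>" "a + b = \<gamma>" "a \<noteq> 0" "b \<noteq> 0" using p ab by auto
    then have "deg a < deg \<gamma>" "deg b < deg \<gamma>" using deg_pos[of a] deg_pos[of b] deg_add[of a b] by auto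
    then show "\<tau> (fst p) (snd p) * E d (fst p) * ?G (snd p) = \<tau> (fst p) (snd p) * E' d (fst p) * ?G' (snd p)"
      using IH(1) Cons.prems(2)[of d] m by (simp add: ab)
  qed
  have "T.mul (E d) ?G \<gamma> + (E' d \<gamma> + (\<Sum>d\<leftarrow>ds. E' d \<gamma>)) = T.mul (E' d) ?G' \<gamma> + (E d \<gamma> + (\<Sum>d\<leftarrow>ds. E d \<gamma>))"
  proof -
    have s: "T.mul (E d) ?G \<gamma> = ?G \<gamma> + E d \<gamma> + (\<Sum>p\<in>T.dec \<gamma> - {(0, \<gamma>)} - {(\<gamma>, 0)}. \<tau> (fst p) (snd p) * E d (fst p) * ?G (snd p))"
      by (rule split) (use E0 G0[of ds E] Cons.prems(1) in auto)
    have s': "T.mul (E' d) ?G' \<gamma> = ?G' \<gamma> + E' d \<gamma> + (\<Sum>p\<in>T.dec \<gamma> - {(0, \<gamma>)} - {(\<gamma>, 0)}. \<tau> (fst p) (snd p) * E' d (fst p) * ?G' (snd p))"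
      by (rule split) (use E0 G0[of ds E'] Cons.prems(1) in auto)
    have "x + e + S + (e' + y') = x' + e' + S + (e + y)" if "x + y' = x' + y" for x x' y y' e e' S :: motive
    proof -
      have "x + e + S + (e' + y') = (x + y') + (e + e' + S)" by (simp only: add_ac)
      also have "\<dots> = x' + e' + S + (e + y)" unfolding that by (simp only: add_ac)
      finally show ?thesis .
    qed
    from this[OF IH(2)] show ?thesis unfolding s s' low .
  qed
  moreover have "T.mul (E d) ?G \<alpha> = T.mul (E' d) ?G' \<alpha>" if "\<alpha> \<in> Gplus \<Gamma>" "deg \<alpha> < deg \<gamma>" for \<alpha>
  proof (rule T.mul_cong)
    fix a b assume ab: "a \<in> Gplus \<Gamma>" "b \<in> Gplus \<Gamma>" "a + b = \<alpha>"
    then have "deg a < deg \<gamma>" "deg b < deg \<gamma>" using that deg_nonneg[of a] deg_nonneg[of b] deg_add[of a b] by auto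
    then show "\<tau> a b * E d a * ?G b = \<tau> a b * E' d a * ?G' b"
      using IH(1) Cons.prems(2)[of d] ab by simp
  qed
  ultimately show ?case by simp
qed simp

lemma ray_factor_lower:
  assumes d: "d \<in> Gplus_nz \<Gamma>" and eq: "\<And>\<alpha>. \<alpha> \<in> Gplus_nz \<Gamma> \<Longrightarrow> deg \<alpha> < k \<Longrightarrow> \<Omega> \<alpha> = \<Omega>' \<alpha>"
  shows "\<alpha> \<in> Gplus \<Gamma> \<Longrightarrow> deg \<alpha> < k \<Longrightarrow>
    ray_part \<Omega> d \<alpha> = ray_part \<Omega>' d \<alpha> \<and> ray_factor \<Gamma> \<Omega> (ray d) \<alpha> = ray_factor \<Gamma> \<Omega>' (ray d) \<alpha>"
proof (induction "nat (deg \<alpha>)" arbitrary: \<alpha> rule: less_induct)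
  case less
  have part: "ray_part \<Omega> d \<alpha> = ray_part \<Omega>' d \<alpha>"
    using eq[of \<alpha>] less.prems in_ray_iff'[OF d, of \<alpha>] by (auto simp: ray_part_def)
  show ?case
  proof (cases "\<alpha> = 0")
    case True
    then show ?thesis using part unital_ray_factor[OF d] by (simp add: unital_on_ray_def)
  next
    case False
    have "ser_exp T.mul (ray_part \<Omega> d) \<alpha> = ser_exp T.mul (ray_part \<Omega>' d) \<alpha> \<longleftrightarrow> ray_part \<Omega> d \<alpha> = ray_part \<Omega>' d \<alpha>"
    proof (rule T.exp_injective)
      fix \<beta> assume b: "\<beta> \<in> Gplus \<Gamma>" "deg \<beta> < deg \<alpha>"
      then have "nat (deg \<beta>) < nat (deg \<alpha>)" using deg_nonneg[of \<beta>] by simp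
      then show "ray_part \<Omega> d \<beta> = ray_part \<Omega>' d \<beta> \<and>
          ser_exp T.mul (ray_part \<Omega> d) \<beta> = ser_exp T.mul (ray_part \<Omega>' d) \<beta>"
        using less.hyps[of \<beta>] b less.prems unfolding ray_factor_eq by simp
    qed (use ray_part_0[OF d] ray_part_sym[OF d] less.prems False in auto)
    then show ?thesis using part by (simp add: ray_factor_eq)
  qed
qed

text \<open>
  Induction on the degree: once the exponents agree in lower degree, the coefficients of the products at
  \<open>\<gamma>\<close> differ by those of the factors of the ray of \<open>\<gamma>\<close>, and these by the exponents at \<open>\<gamma>\<close>.
\<close>

lemma factorization_unique:
  assumes "ordered_prod \<Gamma> clockwise (rays \<Gamma>) (ray_factor \<Gamma> \<Omega>) = ordered_prod \<Gamma> clockwise (rays \<Gamma>) (ray_factor \<Gamma> \<Omega>')"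
  shows "\<gamma> \<in> Gplus_nz \<Gamma> \<Longrightarrow> \<Omega> \<gamma> = \<Omega>' \<gamma>"
proof (induction "nat (deg \<gamma>)" arbitrary: \<gamma> rule: less_induct)
  case less
  note \<gamma> = less.prems
  have eq: "\<Omega> \<alpha> = \<Omega>' \<alpha>" if "\<alpha> \<in> Gplus_nz \<Gamma>" "deg \<alpha> < deg \<gamma>" for \<alpha>
    using less.hyps[of \<alpha>] that deg_pos[OF that(1)] by simp
  have lower: "ray_part \<Omega> d \<alpha> = ray_part \<Omega>' d \<alpha> \<and> ray_factor \<Gamma> \<Omega> (ray d) \<alpha> = ray_factor \<Gamma> \<Omega>' (ray d) \<alpha>"
    if "d \<in> Gplus_nz \<Gamma>" "\<alpha> \<in> Gplus \<Gamma>" "deg \<alpha> < deg \<gamma>" for d \<alpha>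
    by (rule ray_factor_lower[OF that(1) _ that(2,3)]) (rule eq)
  obtain ds where "ray_list (-1) \<gamma> ds" using ray_list_exists[OF disjI2[OF refl]] by blast
  note ds = ray_listD[OF this]
  let ?E = "\<lambda>d. ray_factor \<Gamma> \<Omega> (ray d)" and ?E' = "\<lambda>d. ray_factor \<Gamma> \<Omega>' (ray d)"
  have op: "ordered_prod \<Gamma> clockwise (rays \<Gamma>) (ray_factor \<Gamma> W) \<gamma> = foldr T.mul (map (\<lambda>d. ray_factor \<Gamma> W (ray d)) ds) ser_one \<gamma>" for W
    using ordered_prod_eq[where E = "ray_factor \<Gamma> W", OF _ ray_order_clockwise unital_ray_factor ds(1-3)] by simp
  have "foldr T.mul (map ?E ds) ser_one \<gamma> = foldr T.mul (map ?E' ds) ser_one \<gamma>"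
    using op[of \<Omega>] op[of \<Omega>'] assms by simp
  moreover have "foldr T.mul (map ?E ds) ser_one \<gamma> + (\<Sum>d\<leftarrow>ds. ?E' d \<gamma>) = foldr T.mul (map ?E' ds) ser_one \<gamma> + (\<Sum>d\<leftarrow>ds. ?E d \<gamma>)"
  proof (rule foldr_top_degree[THEN conjunct2, OF \<gamma>])
    fix d assume "d \<in> set ds"
    then have d: "d \<in> Gplus_nz \<Gamma>" using ds(2) by blast
    show "?E d 0 = 1 \<and> ?E' d 0 = 1" using unital_ray_factor[OF d] by (simp add: unital_on_ray_def)
    show "?E d \<alpha> = ?E' d \<alpha>" if "\<alpha> \<in> Gplus \<Gamma>" "deg \<alpha> < deg \<gamma>" for \<alpha>
      using lower[OF d that] by blast
  qed
  ultimately have sums: "(\<Sum>d\<leftarrow>ds. ?E' d \<gamma>) = (\<Sum>d\<leftarrow>ds. ?E d \<gamma>)" by simp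
  obtain d where d: "d \<in> set ds" "form \<Gamma> d \<gamma> = 0" using ds(4)[OF \<gamma>] by auto
  have dG: "d \<in> Gplus_nz \<Gamma>" using d ds(2) by blast
  have dist: "distinct ds"
    using ds(1) by (rule sorted_wrt_distinctI) simp
  have other: "ray_factor \<Gamma> W (ray b) \<gamma> = 0" if b: "b \<in> set ds - {d}" for b W
  proof -
    have bG: "b \<in> Gplus_nz \<Gamma>" using b ds(2) by blast
    have "form \<Gamma> b \<gamma> \<noteq> 0"
    proof
      assume "form \<Gamma> b \<gamma> = 0"
      then have "form \<Gamma> \<gamma> b = 0" "form \<Gamma> \<gamma> d = 0" using d(2) form_skew[of \<gamma> b] form_skew[of \<gamma> d] by simp_all
      then have "form \<Gamma> b d = 0" "form \<Gamma> d b = 0" using form_parallel[OF \<gamma>, of b d] form_skew[of d b] bG dG by auto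
      moreover have "before (-1) b d \<or> before (-1) d b"
        using sorted_wrt_comparable[OF ds(1), of b d] d(1) b by blast
      ultimately show False by simp
    qed
    then show ?thesis using unital_ray_factor[OF bG, of W] \<gamma> by (simp add: unital_on_ray_def)
  qed
  have sum: "(\<Sum>b\<leftarrow>ds. ray_factor \<Gamma> W (ray b) \<gamma>) = ray_factor \<Gamma> W (ray d) \<gamma>" for W
  proof -
    have "(\<Sum>b\<leftarrow>ds. ray_factor \<Gamma> W (ray b) \<gamma>) = (\<Sum>b\<in>set ds. ray_factor \<Gamma> W (ray b) \<gamma>)"
      using dist by (simp add: sum_list_distinct_conv_sum_set)
    also have "\<dots> = ray_factor \<Gamma> W (ray d) \<gamma>"
      using d(1) other by (subst sum.remove[of _ d]) simp_all
    finally show ?thesis .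
  qed
  have "ray_factor \<Gamma> \<Omega> (ray d) \<gamma> = ray_factor \<Gamma> \<Omega>' (ray d) \<gamma>" using sums unfolding sum by simp
  moreover have "ser_exp T.mul (ray_part \<Omega> d) \<gamma> = ser_exp T.mul (ray_part \<Omega>' d) \<gamma> \<longleftrightarrow> ray_part \<Omega> d \<gamma> = ray_part \<Omega>' d \<gamma>"
  proof (rule T.exp_injective)
    fix \<beta> assume "\<beta> \<in> Gplus \<Gamma>" "deg \<beta> < deg \<gamma>"
    then show "ray_part \<Omega> d \<beta> = ray_part \<Omega>' d \<beta> \<and>
          ser_exp T.mul (ray_part \<Omega> d) \<beta> = ser_exp T.mul (ray_part \<Omega>' d) \<beta>"
      using lower[OF dG] unfolding ray_factor_eq by simp
  qed (use ray_part_0[OF dG] ray_part_sym[OF dG] \<gamma> in auto)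
  ultimately have "ray_part \<Omega> d \<gamma> = ray_part \<Omega>' d \<gamma>" by (simp add: ray_factor_eq)
  then have "scalar \<kappa> * \<Omega> \<gamma> = scalar \<kappa> * \<Omega>' \<gamma>"
    using in_ray_iff'[OF dG, of \<gamma>] \<gamma> d(2) by (simp add: ray_part_def)
  moreover have "\<kappa> \<noteq> 0" using qhalf_nz(3) by simp
  ultimately show ?case using T.scalar_cancel by blast
qed

lemma ray_factor_cong:
  assumes "l \<in> rays \<Gamma>" "\<And>\<gamma>. \<gamma> \<in> Gplus_nz \<Gamma> \<Longrightarrow> \<Omega> \<gamma> = \<Omega>' \<gamma>"
  shows "ray_factor \<Gamma> \<Omega> l = ray_factor \<Gamma> \<Omega>' l"
proof -
  obtain d where d: "d \<in> Gplus_nz \<Gamma>" "l = ray d" using assms(1) unfolding rays_eq by blast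
  have "ray_part \<Omega> d = ray_part \<Omega>' d"
    using assms(2) in_ray_iff'[OF d(1)] by (intro ext) (auto simp: ray_part_def)
  then show ?thesis by (simp add: d(2) ray_factor_eq)
qed

lemma clockwise_prod_cong:
  assumes "\<And>\<gamma>. \<gamma> \<in> Gplus_nz \<Gamma> \<Longrightarrow> \<Omega> \<gamma> = \<Omega>' \<gamma>"
  shows "ordered_prod \<Gamma> clockwise (rays \<Gamma>) (ray_factor \<Gamma> \<Omega>) = ordered_prod \<Gamma> clockwise (rays \<Gamma>) (ray_factor \<Gamma> \<Omega>')"
proof
  fix \<gamma>
  obtain ds where "ray_list (-1) \<gamma> ds" using ray_list_exists[OF disjI2[OF refl]] by blast
  note ds = ray_listD[OF this]
  have op: "ordered_prod \<Gamma> clockwise (rays \<Gamma>) (ray_factor \<Gamma> W) \<gamma> = foldr T.mul (map (\<lambda>d. ray_factor \<Gamma> W (ray d)) ds) ser_one \<gamma>" for W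
    using ordered_prod_eq[where E = "ray_factor \<Gamma> W", OF _ ray_order_clockwise unital_ray_factor ds(1-3)] by simp
  have "map (\<lambda>d. ray_factor \<Gamma> \<Omega> (ray d)) ds = map (\<lambda>d. ray_factor \<Gamma> \<Omega>' (ray d)) ds"
    using ds(2) assms by (intro map_cong refl ray_factor_cong) (auto simp: rays_eq)
  then show "ordered_prod \<Gamma> clockwise (rays \<Gamma>) (ray_factor \<Gamma> \<Omega>) \<gamma> = ordered_prod \<Gamma> clockwise (rays \<Gamma>) (ray_factor \<Gamma> \<Omega>') \<gamma>"
    unfolding op by (simp only:)
qed

lemma anticlockwise_eq_clockwise_mps_sum:
  assumes Z: "stability_function \<Gamma> Z" and g: "abelian_invariants \<Gamma> Z g"
  shows "ordered_prod \<Gamma> anticlockwise (rays \<Gamma>) (ray_factor \<Gamma> \<Omega>) =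
    ordered_prod \<Gamma> clockwise (rays \<Gamma>) (ray_factor \<Gamma> (mps_sum g \<Omega>))"
proof
  fix \<gamma>
  obtain ds where "ray_list 1 \<gamma> ds" using ray_list_exists[OF disjI1[OF refl]] by blast
  note ds = ray_listD[OF this]
  obtain ds' where "ray_list (-1) \<gamma> ds'" using ray_list_exists[OF disjI2[OF refl]] by blast
  note ds' = ray_listD[OF this]
  have "ordered_prod \<Gamma> anticlockwise (rays \<Gamma>) (ray_factor \<Gamma> \<Omega>) \<gamma> = foldr T.mul (map (\<lambda>d. ray_factor \<Gamma> \<Omega> (ray d)) ds) ser_one \<gamma>"
    using ordered_prod_eq[where E = "ray_factor \<Gamma> \<Omega>", OF _ ray_order_anticlockwise unital_ray_factor ds(1-3)] by simp
  also have "\<dots> = foldr T.mul (map (\<lambda>d. ray_factor \<Gamma> (mps_sum g \<Omega>) (ray d)) ds') ser_one \<gamma>"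
    by (rule wall_crossing_lists[OF Z g ds(1,2,4) ds'(1,2,4)])
  also have "\<dots> = ordered_prod \<Gamma> clockwise (rays \<Gamma>) (ray_factor \<Gamma> (mps_sum g \<Omega>)) \<gamma>"
    using ordered_prod_eq[where E = "ray_factor \<Gamma> (mps_sum g \<Omega>)", OF _ ray_order_clockwise unital_ray_factor ds'(1-3)] by simp
  finally show "ordered_prod \<Gamma> anticlockwise (rays \<Gamma>) (ray_factor \<Gamma> \<Omega>) \<gamma> =
    ordered_prod \<Gamma> clockwise (rays \<Gamma>) (ray_factor \<Gamma> (mps_sum g \<Omega>)) \<gamma>" .
qed

end

theorem theorem1p1:
  fixes \<Gamma> :: "'g::ab_group_add skew_lattice"
    and Z :: "'g \<Rightarrow> complex"
    and \<Omega>p \<Omega>m :: "'g \<Rightarrow> motive"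
    and g :: "('g \<Rightarrow>\<^sub>0 nat) \<Rightarrow> motive"
  assumes "rank2_skew_lattice \<Gamma>"
    and "form \<Gamma> (e1 \<Gamma>) (e2 \<Gamma>) > 0"
    and "stability_function \<Gamma> Z"
    and "abelian_invariants \<Gamma> Z g"
  shows "ordered_prod \<Gamma> clockwise (rays \<Gamma>) (ray_factor \<Gamma> \<Omega>p) =
           ordered_prod \<Gamma> anticlockwise (rays \<Gamma>) (ray_factor \<Gamma> \<Omega>m) \<longleftrightarrow>
         (\<forall>\<gamma>\<in>Gplus_nz \<Gamma>. \<Omega>p \<gamma> =
           (\<Sum>m\<in>{m \<in> mults \<Gamma>. mnorm m = \<gamma>}.
              scalar (1 / of_nat (mfact m)) * g m * (\<Prod>\<alpha>\<in>Poly_Mapping.keys m. \<Omega>m \<alpha> ^ Poly_Mapping.lookup m \<alpha>)))"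
proof -
  interpret positive_lattice \<Gamma>
    using assms(1,2) by unfold_locales
  have "(\<Sum>m\<in>{m \<in> mults \<Gamma>. mnorm m = \<gamma>}.
      scalar (1 / of_nat (mfact m)) * g m * (\<Prod>\<alpha>\<in>Poly_Mapping.keys m. \<Omega>m \<alpha> ^ Poly_Mapping.lookup m \<alpha>)) = mps_sum g \<Omega>m \<gamma>" for \<gamma>
    unfolding mps_sum_def fibre_def mpow_def ..
  then show ?thesis
    unfolding anticlockwise_eq_clockwise_mps_sum[OF assms(3,4)]
    using factorization_unique[of \<Omega>p "mps_sum g \<Omega>m"] clockwise_prod_cong[of \<Omega>p "mps_sum g \<Omega>m"] by auto
qed


end
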